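(* Let $1<p<\infty$ and let $E$ be a UMD space. Let $(X,\mathcal{F},\mu)$ be a $\sigma$-finite measure space, and let $(\mathcal{A}_n)_{n=-\infty}^\infty$ be a refining sequence of countable partitions of $X$ into measurable sets of finite positive measure; let $\mathcal{A}=\bigcup_{n=-\infty}^\infty\mathcal{A}_n$. For each $K\in\mathcal{A}$, let $f_K:X\to E$ be a function that is supported on $K$, constant on each $K'\in\mathrm{child}_{\mathcal{A}}(K)$, and such that $\int_Kf_K\,d\mu=0$. Then $$\frac1{\beta_p(E)}\Big(\mathbb{E}\Big\|\sum_{K\in\mathcal{A}}\epsilon_K1_K(x)f_K(y_K)\Big\|^p_{L^p(d\mu(x)\times d\nu(y);E)}\Big)^{1/p}\le\Big\|\sum_{K\in\mathcal{A}}f_K(x)\Big\|_{L^p(d\mu(x);E)}\le\beta_p(E)\Big(\mathbb{E}\Big\|\sum_{K\in\mathcal{A}}\epsilon_K1_K(x)f_K(y_K)\Big\|^p_{L^p(d\mu(x)\times d\nu(y);E)}\Big)^{1/p}.$$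
   Context: For $K\in\mathcal{A}_n$, $\mathrm{child}_{\mathcal{A}}(K)=\{K'\in\mathcal{A}_{n+1}:K'\subseteq K\}$. For each $K\in\mathcal{A}$, $(Y_K,\mathcal{G}_K,\nu_K)$ is the probability space with $Y_K=K$, $\mathcal{G}_K$ the $\sigma$-algebra generated by $\{K\}\cup\mathrm{child}_{\mathcal{A}}(K)$, and $\nu_K=\mu(K)^{-1}\mu|_K$. $(Y,\mathcal{G},\nu)$ is the product probability space of the spaces $(Y_K,\mathcal{G}_K,\nu_K)_{K\in\mathcal{A}}$, with points $y=(y_K)_{K\in\mathcal{A}}$. $(\epsilon_K)_{K\in\mathcal{A}}$ are independent unbiased random signs, and $\mathbb{E}$ is the expectation over them. UMD constant: a Banach space $E$ is UMD if there is a finite constant $\beta_p(E)$ with $\|\sum_{n=1}^N\epsilon_nd_n\|_{L^p(E)}\le\beta_p(E)\|\sum_{n=1}^Nd_n\|_{L^p(E)}$ for all $E$-valued $L^p$-martingale difference sequences $(d_n)_{n=1}^N$ and all signs $\epsilon_n\in\{-1,+1\}$. *)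

theory Defs
  imports "HOL-Probability.Probability"
begin

section \<open>Banach-space valued functions\<close>

text \<open>
  The distribution's Bochner integral is restricted to second countable spaces. A UMD space need
  not be separable, so strong measurability and the Bochner integral are defined here for
  arbitrary Banach spaces, with the distribution's notion of simple functions and their integral.
\<close>

definition strongly_measurable :: "'a measure \<Rightarrow> ('a \<Rightarrow> 'e::real_normed_vector) \<Rightarrow> bool" where
  "strongly_measurable M f \<longleftrightarrow>
    (\<exists>s. (\<forall>i. simple_function M (s i)) \<and> (\<forall>x\<in>space M. (\<lambda>i. s i x) \<longlonglongrightarrow> f x))"

definition has_strong_integral :: "'a measure \<Rightarrow> ('a \<Rightarrow> 'e::real_normed_vector) \<Rightarrow> 'e \<Rightarrow> bool" where
  "has_strong_integral M f v \<longleftrightarrow> strongly_measurable M f \<and>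
    (\<exists>s. (\<forall>i. Bochner_Integration.simple_bochner_integrable M (s i)) \<and>
      (\<lambda>i. \<integral>\<^sup>+x. ennreal (norm (f x - s i x)) \<partial>M) \<longlonglongrightarrow> 0 \<and>
      (\<lambda>i. Bochner_Integration.simple_bochner_integral M (s i)) \<longlonglongrightarrow> v)"

text \<open>Only used with a positive exponent.\<close>

definition ennreal_powr :: "ennreal \<Rightarrow> real \<Rightarrow> ennreal" where
  "ennreal_powr a r = (if a = \<infinity> then \<infinity> else ennreal (enn2real a powr r))"

definition Lp_norm :: "'a measure \<Rightarrow> real \<Rightarrow> ('a \<Rightarrow> 'e::real_normed_vector) \<Rightarrow> ennreal" where
  "Lp_norm M p f = ennreal_powr (\<integral>\<^sup>+x. ennreal (norm (f x) powr p) \<partial>M) (1 / p)"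

text \<open>
  Sums of families of functions are unordered sums in the Lebesgue-Bochner space: limits, in the
  norm, of the net of finite partial sums. The limit is unique up to null sets, so the choice of
  representative in \<open>Lp_norm_sum\<close> does not matter; the norm of a divergent sum is infinite.
\<close>

definition Lp_has_sum ::
  "'a measure \<Rightarrow> real \<Rightarrow> ('i \<Rightarrow> 'a \<Rightarrow> 'e::real_normed_vector) \<Rightarrow> 'i set \<Rightarrow> ('a \<Rightarrow> 'e) \<Rightarrow> bool" where
  "Lp_has_sum M p g I F \<longleftrightarrow> strongly_measurable M F \<and>
    ((\<lambda>S. Lp_norm M p (\<lambda>x. F x - (\<Sum>i\<in>S. g i x))) \<longlongrightarrow> 0) (finite_subsets_at_top I)"

definition Lp_norm_sum ::
  "'a measure \<Rightarrow> real \<Rightarrow> ('i \<Rightarrow> 'a \<Rightarrow> 'e::real_normed_vector) \<Rightarrow> 'i set \<Rightarrow> ennreal" where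
  "Lp_norm_sum M p g I =
    (if \<exists>F. Lp_has_sum M p g I F then Lp_norm M p (SOME F. Lp_has_sum M p g I F) else \<infinity>)"


section \<open>The UMD property\<close>

text \<open>
  A martingale difference sequence \<open>d 1, \<dots>, d N\<close> with respect to a filtration
  \<open>F 0, \<dots>, F N\<close>. The last condition says that the conditional expectation of \<open>d n\<close> given
  \<open>F (n - 1)\<close> vanishes.
\<close>

definition Lp_martingale_differences ::
  "'a measure \<Rightarrow> real \<Rightarrow> nat \<Rightarrow> (nat \<Rightarrow> 'a \<Rightarrow> 'e::real_normed_vector) \<Rightarrow> bool" where
  "Lp_martingale_differences P p N d \<longleftrightarrow>
    (\<exists>F. (\<forall>n\<le>N. subalgebra P (F n)) \<and> (\<forall>n<N. subalgebra (F (Suc n)) (F n)) \<and>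
      (\<forall>n\<in>{1..N}. strongly_measurable (F n) (d n) \<and> Lp_norm P p (d n) < \<infinity> \<and>
        (\<forall>B\<in>sets (F (n - 1)). has_strong_integral P (\<lambda>x. indicator B x *\<^sub>R d n x) 0)))"

text \<open>
  A formula cannot quantify over the type of the sample space. Here \<open>P\<close> ranges over all
  probability measures, on arbitrary sigma-algebras, with sample type \<^typ>\<open>real\<close>. This includes,
  up to isomorphism modulo null sets, every standard probability space, and larger sample spaces
  do not change the admissible constants.
\<close>

definition UMD_bound :: "'e::banach itself \<Rightarrow> real \<Rightarrow> real \<Rightarrow> bool" where
  "UMD_bound _ p C \<longleftrightarrow> 0 \<le> C \<and>
    (\<forall>(P :: real measure) N (d :: nat \<Rightarrow> real \<Rightarrow> 'e) s.
      prob_space P \<and> Lp_martingale_differences P p N d \<and> (\<forall>n\<in>{1..N}. s n \<in> {-1, 1}) \<longrightarrow>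
      Lp_norm P p (\<lambda>x. \<Sum>n=1..N. (s n :: real) *\<^sub>R d n x) \<le>
        ennreal C * Lp_norm P p (\<lambda>x. \<Sum>n=1..N. d n x))"

definition UMD :: "'e::banach itself \<Rightarrow> real \<Rightarrow> bool" where
  "UMD E p \<longleftrightarrow> (\<exists>C. UMD_bound E p C)"

definition UMD_const :: "'e::banach itself \<Rightarrow> real \<Rightarrow> real" where
  "UMD_const E p = Inf {C. UMD_bound E p C}"


section \<open>Refining partitions\<close>

text \<open>
  The same set may belong to several of the partitions \<open>A n\<close>, and its children depend on \<open>n\<close>.
  Hence the elements of the union of the partitions are represented by pairs \<open>(n, K)\<close> with
  \<open>K \<in> A n\<close>.
\<close>

definition cells :: "(int \<Rightarrow> 'x set set) \<Rightarrow> (int \<times> 'x set) set" where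
  "cells A = (SIGMA n:UNIV. A n)"

definition child :: "(int \<Rightarrow> 'x set set) \<Rightarrow> int \<times> 'x set \<Rightarrow> 'x set set" where
  "child A k = {K' \<in> A (fst k + 1). K' \<subseteq> snd k}"

definition cell_space :: "'x measure \<Rightarrow> (int \<Rightarrow> 'x set set) \<Rightarrow> int \<times> 'x set \<Rightarrow> 'x measure" where
  "cell_space M A k =
    measure_of (snd k) ({snd k} \<union> child A k) (\<lambda>B. emeasure M B / emeasure M (snd k))"

definition random_signs :: "'w measure \<Rightarrow> 'i set \<Rightarrow> ('i \<Rightarrow> 'w \<Rightarrow> real) \<Rightarrow> bool" where
  "random_signs P I \<epsilon> \<longleftrightarrow> prob_space P \<and> prob_space.indep_vars P (\<lambda>_. borel) \<epsilon> I \<and>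
    (\<forall>k\<in>I. (\<forall>\<omega>\<in>space P. \<epsilon> k \<omega> \<in> {-1, 1}) \<and>
      measure P {\<omega> \<in> space P. \<epsilon> k \<omega> = 1} = 1 / 2 \<and>
      measure P {\<omega> \<in> space P. \<epsilon> k \<omega> = -1} = 1 / 2)"

text \<open>
  The \<open>p\<close>-th root of the expectation, over the signs, of the \<open>p\<close>-th power of the norm of the
  decoupled sum.
\<close>

definition decoupled_norm ::
  "'w measure \<Rightarrow> (int \<times> 'x set \<Rightarrow> 'w \<Rightarrow> real) \<Rightarrow> 'x measure \<Rightarrow> (int \<Rightarrow> 'x set set) \<Rightarrow> real \<Rightarrow>
    (int \<times> 'x set \<Rightarrow> 'x \<Rightarrow> 'e::real_normed_vector) \<Rightarrow> ennreal" where
  "decoupled_norm P \<epsilon> M A p f =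
    ennreal_powr
      (\<integral>\<^sup>+\<omega>. ennreal_powr
          (Lp_norm_sum (M \<Otimes>\<^sub>M (\<Pi>\<^sub>M k\<in>cells A. cell_space M A k)) p
            (\<lambda>k (x, y). (\<epsilon> k \<omega> * indicator (snd k) x) *\<^sub>R f k (y k)) (cells A)) p \<partial>P)
      (1 / p)"

end

theory Submission
  imports Defs
begin

text \<open>
  Order the cells of a finite family by their level and replace \<open>f\<^sub>K(x)\<close> by the two differences
  \<open>(f\<^sub>K(x) + 1\<^sub>K(x) f\<^sub>K(y\<^sub>K)) / 2\<close> and \<open>(f\<^sub>K(x) - 1\<^sub>K(x) f\<^sub>K(y\<^sub>K)) / 2\<close>. Conditionally on \<open>x \<in> K\<close> and on
  the past, the child of \<open>K\<close> containing \<open>x\<close> and the one containing \<open>y\<^sub>K\<close> are independent and identically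
  distributed, so this is a martingale difference sequence. Its sum is \<open>\<Sum> f\<^sub>K(x)\<close>, while suitable
  signs turn it into \<open>\<Sum> \<epsilon>\<^sub>K 1\<^sub>K(x) f\<^sub>K(y\<^sub>K)\<close>. Hence the UMD property gives both inequalities for every fixed
  choice of signs, without averaging. Only countably many atoms are involved, so the martingale
  lives on a discrete probability space, which embeds into the real line. Applied to
  differences of partial sums, the finite inequalities show that one of the two infinite sums
  converges if and only if the other does, and they pass to the limit.
\<close>

section \<open>Lebesgue norms of vector-valued functions\<close>

text \<open>Sorting by level fixes the past of a cell \<open>K\<close> on \<open>K\<close> itself:
  each child of a cell of strictly lower level contains \<open>K\<close> or is disjoint from it, and
  another cell of the same level is disjoint from \<open>K\<close>. So on \<open>K\<close> the
  earlier differences say nothing about the child that contains \<open>x\<close>. Each step is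
  revealed in two halves. The unordered pair of children determines the symmetric half, whose mean
  vanishes with that of \<open>f\<close>; the order of the pair then determines the antisymmetric
  half, whose mean vanishes by exchangeability. UMD speaks of probability spaces and of differences
  in Lp. The first puts the finite family on the union of its cells, a set of finite measure;
  normalising it changes both norms by the same factor. The second is not given, as the zero mean
  only provides integrability of each term: it is recovered from finiteness of the norm of the sum,
  by different arguments for the original and the decoupled sum. Since the space may be
  non-separable, measurability is handled through functions with countably many values, whose
  integrals become absolutely convergent series.\<close>

lemma ennreal_powr_ennreal: "0 \<le> a \<Longrightarrow> ennreal_powr (ennreal a) r = ennreal (a powr r)"
  by (simp add: ennreal_powr_def)

lemma ennreal_powr_mono:
  assumes "a \<le> b" "0 < r"
  shows "ennreal_powr a r \<le> ennreal_powr b r"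
proof (cases b)
  case (real y)
  then obtain x where "a = ennreal x" "0 \<le> x" "x \<le> y"
    using assms(1) by (cases a) (auto simp: top_unique)
  with real assms(2) show ?thesis
    by (simp add: ennreal_powr_ennreal ennreal_leI powr_mono2)
qed (simp add: ennreal_powr_def)

lemma ennreal_powr_powr:
  assumes "0 < r" "0 < s"
  shows "ennreal_powr (ennreal_powr a r) s = ennreal_powr a (r * s)"
  by (cases a) (auto simp: ennreal_powr_ennreal powr_powr ennreal_powr_def)

lemma ennreal_powr_one [simp]: "ennreal_powr a 1 = a"
  by (cases a) (auto simp: ennreal_powr_def)

lemma ennreal_powr_mult:
  assumes "0 < r"
  shows "ennreal_powr (a * b) r = ennreal_powr a r * ennreal_powr b r"
proof (cases a)
  case (real x)
  show ?thesis
  proof (cases b)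
    case (real y)
    with \<open>0 \<le> x\<close> \<open>a = ennreal x\<close> show ?thesis
      by (simp add: ennreal_mult[symmetric] ennreal_powr_ennreal powr_mult)
  next
    case top
    with \<open>0 \<le> x\<close> \<open>a = ennreal x\<close> show ?thesis
      by (cases "x = 0") (auto simp: ennreal_powr_def ennreal_mult_top)
  qed
next
  case top
  show ?thesis
  proof (cases b)
    case (real y)
    with top show ?thesis
      by (cases "y = 0") (auto simp: ennreal_powr_def ennreal_top_mult)
  next
    case top' : top
    with top show ?thesis by (auto simp: ennreal_powr_def)
  qed
qed

lemma ennreal_powr_less_top_iff [simp]: "ennreal_powr a r < \<infinity> \<longleftrightarrow> a < \<infinity>"
  by (auto simp: ennreal_powr_def less_top)

text \<open>Trades a finite bound on the norm for a bound on the integral, so that the estimates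
  below never manipulate roots of extended reals.\<close>

lemma Lp_norm_le_iff:
  assumes "0 < p" "0 \<le> c"
  shows "Lp_norm M p f \<le> ennreal c \<longleftrightarrow>
    (\<integral>\<^sup>+x. ennreal (norm (f x) powr p) \<partial>M) \<le> ennreal (c powr p)"
proof
  assume "Lp_norm M p f \<le> ennreal c"
  then have "ennreal_powr (Lp_norm M p f) p \<le> ennreal_powr (ennreal c) p"
    using assms by (intro ennreal_powr_mono)
  then show "(\<integral>\<^sup>+x. ennreal (norm (f x) powr p) \<partial>M) \<le> ennreal (c powr p)"
    using assms by (simp add: Lp_norm_def ennreal_powr_powr ennreal_powr_ennreal)
next
  assume "(\<integral>\<^sup>+x. ennreal (norm (f x) powr p) \<partial>M) \<le> ennreal (c powr p)"
  then have "Lp_norm M p f \<le> ennreal_powr (ennreal (c powr p)) (1/p)"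
    unfolding Lp_norm_def using assms by (intro ennreal_powr_mono) auto
  then show "Lp_norm M p f \<le> ennreal c"
    using assms by (simp add: ennreal_powr_ennreal powr_powr)
qed

lemma Lp_norm_less_top_iff: "Lp_norm M p f < \<infinity> \<longleftrightarrow> (\<integral>\<^sup>+x. ennreal (norm (f x) powr p) \<partial>M) < \<infinity>"
  by (simp add: Lp_norm_def del: infinity_ennreal_def)

lemma Lp_norm_mono:
  assumes "0 < p" "\<And>x. x \<in> space M \<Longrightarrow> norm (f x) \<le> norm (g x)"
  shows "Lp_norm M p f \<le> Lp_norm M p g"
  unfolding Lp_norm_def using assms
  by (intro ennreal_powr_mono nn_integral_mono ennreal_leI powr_mono2) auto

lemma Lp_norm_cong:
  assumes "\<And>x. x \<in> space M \<Longrightarrow> norm (f x) = norm (g x)"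
  shows "Lp_norm M p f = Lp_norm M p g"
  unfolding Lp_norm_def using assms by (simp cong: nn_integral_cong)

lemma Lp_norm_zero [simp]: "Lp_norm M p (\<lambda>x. 0) = 0"
  by (simp add: Lp_norm_def ennreal_powr_def)

text \<open>For positive arguments this is convexity of \<open>powr\<close>; a zero argument is
  settled by \<open>s powr p \<le> s\<close> for \<open>0 < s < 1\<close>.\<close>

lemma powr_convex_weighted:
  fixes x y t p :: real
  assumes "1 \<le> p" "0 < t" "t < 1" "0 \<le> x" "0 \<le> y"
  shows "(t * x + (1 - t) * y) powr p \<le> t * x powr p + (1 - t) * y powr p"
proof -
  have scale: "(s * u) powr p \<le> s * u powr p" if "0 < s" "s < 1" "0 \<le> u" for s u
  proof -
    have "s powr p \<le> s powr 1"
      using that assms(1) by (intro powr_mono') auto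
    with that show ?thesis by (simp add: powr_mult mult_right_mono)
  qed
  consider "x = 0" | "y = 0" | "0 < x" "0 < y" using assms by fastforce
  then show ?thesis
  proof cases
    case 1 with scale[of "1 - t" y] assms show ?thesis by simp
  next
    case 2 with scale[of t x] assms show ?thesis by simp
  next
    case 3
    with convex_onD[OF powr_convex[OF assms(1)], of t y x] assms show ?thesis
      by (simp add: add.commute)
  qed
qed

text \<open>Minkowski's inequality follows from convexity of \<open>t \<mapsto> t powr p\<close> applied pointwise with the
  constant weights \<open>a / (a + b)\<close> and \<open>b / (a + b)\<close>.\<close>

lemma Lp_norm_add_le:
  fixes f g :: "'a \<Rightarrow> 'e::real_normed_vector"
  assumes p: "1 \<le> p" and a: "0 < a" "0 < b"
    and f: "(\<lambda>x. norm (f x)) \<in> borel_measurable M" and g: "(\<lambda>x. norm (g x)) \<in> borel_measurable M"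
    and "Lp_norm M p f \<le> ennreal a" "Lp_norm M p g \<le> ennreal b"
  shows "Lp_norm M p (\<lambda>x. f x + g x) \<le> ennreal (a + b)"
proof -
  note [measurable] = f g
  define t where "t = a / (a + b)"
  have t: "0 < t" "t < 1" "1 - t = b / (a + b)"
    using a by (auto simp: t_def field_simps)
  let ?c = "(a + b) powr p"
  have pw: "norm (f x + g x) powr p \<le>
      ?c * (t * a powr (-p)) * norm (f x) powr p + ?c * ((1 - t) * b powr (-p)) * norm (g x) powr p" for x
  proof -
    have "norm (f x + g x) powr p \<le> (norm (f x) + norm (g x)) powr p"
      using p by (intro powr_mono2 norm_triangle_ineq) auto
    also have "norm (f x) + norm (g x) =
        (a + b) * (t * (norm (f x) / a) + (1 - t) * (norm (g x) / b))"
    proof -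
      have "(a + b) * t = a" "(a + b) * (1 - t) = b"
        using a by (simp add: t_def, simp add: t(3))
      then have "(a + b) * (t * u + (1 - t) * v) = a * u + b * v" for u v
        by (simp only: distrib_left mult.assoc[symmetric])
      from this[of "norm (f x) / a" "norm (g x) / b"] a show ?thesis by simp
    qed
    also have "\<dots> powr p = ?c * (t * (norm (f x) / a) + (1 - t) * (norm (g x) / b)) powr p"
      using a t by (intro powr_mult)
    also have "\<dots> \<le> ?c * (t * (norm (f x) / a) powr p + (1 - t) * (norm (g x) / b) powr p)"
      using a t p by (intro mult_left_mono powr_convex_weighted) auto
    also have "\<dots> = ?c * (t * a powr (-p)) * norm (f x) powr p + ?c * ((1 - t) * b powr (-p)) * norm (g x) powr p"
      using a by (simp add: powr_divide powr_minus field_simps)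
    finally show ?thesis .
  qed
  have I: "(\<integral>\<^sup>+x. ennreal (norm (f x) powr p) \<partial>M) \<le> ennreal (a powr p)"
    "(\<integral>\<^sup>+x. ennreal (norm (g x) powr p) \<partial>M) \<le> ennreal (b powr p)"
    using assms by (auto simp: Lp_norm_le_iff)
  have nonneg: "0 \<le> ?c * (t * a powr (-p))" "0 \<le> ?c * ((1 - t) * b powr (-p))"
    using t(1,2) by (intro mult_nonneg_nonneg; simp)+
  have "(\<integral>\<^sup>+x. ennreal (norm (f x + g x) powr p) \<partial>M) \<le>
     (\<integral>\<^sup>+x. ennreal (?c * (t * a powr (-p))) * ennreal (norm (f x) powr p) +
       ennreal (?c * ((1 - t) * b powr (-p))) * ennreal (norm (g x) powr p) \<partial>M)"
    using pw nonneg
    by (intro nn_integral_mono) (simp flip: ennreal_mult ennreal_plus add: ennreal_leI)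
  also have "\<dots> = ennreal (?c * (t * a powr (-p))) * (\<integral>\<^sup>+x. ennreal (norm (f x) powr p) \<partial>M) +
       ennreal (?c * ((1 - t) * b powr (-p))) * (\<integral>\<^sup>+x. ennreal (norm (g x) powr p) \<partial>M)"
    by (subst nn_integral_add) (auto simp: nn_integral_cmult)
  also have "\<dots> \<le> ennreal (?c * (t * a powr (-p))) * ennreal (a powr p) +
       ennreal (?c * ((1 - t) * b powr (-p))) * ennreal (b powr p)"
    by (intro add_mono mult_left_mono I) auto
  also have "\<dots> = ennreal (?c * (t * a powr (-p)) * a powr p + ?c * ((1 - t) * b powr (-p)) * b powr p)"
    using nonneg by (simp flip: ennreal_mult ennreal_plus)
  also have "?c * (t * a powr (-p)) * a powr p + ?c * ((1 - t) * b powr (-p)) * b powr p = ?c"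
    using a by (simp add: powr_minus field_simps)
  finally show ?thesis
    using a p by (subst Lp_norm_le_iff) auto
qed

text \<open>Enlarging both norms by \<open>e / 2\<close> keeps the weights of the convexity estimate
  positive even if one of the norms is zero.\<close>

lemma Lp_norm_triangle:
  fixes f g :: "'a \<Rightarrow> 'e::real_normed_vector"
  assumes p: "1 \<le> p"
    and f: "(\<lambda>x. norm (f x)) \<in> borel_measurable M" and g: "(\<lambda>x. norm (g x)) \<in> borel_measurable M"
  shows "Lp_norm M p (\<lambda>x. f x + g x) \<le> Lp_norm M p f + Lp_norm M p g"
proof (rule ennreal_le_epsilon)
  fix e :: real assume e: "0 < e" and fin: "Lp_norm M p f + Lp_norm M p g < top"
  obtain a b where ab: "Lp_norm M p f = ennreal a" "Lp_norm M p g = ennreal b" "0 \<le> a" "0 \<le> b"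
    using fin by (cases "Lp_norm M p f"; cases "Lp_norm M p g") auto
  have "Lp_norm M p (\<lambda>x. f x + g x) \<le> ennreal ((a + e / 2) + (b + e / 2))"
    using p f g e ab by (intro Lp_norm_add_le) (auto intro!: ennreal_leI)
  also have "\<dots> = Lp_norm M p f + Lp_norm M p g + ennreal e"
    using e ab by (simp flip: ennreal_plus)
  finally show "Lp_norm M p (\<lambda>x. f x + g x) \<le> Lp_norm M p f + Lp_norm M p g + ennreal e" .
qed

lemma Lp_norm_scaleR:
  assumes "0 < p"  and f: "(\<lambda>x. norm (f x)) \<in> borel_measurable M"
  shows "Lp_norm M p (\<lambda>x. c *\<^sub>R f x) = ennreal \<bar>c\<bar> * Lp_norm M p f"
proof -
  note [measurable] = f
  have "(\<integral>\<^sup>+x. ennreal (norm (c *\<^sub>R f x) powr p) \<partial>M)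
      = (\<integral>\<^sup>+x. ennreal (\<bar>c\<bar> powr p) * ennreal (norm (f x) powr p) \<partial>M)"
    by (simp add: powr_mult ennreal_mult)
  also have "\<dots> = ennreal (\<bar>c\<bar> powr p) * (\<integral>\<^sup>+x. ennreal (norm (f x) powr p) \<partial>M)"
    by (rule nn_integral_cmult) measurable
  finally show ?thesis
    using assms by (simp add: Lp_norm_def ennreal_powr_mult ennreal_powr_ennreal powr_powr)
qed

lemma Lp_norm_finite_add:
  assumes "1 \<le> p"
    and "(\<lambda>x. norm (f x)) \<in> borel_measurable M" "(\<lambda>x. norm (g x)) \<in> borel_measurable M"
    and "Lp_norm M p f < \<infinity>" "Lp_norm M p g < \<infinity>"
  shows "Lp_norm M p (\<lambda>x. f x + g x) < \<infinity>"
proof -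
  have "Lp_norm M p f + Lp_norm M p g \<noteq> \<infinity>"
    using assms(4,5) by (metis ennreal_add_eq_top infinity_ennreal_def less_irrefl)
  with Lp_norm_triangle[OF assms(1-3)] show ?thesis
    unfolding infinity_ennreal_def by (meson le_less_trans less_top)
qed

section \<open>Strong measurability and unconditional convergence\<close>

lemma strongly_measurable_norm:
  assumes "strongly_measurable M f"
  shows "(\<lambda>x. norm (f x)) \<in> borel_measurable M"
proof -
  obtain s where s: "\<And>i. simple_function M (s i)" "\<And>x. x \<in> space M \<Longrightarrow> (\<lambda>i. s i x) \<longlonglongrightarrow> f x"
    using assms by (auto simp: strongly_measurable_def)
  show ?thesis
  proof (rule borel_measurable_LIMSEQ_real)
    show "(\<lambda>i. norm (s i x)) \<longlonglongrightarrow> norm (f x)" if "x \<in> space M" for x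
      using s(2)[OF that] by (rule tendsto_norm)
    show "(\<lambda>x. norm (s i x)) \<in> borel_measurable M" for i
      by (rule borel_measurable_simple_function[OF simple_function_compose1[OF s(1)]])
  qed
qed

lemma strongly_measurable_add:
  assumes "strongly_measurable M f" "strongly_measurable M g"
  shows "strongly_measurable M (\<lambda>x. f x + g x)"
proof -
  obtain s where "\<And>i. simple_function M (s i)" "\<And>x. x \<in> space M \<Longrightarrow> (\<lambda>i. s i x) \<longlonglongrightarrow> f x"
    using assms(1) by (auto simp: strongly_measurable_def)
  moreover obtain t where "\<And>i. simple_function M (t i)" "\<And>x. x \<in> space M \<Longrightarrow> (\<lambda>i. t i x) \<longlonglongrightarrow> g x"
    using assms(2) by (auto simp: strongly_measurable_def)
  ultimately show ?thesis
    unfolding strongly_measurable_def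
    by (intro exI[of _ "\<lambda>i x. s i x + t i x"]) (auto intro: tendsto_add simple_function_compose2)
qed

lemma strongly_measurable_scaleR:
  assumes "strongly_measurable M f"
  shows "strongly_measurable M (\<lambda>x. c *\<^sub>R f x)"
proof -
  obtain s where "\<And>i. simple_function M (s i)" "\<And>x. x \<in> space M \<Longrightarrow> (\<lambda>i. s i x) \<longlonglongrightarrow> f x"
    using assms by (auto simp: strongly_measurable_def)
  then show ?thesis
    unfolding strongly_measurable_def
    by (intro exI[of _ "\<lambda>i x. c *\<^sub>R s i x"]) (auto intro: tendsto_intros simple_function_compose1)
qed

lemma strongly_measurable_diff:
  assumes "strongly_measurable M f" "strongly_measurable M g"
  shows "strongly_measurable M (\<lambda>x. f x - g x)"
  using strongly_measurable_add[OF assms(1) strongly_measurable_scaleR[OF assms(2), of "-1"]] by simp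

section \<open>Functions with countably many measurable fibres\<close>

definition countably_valued :: "'a measure \<Rightarrow> ('a \<Rightarrow> 'b) \<Rightarrow> bool" where
  "countably_valued M u \<longleftrightarrow> u \<in> measurable M (count_space UNIV) \<and> countable (u ` space M)"

text \<open>The composite is glued from the functions \<open>h i (v x)\<close> over the countably
  many values \<open>i\<close> of \<open>u\<close>. Hence \<open>h\<close> can be any function
  between any types, which makes the class stable under all pointwise operations.\<close>

lemma countably_valued_compose2:
  assumes "countably_valued M u" "countably_valued M v"
  shows "countably_valued M (\<lambda>x. h (u x) (v x))"
  unfolding countably_valued_def
proof
  have u: "u \<in> measurable M (count_space (u ` space M))" "countable (u ` space M)"
    using assms(1) unfolding countably_valued_def
    by (auto simp: measurable_count_space_eq_countable intro: measurable_sets[where A="count_space UNIV"])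
  have v: "(\<lambda>x. h i (v x)) \<in> measurable M (count_space UNIV)" for i
    using assms(2)
    by (rule_tac measurable_compose[where N="count_space UNIV"]) (auto simp: countably_valued_def)
  show "(\<lambda>x. h (u x) (v x)) \<in> measurable M (count_space UNIV)"
    using measurable_compose_countable'[OF v u] .
  have "(\<lambda>x. h (u x) (v x)) ` space M \<subseteq> (\<lambda>(a, b). h a b) ` (u ` space M \<times> v ` space M)"
    by auto
  then show "countable ((\<lambda>x. h (u x) (v x)) ` space M)"
    using assms by (elim countable_subset) (auto simp: countably_valued_def)
qed

lemma countably_valued_const [simp]: "countably_valued M (\<lambda>x. c)"
  by (auto simp: countably_valued_def image_constant_conv)

lemma countably_valued_compose: "countably_valued M u \<Longrightarrow> countably_valued M (\<lambda>x. h (u x))"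
  using countably_valued_compose2[of M u "\<lambda>_. ()" "\<lambda>a b. h a"] by simp

lemma countably_valued_sum:
  "finite T \<Longrightarrow> (\<And>i. i \<in> T \<Longrightarrow> countably_valued M (g i)) \<Longrightarrow> countably_valued M (\<lambda>x. \<Sum>i\<in>T. g i x)"
  by (induction rule: finite_induct) (auto intro: countably_valued_compose2)

lemma simple_function_countably_valued:
  assumes "countably_valued M u" "finite (u ` space M)"
  shows "simple_function M u"
  using assms unfolding simple_function_def countably_valued_def
  by (auto intro!: measurable_sets[where A="count_space UNIV"])

text \<open>The diagonal approximation: at stage \<open>k\<close> use the last of the functions \<open>u 0, \<dots>, u (k-1)\<close>
  whose value at the point is among the first \<open>k\<close> values of that function.\<close>

lemma strongly_measurable_limit:
  fixes u :: "nat \<Rightarrow> 'a \<Rightarrow> 'e::real_normed_vector"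
  assumes u: "\<And>j. countably_valued M (u j)"
    and lim: "\<And>x. x \<in> space M \<Longrightarrow> (\<lambda>j. u j x) \<longlonglongrightarrow> G x"
  shows "strongly_measurable M G"
proof -
  define e where "e j = to_nat_on (u j ` space M)" for j
  define r :: "nat \<Rightarrow> nat \<Rightarrow> 'a \<Rightarrow> 'e" where
    "r k = rec_nat (\<lambda>x. 0) (\<lambda>j w x. if e j (u j x) < k then u j x else w x)" for k
  have r0: "r k 0 = (\<lambda>x. 0)" and rS: "r k (Suc j) = (\<lambda>x. if e j (u j x) < k then u j x else r k j x)" for k j
    unfolding r_def by simp_all
  have cv: "countably_valued M (r k j)" for k j
  proof (induction j)
    case (Suc j)
    then show ?case
      unfolding rS using u
      by (intro countably_valued_compose2[of M "u j" "r k j" "\<lambda>a b. if e j a < k then a else b"])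
  qed (simp add: r0)
  have fin: "finite (r k j ` space M)" for k j
  proof (induction j)
    case (Suc j)
    have "inj_on (e j) (u j ` space M)"
      using u[of j] by (auto simp: e_def countably_valued_def)
    then have "finite (e j -` {..<k} \<inter> u j ` space M)"
      by (intro finite_vimage_IntI) auto
    with Suc show ?case
      by (rule_tac finite_subset[of _ "(e j -` {..<k} \<inter> u j ` space M) \<union> r k j ` space M"])
         (auto simp: rS)
  qed (simp add: r0 image_constant_conv)
  \<comment> \<open>Once \<open>u j0\<close> qualifies at stage \<open>k\<close>, it can only be
    overridden by a function with larger index. The diagonal value is therefore at least as late as
    \<open>j0\<close>, which is how the limit of \<open>u\<close> is inherited.\<close>
  have late: "\<exists>i. j0 \<le> i \<and> r k j x = u i x" if "e j0 (u j0 x) < k" "j0 < j" for k j j0 x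
    using that
  proof (induction j)
    case (Suc j)
    then show ?case by (cases "j0 = j") (auto simp: rS less_Suc_eq_le)
  qed simp
  show ?thesis
    unfolding strongly_measurable_def
  proof (intro exI[of _ "\<lambda>k. r k k"] conjI allI ballI)
    show "simple_function M (r k k)" for k
      using cv fin by (rule simple_function_countably_valued)
    fix x assume x: "x \<in> space M"
    show "(\<lambda>k. r k k x) \<longlonglongrightarrow> G x"
    proof (rule LIMSEQ_I)
      fix d :: real assume "0 < d"
      then obtain j0 where j0: "\<And>i. j0 \<le> i \<Longrightarrow> norm (u i x - G x) < d"
        using LIMSEQ_D[OF lim[OF x]] by blast
      show "\<exists>N. \<forall>k\<ge>N. norm (r k k x - G x) < d"
      proof (intro exI allI impI)
        fix k assume "max (Suc j0) (Suc (e j0 (u j0 x))) \<le> k"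
        then have "e j0 (u j0 x) < k" "j0 < k" by auto
        from late[OF this] obtain i where "j0 \<le> i" "r k k x = u i x"
          by blast
        with j0 show "norm (r k k x - G x) < d" by simp
      qed
    qed
  qed
qed

lemma strongly_measurable_countably_valued: "countably_valued M u \<Longrightarrow> strongly_measurable M u"
  by (rule strongly_measurable_limit[of M "\<lambda>_. u"]) auto

lemma countably_valued_norm: "countably_valued M u \<Longrightarrow> (\<lambda>x. norm (u x)) \<in> borel_measurable M"
  by (intro strongly_measurable_norm strongly_measurable_countably_valued)

lemma Lp_norm_sum_le:
  fixes v :: "nat \<Rightarrow> 'a \<Rightarrow> 'e::real_normed_vector"
  assumes "1 \<le> p" "\<And>k. (\<lambda>x. norm (v k x)) \<in> borel_measurable M" "\<And>k. Lp_norm M p (v k) \<le> ennreal (a k)"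
    "\<And>k. 0 \<le> a k"
  shows "Lp_norm M p (\<lambda>x. \<Sum>k<n. norm (v k x)) \<le> ennreal (\<Sum>k<n. a k)"
proof (induction n)
  case (Suc n)
  have "Lp_norm M p (\<lambda>x. (\<Sum>k<n. norm (v k x)) + norm (v n x))
      \<le> Lp_norm M p (\<lambda>x. \<Sum>k<n. norm (v k x)) + Lp_norm M p (\<lambda>x. norm (v n x))"
    using assms(1,2) by (intro Lp_norm_triangle) (auto simp: sum_nonneg)
  also have "Lp_norm M p (\<lambda>x. norm (v n x)) = Lp_norm M p (v n)"
    by (intro Lp_norm_cong) simp
  finally show ?case
    using add_mono[OF Suc assms(3)[of n]] assms(4) by (simp add: sum_nonneg)
qed simp

text \<open>Riesz-Fischer for a rapidly Cauchy sequence: the norms of the increments have partial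
  sums bounded in Lp by the geometric series with sum \<open>2\<close>, so they are summable almost
  everywhere and completeness of the range gives a pointwise limit. Fatou's lemma preserves the
  quantitative bounds.\<close>

lemma Lp_complete:
  fixes u :: "nat \<Rightarrow> 'a \<Rightarrow> 'e::banach"
  assumes p: "1 \<le> p" and u: "\<And>k. countably_valued M (u k)"
    and cauchy: "\<And>k l. k \<le> l \<Longrightarrow> Lp_norm M p (\<lambda>x. u l x - u k x) \<le> ennreal ((1 / 2) ^ k)"
  shows "\<exists>G. strongly_measurable M G \<and> (\<forall>k. Lp_norm M p (\<lambda>x. G x - u k x) \<le> ennreal ((1 / 2) ^ k))"
proof -
  define v where "v k x = u (Suc k) x - u k x" for k x
  have meas[measurable]: "(\<lambda>x. norm (u l x - u k x)) \<in> borel_measurable M" for k l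
    by (rule countably_valued_norm[OF countably_valued_compose2[OF u u, of "\<lambda>a b. a - b"]])
  have v[measurable]: "(\<lambda>x. norm (v k x)) \<in> borel_measurable M" for k
    unfolding v_def by measurable
  have le_two: "Lp_norm M p (\<lambda>x. \<Sum>k<n. norm (v k x)) \<le> ennreal 2" for n
  proof -
    have "Lp_norm M p (\<lambda>x. \<Sum>k<n. norm (v k x)) \<le> ennreal (\<Sum>k<n. (1 / 2) ^ k)"
      using cauchy by (intro Lp_norm_sum_le p v) (auto simp: v_def)
    also have "\<dots> \<le> ennreal 2"
      by (intro ennreal_leI) (simp add: sum_gp_strict)
    finally show ?thesis .
  qed
  have le2: "(\<integral>\<^sup>+x. ennreal ((\<Sum>k<n. norm (v k x)) powr p) \<partial>M) \<le> ennreal (2 powr p)" for n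
    using p iffD1[OF Lp_norm_le_iff le_two[of n]] by (simp add: sum_nonneg)
  have "(\<integral>\<^sup>+x. (SUP n. ennreal ((\<Sum>k<n. norm (v k x)) powr p)) \<partial>M)
      = (SUP n. \<integral>\<^sup>+x. ennreal ((\<Sum>k<n. norm (v k x)) powr p) \<partial>M)"
  proof (intro nn_integral_monotone_convergence_SUP incseq_SucI le_funI ennreal_leI powr_mono2)
    show "(\<lambda>x. ennreal ((\<Sum>k<i. norm (v k x)) powr p)) \<in> borel_measurable M" for i
      by measurable
    show "0 \<le> (\<Sum>k<i. norm (v k x))" for i x
      by (simp add: sum_nonneg)
  qed (use p in simp_all)
  also have "\<dots> \<le> ennreal (2 powr p)"
    using le2 by (intro SUP_least)
  finally have fin: "(\<integral>\<^sup>+x. (SUP n. ennreal ((\<Sum>k<n. norm (v k x)) powr p)) \<partial>M) \<noteq> \<infinity>"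
    by (auto simp: top_unique)
  define C where "C x \<longleftrightarrow> (SUP n. ennreal ((\<Sum>k<n. norm (v k x)) powr p)) \<noteq> \<infinity>" for x
  have Cmeas[measurable]: "Measurable.pred M C"
    unfolding C_def by measurable
  have AE_C: "AE x in M. C x"
    unfolding C_def using fin by (intro nn_integral_PInf_AE) auto
  have conv: "convergent (\<lambda>k. u k x)" if "C x" for x
  proof -
    define S where "S = (SUP n. ennreal ((\<Sum>k<n. norm (v k x)) powr p))"
    have "S \<noteq> top" using that by (simp only: C_def S_def infinity_ennreal_def simp_thms)
    then obtain b where b: "S = ennreal b" "0 \<le> b"
      by (cases S) simp_all
    have bd: "(\<Sum>k<n. norm (v k x)) \<le> b powr (1 / p)" for n
    proof -
      have "ennreal ((\<Sum>k<n. norm (v k x)) powr p) \<le> ennreal b"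
        unfolding b(1)[symmetric] S_def by (rule SUP_upper) simp
      then have "((\<Sum>k<n. norm (v k x)) powr p) powr (1 / p) \<le> b powr (1 / p)"
        using b(2) p by (intro powr_mono2) auto
      with p show ?thesis by (simp add: powr_powr sum_nonneg)
    qed
    have "summable (\<lambda>k. norm (v k x))"
      by (rule bounded_imp_summable[where B="b powr (1 / p)"])
         (use bd[of "Suc n" for n] in \<open>auto simp: lessThan_Suc_atMost\<close>)
    then have "summable (\<lambda>k. v k x)"
      by (rule summable_norm_cancel)
    then have "convergent (\<lambda>n. \<Sum>k<n. v k x)"
      by (simp add: summable_iff_convergent)
    moreover have "(\<Sum>k<n. v k x) = u n x - u 0 x" for n
      unfolding v_def by (rule sum_lessThan_telescope)
    ultimately have "convergent (\<lambda>n. u n x - u 0 x)"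
      by simp
    then have "convergent (\<lambda>n. (u n x - u 0 x) + u 0 x)"
      by (intro convergent_add convergent_const)
    then show ?thesis by simp
  qed
  \<comment> \<open>Strong measurability asks for approximation at every point, not almost
    everywhere; the value \<open>0\<close> off the measurable set \<open>C\<close> achieves
    it.\<close>
  define G where "G x = (if C x then lim (\<lambda>k. u k x) else 0)" for x
  have limG: "(\<lambda>k. u k x) \<longlonglongrightarrow> G x" if "C x" for x
    using conv[OF that] that by (simp add: G_def convergent_LIMSEQ_iff)
  have sm: "strongly_measurable M G"
  proof (rule strongly_measurable_limit)
    show "countably_valued M (\<lambda>x. if C x then u j x else 0)" for j
    proof (rule countably_valued_compose2[of M C "u j" "\<lambda>c a. if c then a else 0"])
      show "countably_valued M C"
        by (simp add: countably_valued_def countable_finite)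
    qed (rule u)
    show "(\<lambda>j. if C x then u j x else 0) \<longlonglongrightarrow> G x" for x
      using limG[of x] by (auto simp: G_def)
  qed
  have "Lp_norm M p (\<lambda>x. G x - u k x) \<le> ennreal ((1 / 2) ^ k)" for k
  proof -
    have "(\<integral>\<^sup>+x. ennreal (norm (G x - u k x) powr p) \<partial>M)
        = (\<integral>\<^sup>+x. liminf (\<lambda>l. ennreal (norm (u l x - u k x) powr p)) \<partial>M)"
    proof (rule nn_integral_cong_AE)
      show "AE x in M. ennreal (norm (G x - u k x) powr p) = liminf (\<lambda>l. ennreal (norm (u l x - u k x) powr p))"
        using AE_C
      proof eventually_elim
        case (elim x)
        have "(\<lambda>l. ennreal (norm (u l x - u k x) powr p)) \<longlonglongrightarrow> ennreal (norm (G x - u k x) powr p)"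
          using p by (intro tendsto_ennrealI tendsto_powr' tendsto_norm tendsto_diff limG elim tendsto_const) auto
        then show ?case
          by (intro lim_imp_Liminf[symmetric]) simp_all
      qed
    qed
    also have "\<dots> \<le> liminf (\<lambda>l. \<integral>\<^sup>+x. ennreal (norm (u l x - u k x) powr p) \<partial>M)"
      by (rule nn_integral_liminf) measurable
    also have "\<dots> \<le> ennreal (((1 / 2) ^ k) powr p)"
    proof (rule Liminf_le)
      show "eventually (\<lambda>l. (\<integral>\<^sup>+x. ennreal (norm (u l x - u k x) powr p) \<partial>M) \<le> ennreal (((1 / 2) ^ k) powr p)) sequentially"
        using eventually_ge_at_top[of k]
      proof eventually_elim
        case (elim l)
        with cauchy[of k l] p show ?case by (subst (asm) Lp_norm_le_iff) auto
      qed
    qed simp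
    finally show ?thesis
      using p by (subst Lp_norm_le_iff) auto
  qed
  with sm show ?thesis by blast
qed

section \<open>Unordered sums in Lp and comparison of two families\<close>

lemma ennreal_tendsto_0I:
  assumes "\<And>e::real. 0 < e \<Longrightarrow> eventually (\<lambda>x. f x \<le> ennreal e) F"
  shows "(f \<longlongrightarrow> 0) F"
proof (rule order_tendstoI)
  fix a :: ennreal assume "0 < a"
  then obtain e :: real where e: "0 < e" "ennreal e < a"
  proof (cases a)
    case (real r)
    with \<open>0 < a\<close> that[of "r / 2"] show ?thesis by (simp add: ennreal_less_iff)
  next
    case top
    with that[of 1] show ?thesis by simp
  qed
  from assms[OF e(1)] show "eventually (\<lambda>x. f x < a) F"
    by eventually_elim (rule le_less_trans[OF _ e(2)])
qed simp

lemma ennreal_tendsto_0D: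
  assumes "(f \<longlongrightarrow> (0::ennreal)) F" "0 < e"
  shows "eventually (\<lambda>x. f x \<le> ennreal e) F"
proof -
  have "eventually (\<lambda>x. f x < ennreal e) F"
    using assms by (intro order_tendstoD(2)[OF assms(1)]) simp
  then show ?thesis by eventually_elim simp
qed

text \<open>Cauchy criterion for unordered sums. The unions \<open>W k\<close> of the first critical
  sets are nested, so their partial sums form a rapidly Cauchy sequence; any finite set above
  \<open>W k\<close> adds only indices outside \<open>T0 k\<close>, hence a tail of size at most
  \<open>(1 / 2) ^ k\<close>.\<close>

lemma Lp_has_sum_exists:
  fixes g :: "'i \<Rightarrow> 'a \<Rightarrow> 'e::banach"
  assumes p: "1 \<le> p" and g: "\<And>i. i \<in> I \<Longrightarrow> countably_valued M (g i)"
    and cauchy: "\<And>e::real. 0 < e \<Longrightarrow> \<exists>T0. finite T0 \<and> T0 \<subseteq> I \<and>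
      (\<forall>T. finite T \<and> T \<subseteq> I \<and> T \<inter> T0 = {} \<longrightarrow> Lp_norm M p (\<lambda>x. \<Sum>i\<in>T. g i x) \<le> ennreal e)"
  shows "\<exists>G. Lp_has_sum M p g I G"
proof -
  have "\<exists>T0. finite T0 \<and> T0 \<subseteq> I \<and>
      (\<forall>T. finite T \<and> T \<subseteq> I \<and> T \<inter> T0 = {} \<longrightarrow> Lp_norm M p (\<lambda>x. \<Sum>i\<in>T. g i x) \<le> ennreal ((1 / 2) ^ k))" for k :: nat
    by (rule cauchy) simp
  then obtain T0 where T0: "\<And>k. finite (T0 k)" "\<And>k. T0 k \<subseteq> I"
    and small: "\<And>k T. finite T \<Longrightarrow> T \<subseteq> I \<Longrightarrow> T \<inter> T0 k = {} \<Longrightarrow>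
      Lp_norm M p (\<lambda>x. \<Sum>i\<in>T. g i x) \<le> ennreal ((1 / 2) ^ k)"
    by metis
  define W where "W k = (\<Union>j\<le>k. T0 j)" for k :: nat
  have W: "finite (W k)" "W k \<subseteq> I" "T0 k \<subseteq> W k" "k \<le> l \<Longrightarrow> W k \<subseteq> W l" for k l
    using T0 by (auto simp: W_def dest: order_trans)
  define u where "u k x = (\<Sum>i\<in>W k. g i x)" for k x
  have cv: "countably_valued M (\<lambda>x. \<Sum>i\<in>T. g i x)" if "finite T" "T \<subseteq> I" for T
    using that g by (intro countably_valued_sum) auto
  have tail: "Lp_norm M p (\<lambda>x. (\<Sum>i\<in>T. g i x) - u k x) \<le> ennreal ((1 / 2) ^ k)"
    if "finite T" "T \<subseteq> I" "W k \<subseteq> T" for T k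
  proof -
    have "(\<Sum>i\<in>T. g i x) - u k x = (\<Sum>i\<in>T - W k. g i x)" for x
      unfolding u_def using that(1,3) by (rule sum_diff[symmetric])
    then show ?thesis
      using small[of "T - W k" k] that W(3)[of k] by auto
  qed
  obtain G where G: "strongly_measurable M G" "\<And>k. Lp_norm M p (\<lambda>x. G x - u k x) \<le> ennreal ((1 / 2) ^ k)"
  proof -
    have "\<exists>G. strongly_measurable M G \<and> (\<forall>k. Lp_norm M p (\<lambda>x. G x - u k x) \<le> ennreal ((1 / 2) ^ k))"
    proof (rule Lp_complete[OF p])
      show "countably_valued M (u k)" for k
        unfolding u_def using W by (intro cv)
      show "Lp_norm M p (\<lambda>x. u l x - u k x) \<le> ennreal ((1 / 2) ^ k)" if "k \<le> l" for k l
        using tail[of "W l" k] W that by (simp add: u_def)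
    qed
    with that show ?thesis by blast
  qed
  have "Lp_has_sum M p g I G"
    unfolding Lp_has_sum_def
  proof (intro conjI G(1) ennreal_tendsto_0I)
    fix e :: real assume "0 < e"
    then obtain k where k: "(1 / 2) ^ k < e / 2"
      using real_arch_pow_inv[of "e / 2" "1 / 2"] by auto
    show "eventually (\<lambda>T. Lp_norm M p (\<lambda>x. G x - (\<Sum>i\<in>T. g i x)) \<le> ennreal e) (finite_subsets_at_top I)"
      unfolding eventually_finite_subsets_at_top
    proof (intro exI[of _ "W k"] conjI W allI impI)
      fix T assume T: "finite T \<and> W k \<subseteq> T \<and> T \<subseteq> I"
      have m1: "(\<lambda>x. norm (G x - u k x)) \<in> borel_measurable M"
        unfolding u_def using W
        by (intro strongly_measurable_norm strongly_measurable_diff G strongly_measurable_countably_valued cv)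
      have cvd: "countably_valued M (\<lambda>x. u k x - (\<Sum>i\<in>T. g i x))"
        unfolding u_def
        using T W by (intro countably_valued_compose2[where h="\<lambda>a b. a - b"] cv) auto
      have "Lp_norm M p (\<lambda>x. (G x - u k x) + (u k x - (\<Sum>i\<in>T. g i x)))
          \<le> Lp_norm M p (\<lambda>x. G x - u k x) + Lp_norm M p (\<lambda>x. u k x - (\<Sum>i\<in>T. g i x))"
        by (rule Lp_norm_triangle[OF p m1 countably_valued_norm[OF cvd]])
      also have "Lp_norm M p (\<lambda>x. u k x - (\<Sum>i\<in>T. g i x)) = Lp_norm M p (\<lambda>x. (\<Sum>i\<in>T. g i x) - u k x)"
        by (intro Lp_norm_cong norm_minus_commute)
      also have "Lp_norm M p (\<lambda>x. G x - u k x) + \<dots> \<le> ennreal ((1 / 2) ^ k) + ennreal ((1 / 2) ^ k)"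
        using T by (intro add_mono G tail) auto
      also have "\<dots> \<le> ennreal e"
        using k by (simp flip: ennreal_plus add: ennreal_leI)
      finally show "Lp_norm M p (\<lambda>x. G x - (\<Sum>i\<in>T. g i x)) \<le> ennreal e"
        by simp
    qed
  qed
  then show ?thesis by blast
qed

text \<open>The finite inequality is applied to one finite set \<open>T\<close> at which both
  partial sums are within \<open>d\<close> of their limits. The total error
  \<open>d + \<beta> * d\<close> explains the choice \<open>d = e / (\<beta> + 1)\<close>.\<close>

lemma Lp_has_sum_compare:
  fixes g :: "'i \<Rightarrow> 'a \<Rightarrow> 'e::banach" and h :: "'i \<Rightarrow> 'b \<Rightarrow> 'e"
  assumes p: "1 \<le> p" and \<beta>: "0 \<le> \<beta>"
    and g: "\<And>i. i \<in> I \<Longrightarrow> countably_valued M (g i)" and h: "\<And>i. i \<in> I \<Longrightarrow> countably_valued N (h i)"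
    and G: "Lp_has_sum M p g I G" and H: "Lp_has_sum N p h I H"
    and le: "\<And>T. finite T \<Longrightarrow> T \<subseteq> I \<Longrightarrow>
      Lp_norm M p (\<lambda>x. \<Sum>i\<in>T. g i x) \<le> ennreal \<beta> * Lp_norm N p (\<lambda>x. \<Sum>i\<in>T. h i x)"
  shows "Lp_norm M p G \<le> ennreal \<beta> * Lp_norm N p H"
proof (rule ennreal_le_epsilon)
  have cvg: "countably_valued M (\<lambda>x. \<Sum>i\<in>T. g i x)" if "finite T" "T \<subseteq> I" for T
    using that g by (intro countably_valued_sum) auto
  have cvh: "countably_valued N (\<lambda>x. \<Sum>i\<in>T. h i x)" if "finite T" "T \<subseteq> I" for T
    using that h by (intro countably_valued_sum) auto
  have mH: "(\<lambda>x. norm (H x - (\<Sum>i\<in>T. h i x))) \<in> borel_measurable N" if "finite T" "T \<subseteq> I" for T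
    using that H
    by (intro strongly_measurable_norm strongly_measurable_diff strongly_measurable_countably_valued[OF cvh])
      (auto simp: Lp_has_sum_def)
  have mH': "(\<lambda>x. norm (H x)) \<in> borel_measurable N"
    using H by (intro strongly_measurable_norm) (auto simp: Lp_has_sum_def)
  have near: "eventually (\<lambda>T. Lp_norm N p (\<lambda>x. H x - (\<Sum>i\<in>T. h i x)) \<le> ennreal e) (finite_subsets_at_top I)"
    if "0 < e" for e
    using H that by (intro ennreal_tendsto_0D) (auto simp: Lp_has_sum_def)
  fix e :: real assume e: "0 < e"
  define d where "d = e / (\<beta> + 1)"
  have d: "0 < d" "d + \<beta> * d \<le> e"
  proof -
    show "0 < d" using e \<beta> by (simp add: d_def)
    have "(\<beta> + 1) * d = e" using \<beta> by (simp add: d_def)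
    then show "d + \<beta> * d \<le> e" by (simp add: distrib_right)
  qed
  have "eventually (\<lambda>T. Lp_norm M p (\<lambda>x. G x - (\<Sum>i\<in>T. g i x)) \<le> ennreal d) (finite_subsets_at_top I)"
    using G d by (intro ennreal_tendsto_0D) (auto simp: Lp_has_sum_def)
  with near[OF d(1)]
  have "eventually (\<lambda>T. Lp_norm M p (\<lambda>x. G x - (\<Sum>i\<in>T. g i x)) \<le> ennreal d \<and>
      Lp_norm N p (\<lambda>x. H x - (\<Sum>i\<in>T. h i x)) \<le> ennreal d \<and> finite T \<and> T \<subseteq> I) (finite_subsets_at_top I)"
    by (intro eventually_conj) (auto simp: eventually_finite_subsets_at_top)
  then obtain T where T: "Lp_norm M p (\<lambda>x. G x - (\<Sum>i\<in>T. g i x)) \<le> ennreal d"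
      "Lp_norm N p (\<lambda>x. H x - (\<Sum>i\<in>T. h i x)) \<le> ennreal d" "finite T" "T \<subseteq> I"
    using eventually_happens'[OF finite_subsets_at_top_neq_bot] by blast
  have "Lp_norm M p (\<lambda>x. (G x - (\<Sum>i\<in>T. g i x)) + (\<Sum>i\<in>T. g i x))
      \<le> Lp_norm M p (\<lambda>x. G x - (\<Sum>i\<in>T. g i x)) + Lp_norm M p (\<lambda>x. \<Sum>i\<in>T. g i x)"
  proof (rule Lp_norm_triangle[OF p _ countably_valued_norm[OF cvg[OF T(3,4)]]])
    show "(\<lambda>x. norm (G x - (\<Sum>i\<in>T. g i x))) \<in> borel_measurable M"
      using T(3,4) G
      by (intro strongly_measurable_norm strongly_measurable_diff strongly_measurable_countably_valued[OF cvg])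
        (auto simp: Lp_has_sum_def)
  qed
  also have "\<dots> \<le> ennreal d + ennreal \<beta> * Lp_norm N p (\<lambda>x. \<Sum>i\<in>T. h i x)"
    by (intro add_mono T le)
  also have "Lp_norm N p (\<lambda>x. \<Sum>i\<in>T. h i x) = Lp_norm N p (\<lambda>x. H x + - (H x - (\<Sum>i\<in>T. h i x)))"
    by simp
  also have "\<dots> \<le> Lp_norm N p H + Lp_norm N p (\<lambda>x. - (H x - (\<Sum>i\<in>T. h i x)))"
    by (rule Lp_norm_triangle[OF p mH'], insert T mH[of T], simp add: norm_minus_commute)
  also have "Lp_norm N p (\<lambda>x. - (H x - (\<Sum>i\<in>T. h i x))) = Lp_norm N p (\<lambda>x. H x - (\<Sum>i\<in>T. h i x))"
    by (intro Lp_norm_cong norm_minus_cancel)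
  also have "\<dots> \<le> ennreal d" by fact
  finally have "Lp_norm M p G \<le> ennreal d + ennreal \<beta> * (Lp_norm N p H + ennreal d)"
    by (simp add: add_mono mult_left_mono)
  also have "\<dots> = ennreal \<beta> * Lp_norm N p H + ennreal (d + \<beta> * d)"
    using d(1) \<beta> by (simp add: ennreal_mult distrib_left ac_simps)
  also have "\<dots> \<le> ennreal \<beta> * Lp_norm N p H + ennreal e"
    using d(2) by (intro add_left_mono ennreal_leI)
  finally show "Lp_norm M p G \<le> ennreal \<beta> * Lp_norm N p H + ennreal e" .
qed

text \<open>The finite inequality on sets that avoid a fixed finite set carries the Cauchy criterion
  from \<open>h\<close> to \<open>g\<close>, so convergence on the right forces convergence on the
  left. This covers the value infinity that \<open>Lp_norm_sum\<close> gives to divergent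
  sums.\<close>

lemma Lp_norm_sum_compare:
  fixes g :: "'i \<Rightarrow> 'a \<Rightarrow> 'e::banach" and h :: "'i \<Rightarrow> 'b \<Rightarrow> 'e"
  assumes p: "1 \<le> p" and \<beta>: "0 \<le> \<beta>"
    and g: "\<And>i. i \<in> I \<Longrightarrow> countably_valued M (g i)" and h: "\<And>i. i \<in> I \<Longrightarrow> countably_valued N (h i)"
    and le: "\<And>T. finite T \<Longrightarrow> T \<subseteq> I \<Longrightarrow>
      Lp_norm M p (\<lambda>x. \<Sum>i\<in>T. g i x) \<le> ennreal \<beta> * Lp_norm N p (\<lambda>x. \<Sum>i\<in>T. h i x)"
  shows "Lp_norm_sum M p g I \<le> ennreal \<beta> * Lp_norm_sum N p h I"
proof -
  have cvh: "countably_valued N (\<lambda>x. \<Sum>i\<in>T. h i x)" if "finite T" "T \<subseteq> I" for T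
    using that h by (intro countably_valued_sum) auto
  show ?thesis
  proof (cases "\<exists>H. Lp_has_sum N p h I H")
    case True
    define H where "H = (SOME H. Lp_has_sum N p h I H)"
    have H: "Lp_has_sum N p h I H"
      unfolding H_def using True by (rule someI_ex)
    have mH: "(\<lambda>x. norm (H x - (\<Sum>i\<in>T. h i x))) \<in> borel_measurable N" if "finite T" "T \<subseteq> I" for T
      using that H
      by (intro strongly_measurable_norm strongly_measurable_diff strongly_measurable_countably_valued[OF cvh])
        (auto simp: Lp_has_sum_def)
    have near: "eventually (\<lambda>T. Lp_norm N p (\<lambda>x. H x - (\<Sum>i\<in>T. h i x)) \<le> ennreal e) (finite_subsets_at_top I)"
      if "0 < e" for e
      using H that by (intro ennreal_tendsto_0D) (auto simp: Lp_has_sum_def)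
    have "\<exists>G. Lp_has_sum M p g I G"
    proof (rule Lp_has_sum_exists[OF p g])
      fix e :: real assume e: "0 < e"
      \<comment> \<open>A tail sum of \<open>h\<close> is the difference of two partial sums, each
        within \<open>d\<close> of \<open>H\<close>, so \<open>\<beta> * (d + d)\<close> has to stay
        below \<open>e\<close>.\<close>
      define d where "d = e / 2 / (\<beta> + 1)"
      have d: "0 < d" "\<beta> * (d + d) \<le> e"
      proof -
        show "0 < d" using e \<beta> by (simp add: d_def)
        have "(\<beta> + 1) * d = e / 2"
          unfolding d_def using \<beta> by (subst times_divide_eq_right) (rule nonzero_mult_div_cancel_left, simp)
        with \<open>0 < d\<close> show "\<beta> * (d + d) \<le> e" by (simp add: distrib_right distrib_left)
      qed
      from near[OF d(1)] obtain T0 where T0: "finite T0" "T0 \<subseteq> I"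
        and *: "\<And>T. finite T \<Longrightarrow> T0 \<subseteq> T \<Longrightarrow> T \<subseteq> I \<Longrightarrow> Lp_norm N p (\<lambda>x. H x - (\<Sum>i\<in>T. h i x)) \<le> ennreal d"
        unfolding eventually_finite_subsets_at_top by metis
      have small: "Lp_norm M p (\<lambda>x. \<Sum>i\<in>T. g i x) \<le> ennreal e" if T: "finite T" "T \<subseteq> I" "T \<inter> T0 = {}" for T
      proof -
        have "Lp_norm N p (\<lambda>x. \<Sum>i\<in>T. h i x)
            = Lp_norm N p (\<lambda>x. (H x - (\<Sum>i\<in>T0. h i x)) + - (H x - (\<Sum>i\<in>T \<union> T0. h i x)))"
          using T T0 by (intro Lp_norm_cong) (simp add: sum.union_disjoint)
        also have "\<dots> \<le> Lp_norm N p (\<lambda>x. H x - (\<Sum>i\<in>T0. h i x)) +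
            Lp_norm N p (\<lambda>x. - (H x - (\<Sum>i\<in>T \<union> T0. h i x)))"
          by (rule Lp_norm_triangle[OF p mH], insert T T0 mH[of "T \<union> T0"], simp_all add: norm_minus_commute)
        also have "Lp_norm N p (\<lambda>x. - (H x - (\<Sum>i\<in>T \<union> T0. h i x))) = Lp_norm N p (\<lambda>x. H x - (\<Sum>i\<in>T \<union> T0. h i x))"
          by (intro Lp_norm_cong norm_minus_cancel)
        also have "Lp_norm N p (\<lambda>x. H x - (\<Sum>i\<in>T0. h i x)) + \<dots> \<le> ennreal d + ennreal d"
          using T T0 by (intro add_mono *) auto
        finally have "ennreal \<beta> * Lp_norm N p (\<lambda>x. \<Sum>i\<in>T. h i x) \<le> ennreal \<beta> * (ennreal d + ennreal d)"
          by (rule mult_left_mono) simp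
        also have "\<dots> \<le> ennreal e"
          using d \<beta> by (simp flip: ennreal_plus ennreal_mult add: ennreal_leI)
        finally show ?thesis
          using le[OF T(1,2)] by (rule order_trans[rotated])
      qed
      show "\<exists>T0. finite T0 \<and> T0 \<subseteq> I \<and>
          (\<forall>T. finite T \<and> T \<subseteq> I \<and> T \<inter> T0 = {} \<longrightarrow> Lp_norm M p (\<lambda>x. \<Sum>i\<in>T. g i x) \<le> ennreal e)"
        using T0 small by (intro exI[of _ T0] conjI allI impI) simp_all
    qed
    note exG = this
    define G where "G = (SOME G. Lp_has_sum M p g I G)"
    have G: "Lp_has_sum M p g I G"
      unfolding G_def using exG by (rule someI_ex)
    have "Lp_norm M p G \<le> ennreal \<beta> * Lp_norm N p H"
      by (rule Lp_has_sum_compare[OF p \<beta> g h G H le])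
    with True exG show ?thesis
      by (simp add: Lp_norm_sum_def G_def H_def)
  next
    case False
    show ?thesis
    \<comment> \<open>For \<open>\<beta> = 0\<close> the right side is
      \<open>0 * \<infinity> = 0\<close>, so the sum of \<open>g\<close> has to be null: its finite
      sums are, and comparison with the zero family transfers this to the representative picked by
      \<open>SOME\<close>. Otherwise the right side is infinite.\<close>
    proof (cases "\<beta> = 0")
      case True
      then have 0: "Lp_norm M p (\<lambda>x. \<Sum>i\<in>T. g i x) = 0" if "finite T" "T \<subseteq> I" for T
        using le[OF that] by simp
      have "Lp_has_sum M p g I (\<lambda>x. 0)"
        unfolding Lp_has_sum_def
      proof (intro conjI ennreal_tendsto_0I)
        fix e :: real assume "0 < e"
        have "Lp_norm M p (\<lambda>x. 0 - (\<Sum>i\<in>T. g i x)) \<le> ennreal e" if "finite T" "T \<subseteq> I" for T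
          using 0[OF that] by (subst Lp_norm_cong[of M _ "\<lambda>x. \<Sum>i\<in>T. g i x"]) auto
        then show "eventually (\<lambda>T. Lp_norm M p (\<lambda>x. 0 - (\<Sum>i\<in>T. g i x)) \<le> ennreal e) (finite_subsets_at_top I)"
          by (intro eventually_finite_subsets_at_top_weakI)
      qed (simp add: strongly_measurable_countably_valued)
      then have ex: "\<exists>G. Lp_has_sum M p g I G" by (rule exI[of _ "\<lambda>x. 0"])
      define G where "G = (SOME G. Lp_has_sum M p g I G)"
      have G: "Lp_has_sum M p g I G"
        unfolding G_def using ex by (rule someI_ex)
      have "Lp_norm M p G \<le> ennreal \<beta> * Lp_norm M p (\<lambda>x. 0 :: 'e)"
      proof (rule Lp_has_sum_compare[OF p \<beta> g _ G, where h="\<lambda>i x. 0"])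
        show "Lp_has_sum M p (\<lambda>i x. 0) I (\<lambda>x. 0 :: 'e)"
          by (simp add: Lp_has_sum_def strongly_measurable_countably_valued)
      qed (simp_all add: 0)
      with ex show ?thesis
        by (simp add: Lp_norm_sum_def G_def)
    next
      case False
      with \<open>\<nexists>H. _ H\<close> \<beta> show ?thesis
        by (simp add: Lp_norm_sum_def ennreal_mult_top)
    qed
  qed
qed

section \<open>Strong integrals of countably valued functions\<close>

text \<open>The integrand is written as a sum over the possible values of \<open>\<tau>\<close>;
  Tonelli's theorem for a countable counting measure then exchanges sum and integral.\<close>

lemma nn_integral_fibers:
  assumes \<tau>: "countably_valued M \<tau>" and T: "countable T" "\<tau> ` space M \<subseteq> T"
  shows "(\<integral>\<^sup>+x. h (\<tau> x) \<partial>M) = (\<integral>\<^sup>+t. h t * emeasure M (\<tau> -` {t} \<inter> space M) \<partial>count_space T)"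
proof -
  have fib[measurable]: "\<tau> -` {t} \<inter> space M \<in> sets M" for t
    using \<tau> by (auto simp: countably_valued_def intro: measurable_sets)
  have "(\<integral>\<^sup>+x. h (\<tau> x) \<partial>M) = (\<integral>\<^sup>+x. \<integral>\<^sup>+t. h t * indicator (\<tau> -` {t} \<inter> space M) x \<partial>count_space T \<partial>M)"
  proof (rule nn_integral_cong)
    fix x assume "x \<in> space M"
    then have "(\<integral>\<^sup>+t. h t * indicator (\<tau> -` {t} \<inter> space M) x \<partial>count_space T)
        = (\<Sum>t\<in>{\<tau> x}. h t * indicator (\<tau> -` {t} \<inter> space M) x)"
      using T by (intro nn_integral_count_space') (auto split: split_indicator)
    with \<open>x \<in> space M\<close> show "h (\<tau> x) = (\<integral>\<^sup>+t. h t * indicator (\<tau> -` {t} \<inter> space M) x \<partial>count_space T)"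
      by simp
  qed
  also have "\<dots> = (\<integral>\<^sup>+t. \<integral>\<^sup>+x. h t * indicator (\<tau> -` {t} \<inter> space M) x \<partial>M \<partial>count_space T)"
    by (rule nn_integral_count_space_nn_integral[OF T(1)]) measurable
  also have "\<dots> = (\<integral>\<^sup>+t. h t * emeasure M (\<tau> -` {t} \<inter> space M) \<partial>count_space T)"
    by (intro nn_integral_cong nn_integral_cmult_indicator fib)
  finally show ?thesis .
qed

text \<open>Two simple approximations of one function have integrals that differ by at most the two
  approximation errors. This makes the strong integral well defined.\<close>

lemma simple_bochner_integral_dist_le:
  fixes s t :: "'a \<Rightarrow> 'e::real_normed_vector"
  assumes f: "strongly_measurable M f"
    and s: "Bochner_Integration.simple_bochner_integrable M s"
    and t: "Bochner_Integration.simple_bochner_integrable M t"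
  shows "ennreal (norm (Bochner_Integration.simple_bochner_integral M s - Bochner_Integration.simple_bochner_integral M t))
    \<le> (\<integral>\<^sup>+x. ennreal (norm (f x - s x)) \<partial>M) + (\<integral>\<^sup>+x. ennreal (norm (f x - t x)) \<partial>M)"
proof -
  have simp: "simple_function M s" "simple_function M t"
    using s t by (auto elim: Bochner_Integration.simple_bochner_integrable.cases)
  have sm: "strongly_measurable M u" if "simple_function M u" for u :: "'a \<Rightarrow> 'e"
    unfolding strongly_measurable_def using that by (intro exI[of _ "\<lambda>_. u"]) auto
  have [measurable]: "(\<lambda>x. norm (f x - s x)) \<in> borel_measurable M" "(\<lambda>x. norm (f x - t x)) \<in> borel_measurable M"
    by (intro strongly_measurable_norm strongly_measurable_diff f sm[OF simp(1)] sm[OF simp(2)])+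
  have "ennreal (norm (Bochner_Integration.simple_bochner_integral M s - Bochner_Integration.simple_bochner_integral M t))
      = norm (Bochner_Integration.simple_bochner_integral M (\<lambda>x. s x - t x))"
    using s t by (subst simple_bochner_integral_diff) auto
  also have "\<dots> \<le> Bochner_Integration.simple_bochner_integral M (\<lambda>x. norm (s x - t x))"
    using simple_bochner_integrable_compose2[of "(-)" M s t] s t
    by (auto intro!: simple_bochner_integral_norm_bound)
  also have "\<dots> = (\<integral>\<^sup>+x. norm (s x - t x) \<partial>M)"
    using simple_bochner_integrable_compose2[of "\<lambda>x y. norm (x - y)" M s t] s t
    by (auto intro!: simple_bochner_integral_eq_nn_integral)
  also have "\<dots> \<le> (\<integral>\<^sup>+x. ennreal (norm (f x - s x)) + ennreal (norm (f x - t x)) \<partial>M)"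
  proof (rule nn_integral_mono)
    show "ennreal (norm (s x - t x)) \<le> ennreal (norm (f x - s x)) + ennreal (norm (f x - t x))" for x
      using norm_triangle_ineq[of "s x - f x" "f x - t x"]
      by (simp flip: ennreal_plus add: ennreal_leI norm_minus_commute)
  qed
  also have "\<dots> = (\<integral>\<^sup>+x. ennreal (norm (f x - s x)) \<partial>M) + (\<integral>\<^sup>+x. ennreal (norm (f x - t x)) \<partial>M)"
    by (rule nn_integral_add) auto
  finally show ?thesis .
qed

text \<open>Also a tool for computing: evaluating one integral over two different partitions into
  fibres identifies the two resulting series.\<close>

lemma has_strong_integral_unique:
  assumes "has_strong_integral M f v" "has_strong_integral M f w"
  shows "v = w"
proof -
  obtain s where f: "strongly_measurable M f"
    and s: "\<And>i. Bochner_Integration.simple_bochner_integrable M (s i)"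
      "(\<lambda>i. \<integral>\<^sup>+x. ennreal (norm (f x - s i x)) \<partial>M) \<longlonglongrightarrow> 0"
      "(\<lambda>i. Bochner_Integration.simple_bochner_integral M (s i)) \<longlonglongrightarrow> v"
    using assms(1) unfolding has_strong_integral_def by blast
  obtain t where
      t: "\<And>i. Bochner_Integration.simple_bochner_integrable M (t i)"
      "(\<lambda>i. \<integral>\<^sup>+x. ennreal (norm (f x - t i x)) \<partial>M) \<longlonglongrightarrow> 0"
      "(\<lambda>i. Bochner_Integration.simple_bochner_integral M (t i)) \<longlonglongrightarrow> w"
    using assms(2) unfolding has_strong_integral_def by blast
  let ?d = "\<lambda>i. ennreal (norm (Bochner_Integration.simple_bochner_integral M (s i) -
      Bochner_Integration.simple_bochner_integral M (t i)))"
  have "?d \<longlonglongrightarrow> ennreal (norm (v - w))"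
    by (intro tendsto_ennrealI tendsto_norm tendsto_diff s t)
  moreover have "?d \<longlonglongrightarrow> 0"
  proof (rule tendsto_sandwich[OF always_eventually always_eventually tendsto_const])
    show "\<forall>i. ?d i \<le> (\<integral>\<^sup>+x. ennreal (norm (f x - s i x)) \<partial>M) + (\<integral>\<^sup>+x. ennreal (norm (f x - t i x)) \<partial>M)"
      by (intro allI simple_bochner_integral_dist_le f s t)
    show "(\<lambda>i. (\<integral>\<^sup>+x. ennreal (norm (f x - s i x)) \<partial>M) + (\<integral>\<^sup>+x. ennreal (norm (f x - t i x)) \<partial>M)) \<longlonglongrightarrow> 0"
      using tendsto_add[OF s(2) t(2)] by simp
  qed simp
  ultimately have "ennreal (norm (v - w)) = 0"
    by (rule LIMSEQ_unique)
  then show ?thesis by (simp add: ennreal_eq_0_iff)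
qed

lemma has_strong_integral_add:
  fixes f g :: "'a \<Rightarrow> 'e::real_normed_vector"
  assumes f: "has_strong_integral M f v" and g: "has_strong_integral M g w"
  shows "has_strong_integral M (\<lambda>x. f x + g x) (v + w)"
proof -
  obtain s where sf: "strongly_measurable M f"
    and s: "\<And>i. Bochner_Integration.simple_bochner_integrable M (s i)"
      "(\<lambda>i. \<integral>\<^sup>+x. ennreal (norm (f x - s i x)) \<partial>M) \<longlonglongrightarrow> 0"
      "(\<lambda>i. Bochner_Integration.simple_bochner_integral M (s i)) \<longlonglongrightarrow> v"
    using f unfolding has_strong_integral_def by blast
  obtain t where sg: "strongly_measurable M g"
    and t: "\<And>i. Bochner_Integration.simple_bochner_integrable M (t i)"
      "(\<lambda>i. \<integral>\<^sup>+x. ennreal (norm (g x - t i x)) \<partial>M) \<longlonglongrightarrow> 0"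
      "(\<lambda>i. Bochner_Integration.simple_bochner_integral M (t i)) \<longlonglongrightarrow> w"
    using g unfolding has_strong_integral_def by blast
  have sm: "strongly_measurable M u" if "Bochner_Integration.simple_bochner_integrable M u" for u :: "'a \<Rightarrow> 'e"
    unfolding strongly_measurable_def using that
    by (intro exI[of _ "\<lambda>_. u"]) (auto elim: Bochner_Integration.simple_bochner_integrable.cases)
  have [measurable]: "(\<lambda>x. norm (f x - s i x)) \<in> borel_measurable M" "(\<lambda>x. norm (g x - t i x)) \<in> borel_measurable M" for i
    by (intro strongly_measurable_norm strongly_measurable_diff sf sg sm[OF s(1)] sm[OF t(1)])+
  show ?thesis
    unfolding has_strong_integral_def
  proof (intro conjI exI[of _ "\<lambda>i x. s i x + t i x"] allI)
    show "strongly_measurable M (\<lambda>x. f x + g x)"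
      by (intro strongly_measurable_add sf sg)
    show "Bochner_Integration.simple_bochner_integrable M (\<lambda>x. s i x + t i x)" for i
      by (rule simple_bochner_integrable_compose2[of "(+)", OF _ s(1) t(1)]) simp
    show "(\<lambda>i. Bochner_Integration.simple_bochner_integral M (\<lambda>x. s i x + t i x)) \<longlonglongrightarrow> v + w"
      using tendsto_add[OF s(3) t(3)] by (simp add: simple_bochner_integral_add s t)
    show "(\<lambda>i. \<integral>\<^sup>+x. ennreal (norm (f x + g x - (s i x + t i x))) \<partial>M) \<longlonglongrightarrow> 0"
    proof (rule tendsto_sandwich[OF always_eventually always_eventually tendsto_const])
      show "\<forall>i. (\<integral>\<^sup>+x. ennreal (norm (f x + g x - (s i x + t i x))) \<partial>M) \<le>
          (\<integral>\<^sup>+x. ennreal (norm (f x - s i x)) \<partial>M) + (\<integral>\<^sup>+x. ennreal (norm (g x - t i x)) \<partial>M)"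
      proof
        fix i
        have "(\<integral>\<^sup>+x. ennreal (norm (f x + g x - (s i x + t i x))) \<partial>M) \<le>
            (\<integral>\<^sup>+x. ennreal (norm (f x - s i x)) + ennreal (norm (g x - t i x)) \<partial>M)"
          by (intro nn_integral_mono) (simp flip: ennreal_plus add: ennreal_leI norm_diff_triangle_ineq)
        also have "\<dots> = (\<integral>\<^sup>+x. ennreal (norm (f x - s i x)) \<partial>M) + (\<integral>\<^sup>+x. ennreal (norm (g x - t i x)) \<partial>M)"
          by (rule nn_integral_add) auto
        finally show "(\<integral>\<^sup>+x. ennreal (norm (f x + g x - (s i x + t i x))) \<partial>M) \<le>
          (\<integral>\<^sup>+x. ennreal (norm (f x - s i x)) \<partial>M) + (\<integral>\<^sup>+x. ennreal (norm (g x - t i x)) \<partial>M)" .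
      qed
      show "(\<lambda>i. (\<integral>\<^sup>+x. ennreal (norm (f x - s i x)) \<partial>M) + (\<integral>\<^sup>+x. ennreal (norm (g x - t i x)) \<partial>M)) \<longlonglongrightarrow> 0"
        using tendsto_add[OF s(2) t(2)] by simp
    qed simp
  qed
qed

lemma has_strong_integral_scaleR:
  fixes f :: "'a \<Rightarrow> 'e::real_normed_vector"
  assumes f: "has_strong_integral M f v"
  shows "has_strong_integral M (\<lambda>x. c *\<^sub>R f x) (c *\<^sub>R v)"
proof -
  obtain s where sf: "strongly_measurable M f"
    and s: "\<And>i. Bochner_Integration.simple_bochner_integrable M (s i)"
      "(\<lambda>i. \<integral>\<^sup>+x. ennreal (norm (f x - s i x)) \<partial>M) \<longlonglongrightarrow> 0"
      "(\<lambda>i. Bochner_Integration.simple_bochner_integral M (s i)) \<longlonglongrightarrow> v"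
    using f unfolding has_strong_integral_def by blast
  have sm: "strongly_measurable M (s i)" for i
    unfolding strongly_measurable_def using s(1)[of i]
    by (intro exI[of _ "\<lambda>_. s i"]) (auto elim: Bochner_Integration.simple_bochner_integrable.cases)
  have [measurable]: "(\<lambda>x. norm (f x - s i x)) \<in> borel_measurable M" for i
    by (intro strongly_measurable_norm strongly_measurable_diff sf sm)
  show ?thesis
    unfolding has_strong_integral_def
  proof (intro conjI exI[of _ "\<lambda>i x. c *\<^sub>R s i x"] allI)
    show "strongly_measurable M (\<lambda>x. c *\<^sub>R f x)"
      by (intro strongly_measurable_scaleR sf)
    show "Bochner_Integration.simple_bochner_integrable M (\<lambda>x. c *\<^sub>R s i x)" for i
      using simple_bochner_integrable_compose2[of "\<lambda>a b. c *\<^sub>R a", OF _ s(1) s(1)] by simp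
    show "(\<lambda>i. Bochner_Integration.simple_bochner_integral M (\<lambda>x. c *\<^sub>R s i x)) \<longlonglongrightarrow> c *\<^sub>R v"
      using tendsto_scaleR[OF tendsto_const s(3), of c]
      by (simp add: simple_bochner_integral_linear[OF linear_scale_self s(1)])
    have "(\<integral>\<^sup>+x. ennreal (norm (c *\<^sub>R f x - c *\<^sub>R s i x)) \<partial>M) = ennreal \<bar>c\<bar> * (\<integral>\<^sup>+x. ennreal (norm (f x - s i x)) \<partial>M)" for i
      by (subst nn_integral_cmult[symmetric])
        (auto simp flip: scaleR_diff_right simp add: ennreal_mult)
    then show "(\<lambda>i. \<integral>\<^sup>+x. ennreal (norm (c *\<^sub>R f x - c *\<^sub>R s i x)) \<partial>M) \<longlonglongrightarrow> 0"
      using ennreal_tendsto_cmult[OF _ s(2), of "ennreal \<bar>c\<bar>"] by simp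
  qed
qed

text \<open>Integrability of the norm says that the series over the fibres converges absolutely.
  Truncating to the finitely many values with code at most \<open>i\<close> gives simple functions,
  which converge in mean by dominated convergence and whose integrals are partial sums of the
  series.\<close>

lemma has_strong_integral_fibers:
  fixes G :: "'t \<Rightarrow> 'e::banach"
  assumes \<tau>: "countably_valued M \<tau>" and T: "countable T" "\<tau> ` space M \<subseteq> T"
    and fin: "(\<integral>\<^sup>+x. ennreal (norm (G (\<tau> x))) \<partial>M) < \<infinity>"
  shows "has_strong_integral M (\<lambda>x. G (\<tau> x)) (\<Sum>\<^sub>\<infinity>t\<in>T. measure M (\<tau> -` {t} \<inter> space M) *\<^sub>R G t)"
proof -
  define m where "m t = measure M (\<tau> -` {t} \<inter> space M)" for t
  define e where "e = to_nat_on T"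
  have inj: "inj_on e T" unfolding e_def using T(1) by (rule inj_on_to_nat_on)
  have meas_G: "countably_valued M (\<lambda>x. h (\<tau> x))" for h :: "'t \<Rightarrow> 'z"
    using \<tau> by (rule countably_valued_compose)
  have fib[measurable]: "\<tau> -` {t} \<inter> space M \<in> sets M" for t
    using \<tau> by (auto simp: countably_valued_def intro: measurable_sets)
  \<comment> \<open>A fibre of infinite measure can carry only the value \<open>0\<close>, where the
    conventional value of \<open>measure\<close> is harmless.\<close>
  have fin_fib: "emeasure M (\<tau> -` {t} \<inter> space M) < \<infinity>" if "G t \<noteq> 0" for t
  proof -
    have "ennreal (norm (G t)) * emeasure M (\<tau> -` {t} \<inter> space M)
        = (\<integral>\<^sup>+x. ennreal (norm (G t)) * indicator (\<tau> -` {t} \<inter> space M) x \<partial>M)"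
      by (rule nn_integral_cmult_indicator[symmetric]) (rule fib)
    also have "\<dots> \<le> (\<integral>\<^sup>+x. ennreal (norm (G (\<tau> x))) \<partial>M)"
      by (intro nn_integral_mono) (auto split: split_indicator)
    finally have "ennreal (norm (G t)) * emeasure M (\<tau> -` {t} \<inter> space M) < \<infinity>"
      using fin by (rule le_less_trans)
    with that show ?thesis
      by (auto simp: ennreal_mult_less_top)
  qed
  have norm_eq: "ennreal (norm (m t *\<^sub>R G t)) = ennreal (norm (G t)) * emeasure M (\<tau> -` {t} \<inter> space M)" for t
  proof (cases "G t = 0")
    case False
    then have "emeasure M (\<tau> -` {t} \<inter> space M) = ennreal (m t)"
      unfolding m_def using fin_fib[OF False] by (intro emeasure_eq_ennreal_measure) simp
    then show ?thesis
      by (simp add: m_def ennreal_mult mult.commute)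
  qed simp
  have "(\<integral>\<^sup>+t. ennreal (norm (m t *\<^sub>R G t)) \<partial>count_space T) = (\<integral>\<^sup>+x. ennreal (norm (G (\<tau> x))) \<partial>M)"
    unfolding norm_eq by (rule nn_integral_fibers[OF \<tau> T, symmetric])
  with fin have finT: "(\<integral>\<^sup>+t. ennreal (norm (m t *\<^sub>R G t)) \<partial>count_space T) < \<infinity>" by simp
  have "(\<lambda>t. m t *\<^sub>R G t) abs_summable_on T"
  proof (rule nonneg_bounded_partial_sums_imp_summable_on)
    show "eventually (\<lambda>F. (\<Sum>t\<in>F. norm (m t *\<^sub>R G t)) \<le> enn2real (\<integral>\<^sup>+t. ennreal (norm (m t *\<^sub>R G t)) \<partial>count_space T)) (finite_subsets_at_top T)"
    proof (rule eventually_finite_subsets_at_top_weakI)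
      fix F assume F: "finite F" "F \<subseteq> T"
      have "ennreal (\<Sum>t\<in>F. norm (m t *\<^sub>R G t)) = (\<integral>\<^sup>+t. ennreal (norm (m t *\<^sub>R G t)) \<partial>count_space F)"
        using F by (simp add: nn_integral_count_space_finite sum_ennreal)
      also have "\<dots> \<le> (\<integral>\<^sup>+t. ennreal (norm (m t *\<^sub>R G t)) \<partial>count_space T)"
        using F(2) by (auto simp: nn_integral_count_space_indicator intro!: nn_integral_mono split: split_indicator)
      finally have "enn2real (ennreal (\<Sum>t\<in>F. norm (m t *\<^sub>R G t)))
          \<le> enn2real (\<integral>\<^sup>+t. ennreal (norm (m t *\<^sub>R G t)) \<partial>count_space T)"
        using finT by (intro enn2real_mono) simp_all
      then show "(\<Sum>t\<in>F. norm (m t *\<^sub>R G t)) \<le> enn2real (\<integral>\<^sup>+t. ennreal (norm (m t *\<^sub>R G t)) \<partial>count_space T)"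
        by (subst (asm) enn2real_ennreal) (auto intro: sum_nonneg)
    qed
  qed simp
  then have hs: "((\<lambda>t. m t *\<^sub>R G t) has_sum (\<Sum>\<^sub>\<infinity>t\<in>T. m t *\<^sub>R G t)) T"
    by (rule has_sum_infsum[OF abs_summable_summable])
  define F where "F i = {t\<in>T. e t \<le> i}" for i
  have F: "finite (F i)" "F i \<subseteq> T" for i
  proof -
    have "finite (e -` {..i} \<inter> T)"
      by (intro finite_vimage_IntI inj) simp
    moreover have "F i = e -` {..i} \<inter> T" by (auto simp: F_def)
    ultimately show "finite (F i)" by simp
  qed (auto simp: F_def)
  have flim: "filterlim F (finite_subsets_at_top T) sequentially"
    unfolding filterlim_finite_subsets_at_top
  proof (intro allI impI)
    fix X assume X: "finite X \<and> X \<subseteq> T"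
    show "eventually (\<lambda>i. finite (F i) \<and> X \<subseteq> F i \<and> F i \<subseteq> T) sequentially"
    proof (rule eventually_sequentiallyI[of "Max (insert 0 (e ` X))"])
      fix i assume "Max (insert 0 (e ` X)) \<le> i"
      then have "e x \<le> i" if "x \<in> X" for x
        using X that by simp
      then show "finite (F i) \<and> X \<subseteq> F i \<and> F i \<subseteq> T"
        using X F by (auto simp: F_def)
    qed
  qed
  define s where "s i x = (if e (\<tau> x) \<le> i then G (\<tau> x) else 0)" for i x
  \<comment> \<open>\<open>None\<close> collects all points beyond the truncation, so the truncated
    map has finitely many values and remains injective on the fibres that are kept.\<close>
  have simple_trunc: "simple_function M (\<lambda>x. if e (\<tau> x) \<le> i then Some (\<tau> x) else None)" for i
  proof (rule simple_function_countably_valued)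
    show "finite ((\<lambda>x. if e (\<tau> x) \<le> i then Some (\<tau> x) else None) ` space M)"
      by (rule finite_subset[of _ "insert None (Some ` F i)"]) (use F T in \<open>auto simp: F_def\<close>)
  qed (rule meas_G)
  have s_simple: "simple_function M (s i)" for i
    using simple_function_compose1[OF simple_trunc[of i], of "\<lambda>z. case z of Some t \<Rightarrow> G t | None \<Rightarrow> 0"]
    by (rule back_subst[where P="simple_function M"]) (auto simp: s_def)
  have s_int: "Bochner_Integration.simple_bochner_integrable M (s i)" for i
  proof (rule simple_bochner_integrableI_bounded[OF s_simple])
    show "(\<integral>\<^sup>+x. ennreal (norm (s i x)) \<partial>M) < \<infinity>"
      by (rule le_less_trans[OF _ fin], rule nn_integral_mono) (simp add: s_def)
  qed
  have s_val: "Bochner_Integration.simple_bochner_integral M (s i) = (\<Sum>t\<in>F i. m t *\<^sub>R G t)" for i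
  proof -
    let ?g = "\<lambda>x. if e (\<tau> x) \<le> i then Some (\<tau> x) else None"
    let ?v = "\<lambda>z. case z of Some t \<Rightarrow> G t | None \<Rightarrow> 0"
    have "Bochner_Integration.simple_bochner_integral M (s i)
        = (\<Sum>z\<in>?g ` space M. measure M {x \<in> space M. ?g x = z} *\<^sub>R ?v z)"
      by (rule simple_bochner_integral_partition[OF s_int simple_trunc]) (auto simp: s_def split: if_splits)
    also have "\<dots> = (\<Sum>z\<in>Some ` F i. measure M {x \<in> space M. ?g x = z} *\<^sub>R ?v z)"
    proof (rule sum.mono_neutral_cong)
      fix z assume "z \<in> Some ` F i - ?g ` space M"
      then have "{x \<in> space M. ?g x = z} = {}" by (auto simp del: if_image_distrib)
      then show "measure M {x \<in> space M. ?g x = z} *\<^sub>R ?v z = 0" by (simp only: measure_empty scaleR_zero_left)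
    next
      fix z assume "z \<in> ?g ` space M - Some ` F i"
      then have "z = None" using T by (auto simp: F_def split: if_splits)
      then show "measure M {x \<in> space M. ?g x = z} *\<^sub>R ?v z = 0" by simp
    qed (use simple_trunc[of i] F in \<open>auto simp: simple_function_def\<close>)
    also have "\<dots> = (\<Sum>t\<in>F i. m t *\<^sub>R G t)"
    proof (subst sum.reindex)
      have "{x \<in> space M. ?g x = Some t} = \<tau> -` {t} \<inter> space M" if "t \<in> F i" for t
        using that by (auto simp: F_def)
      then show "(sum ((\<lambda>z. measure M {x \<in> space M. ?g x = z} *\<^sub>R ?v z) \<circ> Some) (F i)) = (\<Sum>t\<in>F i. m t *\<^sub>R G t)"
        by (intro sum.cong refl) (simp add: m_def)
    qed simp
    finally show ?thesis .
  qed
  show ?thesis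
    unfolding has_strong_integral_def m_def[symmetric]
  proof (intro conjI exI[of _ s] allI s_int)
    show "strongly_measurable M (\<lambda>x. G (\<tau> x))"
      by (rule strongly_measurable_countably_valued[OF meas_G])
    show "(\<lambda>i. Bochner_Integration.simple_bochner_integral M (s i)) \<longlonglongrightarrow> (\<Sum>\<^sub>\<infinity>t\<in>T. m t *\<^sub>R G t)"
      unfolding s_val using filterlim_compose[OF hs[unfolded has_sum_def] flim] .
    have "(\<lambda>i. \<integral>\<^sup>+x. ennreal (norm (G (\<tau> x) - s i x)) \<partial>M) \<longlonglongrightarrow> (\<integral>\<^sup>+x. 0 \<partial>M)"
    proof (rule nn_integral_dominated_convergence[where w="\<lambda>x. ennreal (norm (G (\<tau> x)))"])
      have "(\<lambda>x. norm (G (\<tau> x) - s i x)) \<in> borel_measurable M" for i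
        unfolding s_def
        using countably_valued_norm[OF meas_G[of "\<lambda>t. G t - (if e t \<le> i then G t else 0)"]] .
      then show "(\<lambda>x. ennreal (norm (G (\<tau> x) - s i x))) \<in> borel_measurable M" for i by measurable
      show "(\<lambda>x. ennreal (norm (G (\<tau> x)))) \<in> borel_measurable M"
        using countably_valued_norm[OF meas_G[of G]] by measurable
      show "AE x in M. (\<lambda>i. ennreal (norm (G (\<tau> x) - s i x))) \<longlonglongrightarrow> 0"
      proof (rule AE_I2)
        fix x
        have "eventually (\<lambda>i. ennreal (norm (G (\<tau> x) - s i x)) = 0) sequentially"
          by (rule eventually_sequentiallyI[of "e (\<tau> x)"]) (simp add: s_def)
        then show "(\<lambda>i. ennreal (norm (G (\<tau> x) - s i x))) \<longlonglongrightarrow> 0"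
          by (rule tendsto_eventually)
      qed
    qed (use fin in \<open>auto simp: s_def\<close>)
    then show "(\<lambda>i. \<integral>\<^sup>+x. ennreal (norm (G (\<tau> x) - s i x)) \<partial>M) \<longlonglongrightarrow> 0" by simp
  qed
qed

section \<open>The UMD inequality on discrete probability spaces\<close>

text \<open>The sample type may be uncountable and \<open>h\<close> is arbitrary off the support;
  the indicator of the support makes the integrand countably valued while changing it only on a null
  set. On the support \<open>h\<close> lives on \<open>X\<close> and depends on the variable
  \<open>u\<close> alone.\<close>

lemma has_strong_integral_pmf:
  fixes h :: "'c \<Rightarrow> 'e::banach"
  assumes fin: "(\<integral>\<^sup>+x. ennreal (norm (h x)) \<partial>measure_pmf Q) < \<infinity>"
    and X: "countable T" "u ` (set_pmf Q \<inter> X) \<subseteq> T" and h: "\<And>x. x \<in> set_pmf Q \<Longrightarrow> h x = indicator X x *\<^sub>R G (u x)"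
  shows "has_strong_integral (measure_pmf Q) (\<lambda>x. indicator (set_pmf Q) x *\<^sub>R h x)
    (\<Sum>\<^sub>\<infinity>t\<in>T. measure_pmf.prob Q (X \<inter> u -` {t}) *\<^sub>R G t)"
proof -
  define \<tau> where "\<tau> x = (if x \<in> set_pmf Q \<inter> X then Some (u x) else None)" for x
  define G' where "G' z = (case z of Some t \<Rightarrow> G t | None \<Rightarrow> 0)" for z
  have rng: "\<tau> ` space (measure_pmf Q) \<subseteq> insert None (Some ` T)"
    using X by (auto simp: \<tau>_def)
  have cT: "countable (insert None (Some ` T))"
    using X by simp
  have eq: "G' (\<tau> x) = indicator (set_pmf Q) x *\<^sub>R h x" for x
    using h by (auto simp: G'_def \<tau>_def split: split_indicator)
  have "has_strong_integral (measure_pmf Q) (\<lambda>x. G' (\<tau> x))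
    (\<Sum>\<^sub>\<infinity>z\<in>insert None (Some ` T). measure (measure_pmf Q) (\<tau> -` {z} \<inter> space (measure_pmf Q)) *\<^sub>R G' z)"
  proof (rule has_strong_integral_fibers[OF _ cT rng])
    show "countably_valued (measure_pmf Q) \<tau>"
      using rng cT by (auto simp: countably_valued_def intro: countable_subset)
    show "(\<integral>\<^sup>+x. ennreal (norm (G' (\<tau> x))) \<partial>measure_pmf Q) < \<infinity>"
      unfolding eq by (rule le_less_trans[OF nn_integral_mono fin]) (simp split: split_indicator)
  qed
  also have "(\<Sum>\<^sub>\<infinity>z\<in>insert None (Some ` T). measure (measure_pmf Q) (\<tau> -` {z} \<inter> space (measure_pmf Q)) *\<^sub>R G' z)
      = (\<Sum>\<^sub>\<infinity>z\<in>Some ` T. measure (measure_pmf Q) (\<tau> -` {z} \<inter> space (measure_pmf Q)) *\<^sub>R G' z)"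
    by (intro infsum_cong_neutral) (auto simp: G'_def)
  also have "\<dots> = (\<Sum>\<^sub>\<infinity>t\<in>T. measure (measure_pmf Q) (\<tau> -` {Some t} \<inter> space (measure_pmf Q)) *\<^sub>R G t)"
    by (subst infsum_reindex) (auto simp: G'_def o_def)
  also have "\<dots> = (\<Sum>\<^sub>\<infinity>t\<in>T. measure_pmf.prob Q (X \<inter> u -` {t}) *\<^sub>R G t)"
  proof (intro infsum_cong arg_cong2[where f="(*\<^sub>R)"] refl)
    fix t
    have "measure_pmf.prob Q (X \<inter> u -` {t}) = measure_pmf.prob Q (X \<inter> u -` {t} \<inter> set_pmf Q)"
      by (rule measure_Int_set_pmf[symmetric])
    also have "X \<inter> u -` {t} \<inter> set_pmf Q = \<tau> -` {Some t} \<inter> space (measure_pmf Q)"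
      by (auto simp: \<tau>_def split: if_splits)
    finally show "measure (measure_pmf Q) (\<tau> -` {Some t} \<inter> space (measure_pmf Q)) = measure_pmf.prob Q (X \<inter> u -` {t})"
      by simp
  qed
  finally show ?thesis unfolding eq .
qed

lemma has_strong_integral_pmf_self:
  fixes h :: "'c \<Rightarrow> 'e::banach"
  assumes fin: "(\<integral>\<^sup>+x. ennreal (norm (h x)) \<partial>measure_pmf Q) < \<infinity>"
  shows "has_strong_integral (measure_pmf Q) (\<lambda>x. indicator (set_pmf Q) x *\<^sub>R h x)
    (\<Sum>\<^sub>\<infinity>x\<in>set_pmf Q. pmf Q x *\<^sub>R h x)"
proof -
  have *: "UNIV \<inter> (\<lambda>x. x) -` {x} = {x}" for x :: 'c by auto
  show ?thesis
    using has_strong_integral_pmf[OF fin countable_set_pmf[of Q], of "\<lambda>x. x" UNIV h]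
    unfolding * by (simp add: measure_pmf_single)
qed

lemma infsum_pmf_fibers:
  fixes G :: "'t \<Rightarrow> 'e::banach"
  assumes fin: "(\<integral>\<^sup>+x. ennreal (norm (h x)) \<partial>measure_pmf Q) < \<infinity>"
    and X: "countable T" "u ` (set_pmf Q \<inter> X) \<subseteq> T" and h: "\<And>x. x \<in> set_pmf Q \<Longrightarrow> h x = indicator X x *\<^sub>R G (u x)"
  shows "(\<Sum>\<^sub>\<infinity>x\<in>set_pmf Q. pmf Q x *\<^sub>R h x) = (\<Sum>\<^sub>\<infinity>t\<in>T. measure_pmf.prob Q (X \<inter> u -` {t}) *\<^sub>R G t)"
  by (rule has_strong_integral_unique[OF has_strong_integral_pmf_self[OF fin] has_strong_integral_pmf[OF fin X h]])

lemma infsum_pmf_add: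
  fixes g h :: "'c \<Rightarrow> 'e::banach"
  assumes g: "(\<integral>\<^sup>+x. ennreal (norm (g x)) \<partial>measure_pmf Q) < \<infinity>"
    and h: "(\<integral>\<^sup>+x. ennreal (norm (h x)) \<partial>measure_pmf Q) < \<infinity>"
  shows "(\<Sum>\<^sub>\<infinity>x\<in>set_pmf Q. pmf Q x *\<^sub>R (a *\<^sub>R g x + b *\<^sub>R h x)) =
    a *\<^sub>R (\<Sum>\<^sub>\<infinity>x\<in>set_pmf Q. pmf Q x *\<^sub>R g x) + b *\<^sub>R (\<Sum>\<^sub>\<infinity>x\<in>set_pmf Q. pmf Q x *\<^sub>R h x)"
proof -
  have "(\<integral>\<^sup>+x. ennreal (norm (a *\<^sub>R g x + b *\<^sub>R h x)) \<partial>measure_pmf Q)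
      \<le> (\<integral>\<^sup>+x. ennreal \<bar>a\<bar> * ennreal (norm (g x)) + ennreal \<bar>b\<bar> * ennreal (norm (h x)) \<partial>measure_pmf Q)"
    using norm_triangle_ineq[of "a *\<^sub>R g x" "b *\<^sub>R h x" for x]
    by (intro nn_integral_mono) (simp flip: ennreal_plus ennreal_mult add: ennreal_leI)
  also have "\<dots> = ennreal \<bar>a\<bar> * (\<integral>\<^sup>+x. ennreal (norm (g x)) \<partial>measure_pmf Q) +
      ennreal \<bar>b\<bar> * (\<integral>\<^sup>+x. ennreal (norm (h x)) \<partial>measure_pmf Q)"
    by (simp add: nn_integral_add nn_integral_cmult)
  also have "\<dots> < \<infinity>"
    using g h by (simp add: ennreal_mult_less_top)
  finally have "has_strong_integral (measure_pmf Q) (\<lambda>x. indicator (set_pmf Q) x *\<^sub>R (a *\<^sub>R g x + b *\<^sub>R h x))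
      (\<Sum>\<^sub>\<infinity>x\<in>set_pmf Q. pmf Q x *\<^sub>R (a *\<^sub>R g x + b *\<^sub>R h x))"
    by (rule has_strong_integral_pmf_self)
  moreover have "has_strong_integral (measure_pmf Q)
      (\<lambda>x. a *\<^sub>R (indicator (set_pmf Q) x *\<^sub>R g x) + b *\<^sub>R (indicator (set_pmf Q) x *\<^sub>R h x))
      (a *\<^sub>R (\<Sum>\<^sub>\<infinity>x\<in>set_pmf Q. pmf Q x *\<^sub>R g x) + b *\<^sub>R (\<Sum>\<^sub>\<infinity>x\<in>set_pmf Q. pmf Q x *\<^sub>R h x))"
    by (intro has_strong_integral_add has_strong_integral_scaleR has_strong_integral_pmf_self g h)
  moreover have "a *\<^sub>R (indicator (set_pmf Q) x *\<^sub>R g x) + b *\<^sub>R (indicator (set_pmf Q) x *\<^sub>R h x)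
      = indicator (set_pmf Q) x *\<^sub>R (a *\<^sub>R g x + b *\<^sub>R h x)" for x
    by (simp split: split_indicator)
  ultimately show ?thesis
    by (simp only: has_strong_integral_unique)
qed

lemma Lp_norm_pmf_cong:
  assumes "\<And>x. x \<in> set_pmf Q \<Longrightarrow> norm (f x) = norm (g x)"
  shows "Lp_norm (measure_pmf Q) p f = Lp_norm (measure_pmf Q) p g"
proof -
  have "(\<integral>\<^sup>+x. ennreal (norm (f x) powr p) \<partial>measure_pmf Q) = (\<integral>\<^sup>+x. ennreal (norm (g x) powr p) \<partial>measure_pmf Q)"
    using assms by (intro nn_integral_cong_AE) (simp add: AE_measure_pmf_iff)
  then show ?thesis by (simp add: Lp_norm_def)
qed

lemma Lp_norm_map_pmf: "Lp_norm (measure_pmf (map_pmf c Q)) p f = Lp_norm (measure_pmf Q) p (\<lambda>x. f (c x))"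
  by (simp add: Lp_norm_def nn_integral_map_pmf)

lemma Lp_norm_pmf_finite_imp:
  assumes "1 \<le> p" "Lp_norm (measure_pmf Q) p f < \<infinity>"
  shows "(\<integral>\<^sup>+x. ennreal (norm (f x)) \<partial>measure_pmf Q) < \<infinity>"
proof -
  have "norm (f x) \<le> 1 + norm (f x) powr p" for x
  proof (cases "norm (f x) \<le> 1")
    case False
    then have "norm (f x) powr 1 \<le> norm (f x) powr p"
      using assms(1) by (intro powr_mono) auto
    with False show ?thesis by simp
  qed (simp add: add_increasing2)
  then have "(\<integral>\<^sup>+x. ennreal (norm (f x)) \<partial>measure_pmf Q) \<le> (\<integral>\<^sup>+x. 1 + ennreal (norm (f x) powr p) \<partial>measure_pmf Q)"
    by (intro nn_integral_mono) (simp flip: ennreal_plus ennreal_1 add: ennreal_leI)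
  also have "\<dots> = 1 + (\<integral>\<^sup>+x. ennreal (norm (f x) powr p) \<partial>measure_pmf Q)"
    by (simp add: nn_integral_add)
  also have "\<dots> < \<infinity>"
    using assms(2) by (simp add: Lp_norm_less_top_iff[unfolded infinity_ennreal_def])
  finally show ?thesis .
qed

text \<open>The filtration is given by a decreasing sequence of relations: the sets of stage \<open>n\<close> are those
  that do not separate points of the support related by \<open>R n\<close>. Enumerating the support transports
  the martingale to a probability measure on the real line.\<close>

lemma UMD_bound_pmf:
  fixes d :: "nat \<Rightarrow> 'c \<Rightarrow> 'e::banach" and Q :: "'c pmf"
  assumes C: "UMD_bound TYPE('e) p C" and p: "1 \<le> p"
    and nest: "\<And>n x y. R (Suc n) x y \<Longrightarrow> R n x y"
    and adapted: "\<And>n x y. n \<in> {1..N} \<Longrightarrow> x \<in> set_pmf Q \<Longrightarrow> y \<in> set_pmf Q \<Longrightarrow> R n x y \<Longrightarrow> d n x = d n y"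
    and fin: "\<And>n. n \<in> {1..N} \<Longrightarrow> Lp_norm (measure_pmf Q) p (d n) < \<infinity>"
    and zero: "\<And>n B. n \<in> {1..N} \<Longrightarrow>
        (\<And>x y. x \<in> set_pmf Q \<Longrightarrow> y \<in> set_pmf Q \<Longrightarrow> R (n - 1) x y \<Longrightarrow> x \<in> B \<longleftrightarrow> y \<in> B) \<Longrightarrow>
        (\<Sum>\<^sub>\<infinity>x\<in>set_pmf Q. pmf Q x *\<^sub>R (indicator B x *\<^sub>R d n x)) = 0"
    and s: "\<And>n. n \<in> {1..N} \<Longrightarrow> s n \<in> {-1, 1 :: real}"
  shows "Lp_norm (measure_pmf Q) p (\<lambda>x. \<Sum>n=1..N. s n *\<^sub>R d n x) \<le>
    ennreal C * Lp_norm (measure_pmf Q) p (\<lambda>x. \<Sum>n=1..N. d n x)"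
proof -
  let ?S = "set_pmf Q"
  define c where "c x = real (to_nat_on ?S x)" for x
  have inj: "inj_on c ?S"
    using inj_on_to_nat_on[OF countable_set_pmf[of Q]] by (auto simp: inj_on_def c_def)
  define P where "P = map_pmf c Q"
  have setP: "set_pmf P = c ` ?S" by (simp add: P_def)
  \<comment> \<open>The default \<open>0\<close> keeps the range countable and makes
    \<open>d'\<close> vanish off the support, so that the strong integral over the support is the
    integral over the whole line.\<close>
  define d' where "d' n r = (if r \<in> c ` ?S then d n (inv_into ?S c r) else 0)" for n r
  have d'c: "d' n (c x) = d n x" if "x \<in> ?S" for n x
    using that inj by (simp add: d'_def)
  \<comment> \<open>Not separating related points is stable under complements and countable unions
    for any relation, so every \<open>\<S> n\<close> is a sigma-algebra. Points outside the image of
    the support are unconstrained.\<close>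
  define \<S> where "\<S> n = {B. \<forall>x\<in>?S. \<forall>y\<in>?S. R n x y \<longrightarrow> (c x \<in> B \<longleftrightarrow> c y \<in> B)}" for n
  have sa: "sigma_algebra UNIV (\<S> n)" for n
    unfolding sigma_algebra_iff2 by (auto simp: \<S>_def)
  define F where "F n = sigma UNIV (\<S> n)" for n
  have setsF: "sets (F n) = \<S> n" and spaceF: "space (F n) = UNIV" for n
    using sigma_algebra.sets_measure_of_eq[OF sa] by (auto simp: F_def)
  have normP: "Lp_norm (measure_pmf P) p g = Lp_norm (measure_pmf Q) p (\<lambda>x. g (c x))" for g :: "real \<Rightarrow> 'e"
    by (simp add: P_def Lp_norm_map_pmf)
  have fin': "Lp_norm (measure_pmf P) p (d' n) < \<infinity>" if "n \<in> {1..N}" for n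
    unfolding normP using fin[OF that] d'c by (subst Lp_norm_pmf_cong[where g="d n"]) auto
  have "Lp_martingale_differences (measure_pmf P) p N d'"
    unfolding Lp_martingale_differences_def
  proof (intro exI[of _ F] conjI allI impI ballI)
    show "subalgebra (measure_pmf P) (F n)" for n
      by (simp add: subalgebra_def spaceF)
    show "subalgebra (F (Suc n)) (F n)" for n
      using nest[of n] by (auto simp: subalgebra_def spaceF setsF \<S>_def)
    fix n assume n: "n \<in> {1..N}"
    show "Lp_norm (measure_pmf P) p (d' n) < \<infinity>" by (rule fin'[OF n])
    have "range (d' n) \<subseteq> insert 0 (d n ` ?S)"
      by (auto simp: d'_def inv_into_into)
    then have "countable (range (d' n))"
      by (rule countable_subset) simp
    moreover have "d' n -` B \<in> \<S> n" for B
      using adapted[OF n] by (auto simp: \<S>_def d'c)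
    ultimately show "strongly_measurable (F n) (d' n)"
      by (intro strongly_measurable_countably_valued)
        (auto simp: countably_valued_def spaceF setsF intro!: measurableI)
    fix B assume "B \<in> sets (F (n - 1))"
    then have B: "\<And>x y. x \<in> ?S \<Longrightarrow> y \<in> ?S \<Longrightarrow> R (n - 1) x y \<Longrightarrow> x \<in> c -` B \<longleftrightarrow> y \<in> c -` B"
      by (auto simp: setsF \<S>_def)
    have "has_strong_integral (measure_pmf P) (\<lambda>r. indicator (set_pmf P) r *\<^sub>R (indicator B r *\<^sub>R d' n r))
        (\<Sum>\<^sub>\<infinity>r\<in>set_pmf P. pmf P r *\<^sub>R (indicator B r *\<^sub>R d' n r))"
    proof (rule has_strong_integral_pmf_self)
      show "(\<integral>\<^sup>+r. ennreal (norm (indicator B r *\<^sub>R d' n r)) \<partial>measure_pmf P) < \<infinity>"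
        by (rule le_less_trans[OF nn_integral_mono Lp_norm_pmf_finite_imp[OF p fin'[OF n]]])
          (simp split: split_indicator)
    qed
    also have "(\<lambda>r. indicator (set_pmf P) r *\<^sub>R (indicator B r *\<^sub>R d' n r)) = (\<lambda>r. indicator B r *\<^sub>R d' n r)"
      by (auto simp: setP d'_def split: split_indicator)
    also have "(\<Sum>\<^sub>\<infinity>r\<in>set_pmf P. pmf P r *\<^sub>R (indicator B r *\<^sub>R d' n r))
        = (\<Sum>\<^sub>\<infinity>x\<in>?S. pmf P (c x) *\<^sub>R (indicator B (c x) *\<^sub>R d' n (c x)))"
      unfolding setP by (subst infsum_reindex[OF inj]) (simp add: o_def)
    also have "\<dots> = (\<Sum>\<^sub>\<infinity>x\<in>?S. pmf Q x *\<^sub>R (indicator (c -` B) x *\<^sub>R d n x))"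
      by (intro infsum_cong) (auto simp: P_def pmf_map_inj inj d'c split: split_indicator)
    also have "\<dots> = 0"
      by (rule zero[OF n B])
    finally show "has_strong_integral (measure_pmf P) (\<lambda>r. indicator B r *\<^sub>R d' n r) 0" .
  qed
  then have "Lp_norm (measure_pmf P) p (\<lambda>x. \<Sum>n=1..N. s n *\<^sub>R d' n x) \<le>
      ennreal C * Lp_norm (measure_pmf P) p (\<lambda>x. \<Sum>n=1..N. d' n x)"
    using C s unfolding UMD_bound_def by (blast intro: measure_pmf.prob_space_axioms)
  also have "Lp_norm (measure_pmf P) p (\<lambda>x. \<Sum>n=1..N. s n *\<^sub>R d' n x) = Lp_norm (measure_pmf Q) p (\<lambda>x. \<Sum>n=1..N. s n *\<^sub>R d n x)"
    unfolding normP by (rule Lp_norm_pmf_cong) (simp add: d'c)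
  also have "Lp_norm (measure_pmf P) p (\<lambda>x. \<Sum>n=1..N. d' n x) = Lp_norm (measure_pmf Q) p (\<lambda>x. \<Sum>n=1..N. d n x)"
    unfolding normP by (rule Lp_norm_pmf_cong) (simp add: d'c)
  finally show ?thesis .
qed

section \<open>The UMD constant as an infimum of admissible bounds\<close>

lemma UMD_const_le:
  fixes b :: ennreal
  assumes "UMD TYPE('e::banach) p" "b < \<infinity>" "\<And>C. UMD_bound TYPE('e) p C \<Longrightarrow> a \<le> ennreal C * b"
  shows "a \<le> ennreal (UMD_const TYPE('e) p) * b"
proof -
  let ?S = "{C. UMD_bound TYPE('e) p C}"
  obtain r where r: "b = ennreal r" "0 \<le> r" using assms(2) by (cases b) auto
  have bdd: "bdd_below ?S" by (rule bdd_belowI[of _ 0]) (simp add: UMD_bound_def)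
  have ne: "?S \<noteq> {}" using assms(1) unfolding UMD_def by blast
  have nn: "0 \<le> Inf ?S" using ne by (rule cInf_greatest) (simp add: UMD_bound_def)
  show ?thesis
  proof (rule ennreal_le_epsilon)
    fix e :: real assume e: "0 < e"
    define \<delta> where "\<delta> = e / (r + 1)"
    have \<delta>: "0 < \<delta>" "\<delta> * r \<le> e"
    proof -
      show "0 < \<delta>" using e r by (simp add: \<delta>_def)
      have "\<delta> * (r + 1) = e" using r by (simp add: \<delta>_def)
      with \<open>0 < \<delta>\<close> show "\<delta> * r \<le> e" by (simp add: distrib_left)
    qed
    \<comment> \<open>No attainment of the infimum is used: an admissible \<open>C\<close> within
      \<open>\<delta>\<close> of it costs the error \<open>\<delta> * r\<close>, which finiteness of
      \<open>b\<close> makes at most \<open>e\<close>.\<close>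
    obtain C where C: "UMD_bound TYPE('e) p C" "C < Inf ?S + \<delta>"
      using cInf_lessD[OF ne, of "Inf ?S + \<delta>"] \<delta> by auto
    have "a \<le> ennreal C * b" by (rule assms(3)[OF C(1)])
    also have "\<dots> \<le> ennreal (Inf ?S + \<delta>) * b"
      using C by (intro mult_right_mono ennreal_leI) auto
    also have "\<dots> = ennreal (Inf ?S) * b + ennreal (\<delta> * r)"
      using nn \<delta> r by (simp add: ennreal_mult distrib_right)
    also have "\<dots> \<le> ennreal (UMD_const TYPE('e) p) * b + ennreal e"
      unfolding UMD_const_def using \<delta> by (intro add_left_mono ennreal_leI)
    finally show "a \<le> ennreal (UMD_const TYPE('e) p) * b + ennreal e" .
  qed
qed

lemma UMD_const_nonneg: "UMD TYPE('e::banach) p \<Longrightarrow> 0 \<le> UMD_const TYPE('e) p"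
  unfolding UMD_const_def UMD_def by (rule cInf_greatest, blast, simp add: UMD_bound_def)

text \<open>A single Rademacher variable is a martingale difference sequence.\<close>

lemma UMD_const_ge_1:
  fixes v :: "'e::banach"
  assumes U: "UMD TYPE('e) p" and p: "1 \<le> p" and v: "v \<noteq> 0"
  shows "1 \<le> UMD_const TYPE('e) p"
  unfolding UMD_const_def
proof (rule cInf_greatest)
  show "{C. UMD_bound TYPE('e) p C} \<noteq> {}" using U unfolding UMD_def by blast
next
  fix C assume "C \<in> {C. UMD_bound TYPE('e) p C}"
  then have C: "UMD_bound TYPE('e) p C" by simp
  let ?Q = "pmf_of_set (UNIV :: bool set)"
  have set: "set_pmf ?Q = UNIV" by simp
  define d where "d n b = (if b then v else - v)" for n :: nat and b
  have nrm: "Lp_norm (measure_pmf ?Q) p (d n) = ennreal (norm v)" for n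
  proof -
    have "(\<integral>\<^sup>+b. ennreal (norm (d n b) powr p) \<partial>measure_pmf ?Q) = (\<integral>\<^sup>+b. ennreal (norm v powr p) \<partial>measure_pmf ?Q)"
      by (intro nn_integral_cong) (simp add: d_def)
    also have "\<dots> = ennreal (norm v powr p)" by simp
    finally show ?thesis
      using p by (simp add: Lp_norm_def ennreal_powr_ennreal powr_powr)
  qed
  have "Lp_norm (measure_pmf ?Q) p (\<lambda>x. \<Sum>n=1..1. (1::real) *\<^sub>R d n x) \<le>
      ennreal C * Lp_norm (measure_pmf ?Q) p (\<lambda>x. \<Sum>n=1..1. d n x)"
  \<comment> \<open>Stage \<open>0\<close> relates the two outcomes, which leaves only the trivial
    events; later stages separate them. With the single sign \<open>1\<close> both sides contain the
    same norm, which forces \<open>1 \<le> C\<close>.\<close>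
  proof (rule UMD_bound_pmf[OF C p, where R="\<lambda>n a b. n = 0 \<or> a = b" and N=1])
    fix n :: nat and B assume n: "n \<in> {1..1}"
      and B: "\<And>x y. x \<in> set_pmf ?Q \<Longrightarrow> y \<in> set_pmf ?Q \<Longrightarrow> n - 1 = 0 \<or> x = y \<Longrightarrow> x \<in> B \<longleftrightarrow> y \<in> B"
    have "B = {} \<or> B = UNIV"
      using B[unfolded set] n by auto
    then show "(\<Sum>\<^sub>\<infinity>x\<in>set_pmf ?Q. pmf ?Q x *\<^sub>R (indicator B x *\<^sub>R d n x)) = 0"
      unfolding set by (auto simp: UNIV_bool d_def)
  qed (use nrm in auto)
  then have "ennreal (norm v) \<le> ennreal C * ennreal (norm v)"
    by (simp add: nrm)
  then have "norm v \<le> C * norm v"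
    using C by (simp flip: ennreal_mult add: UMD_bound_def)
  with v show "1 \<le> C" by simp
qed

section \<open>Decoupling on a discrete probability space\<close>

lemma nn_integral_pmf_point: "(\<integral>\<^sup>+x. c * indicator {a} x \<partial>measure_pmf Q) = ennreal (pmf Q a) * c"
  by (subst nn_integral_cmult_indicator) (simp_all add: emeasure_pmf_single mult.commute)

lemma pmf_mult_le_nn_integral: "ennreal (pmf Q a) * h a \<le> (\<integral>\<^sup>+x. h x \<partial>measure_pmf Q)"
proof -
  have "(\<integral>\<^sup>+x. h a * indicator {a} x \<partial>measure_pmf Q) \<le> (\<integral>\<^sup>+x. h x \<partial>measure_pmf Q)"
    by (intro nn_integral_mono) (auto split: split_indicator)
  then show ?thesis
    by (simp only: nn_integral_pmf_point)
qed

lemma Lp_norm_scaleR_finite: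
  assumes "0 < p" "(\<lambda>x. norm (f x)) \<in> borel_measurable M" "Lp_norm M p f < \<infinity>"
  shows "Lp_norm M p (\<lambda>x. c *\<^sub>R f x) < \<infinity>"
  using assms(3) unfolding Lp_norm_scaleR[OF assms(1,2)] infinity_ennreal_def ennreal_mult_less_top by simp

text \<open>Cell number \<open>j\<close> owns the two martingale differences with indices
  \<open>2 * j + 1\<close> and \<open>2 * j + 2\<close>.\<close>

lemma sum_pairs:
  fixes F :: "nat \<Rightarrow> 'e::comm_monoid_add"
  shows "(\<Sum>n=1..2*m. F n) = (\<Sum>j<m. F (2 * j + 1) + F (2 * j + 2))"
proof (induction m)
  case (Suc m)
  have "{1..2 * Suc m} = insert (2 * m + 1) (insert (2 * m + 2) {1..2 * m})" by auto
  then have "(\<Sum>n=1..2 * Suc m. F n) = F (2 * m + 1) + (F (2 * m + 2) + (\<Sum>n=1..2*m. F n))"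
    by simp
  then show ?case using Suc by (simp add: ac_simps)
qed simp

text \<open>An atom drawn from \<open>q\<close> lies in the \<open>j\<close>-th cell when \<open>\<tau> j\<close> is defined, and \<open>\<tau> j\<close> is
  then its child; \<open>\<nu> j\<close> is the distribution of the child conditionally on the cell.\<close>

locale discrete_decoupling =
  fixes q :: "'a pmf" and \<nu> :: "nat \<Rightarrow> 't pmf" and \<tau> :: "nat \<Rightarrow> 'a \<Rightarrow> 't option"
    and g :: "nat \<Rightarrow> 't \<Rightarrow> 'e::banach" and m :: nat and \<kappa> :: "nat \<Rightarrow> real"
  assumes loc: "\<And>j h. j < m \<Longrightarrow>
      (\<integral>\<^sup>+a. (case \<tau> j a of None \<Rightarrow> 0 | Some t \<Rightarrow> h t) \<partial>measure_pmf q) = ennreal (\<kappa> j) * (\<integral>\<^sup>+t. h t \<partial>measure_pmf (\<nu> j))"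
    and \<kappa>_pos: "\<And>j. j < m \<Longrightarrow> 0 < \<kappa> j"
    and nested: "\<And>i j a b. i < j \<Longrightarrow> j < m \<Longrightarrow> a \<in> set_pmf q \<Longrightarrow> b \<in> set_pmf q \<Longrightarrow>
      \<tau> j a \<noteq> None \<Longrightarrow> \<tau> j b \<noteq> None \<Longrightarrow> \<tau> i a = \<tau> i b"
    and integrable: "\<And>j. j < m \<Longrightarrow> (\<integral>\<^sup>+t. ennreal (norm (g j t)) \<partial>measure_pmf (\<nu> j)) < \<infinity>"
    and mean_zero: "\<And>j. j < m \<Longrightarrow> (\<Sum>\<^sub>\<infinity>t\<in>set_pmf (\<nu> j). pmf (\<nu> j) t *\<^sub>R g j t) = 0"
begin

definition Q :: "('a \<times> (nat \<Rightarrow> 't)) pmf" where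
  "Q = pair_pmf q (Pi_pmf {..<m} undefined \<nu>)"

definition \<phi> :: "nat \<Rightarrow> 'a \<times> (nat \<Rightarrow> 't) \<Rightarrow> 'e" where
  "\<phi> j x = (case \<tau> j (fst x) of None \<Rightarrow> 0 | Some t \<Rightarrow> g j t)"

definition \<psi> :: "nat \<Rightarrow> 'a \<times> (nat \<Rightarrow> 't) \<Rightarrow> 'e" where
  "\<psi> j x = (case \<tau> j (fst x) of None \<Rightarrow> 0 | Some t \<Rightarrow> g j (snd x j))"

definition rest :: "nat \<Rightarrow> (nat \<Rightarrow> 't) pmf" where
  "rest j = Pi_pmf ({..<m} - {j}) undefined \<nu>"

text \<open>Singles out the coordinate \<open>j\<close>, the independent child that is exchanged
  with the child containing the atom; \<open>rest j\<close> is the joint law of the others.\<close>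

lemma Q_split:
  assumes "j < m"
  shows "Q = pair_pmf q (map_pmf (\<lambda>(y, f). f(j := y)) (pair_pmf (\<nu> j) (rest j)))"
proof -
  have "{..<m} = insert j ({..<m} - {j})" using assms by auto
  then have "Pi_pmf {..<m} undefined \<nu> = Pi_pmf (insert j ({..<m} - {j})) undefined \<nu>" by simp
  also have "\<dots> = map_pmf (\<lambda>(y, f). f(j := y)) (pair_pmf (\<nu> j) (rest j))"
    unfolding rest_def by (rule Pi_pmf_insert) auto
  finally show ?thesis by (simp add: Q_def)
qed

lemma nn_integral_Q:
  assumes "j < m"
  shows "(\<integral>\<^sup>+x. h x \<partial>measure_pmf Q) =
    (\<integral>\<^sup>+a. \<integral>\<^sup>+y. \<integral>\<^sup>+f. h (a, f(j := y)) \<partial>measure_pmf (rest j) \<partial>measure_pmf (\<nu> j) \<partial>measure_pmf q)"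
  by (simp add: Q_split[OF assms] nn_integral_pair_pmf' nn_integral_map_pmf)

lemma set_pmf_Q:
  assumes "j < m"
  shows "set_pmf Q = {(a, f(j := y)) | a y f. a \<in> set_pmf q \<and> y \<in> set_pmf (\<nu> j) \<and> f \<in> set_pmf (rest j)}"
  by (force simp: Q_split[OF assms])

text \<open>Testing \<open>loc\<close> against the indicator of \<open>t\<close>: positive mass of
  an atom sent to \<open>t\<close> forces positive mass of \<open>\<nu> j\<close> at
  \<open>t\<close>.\<close>

lemma \<tau>_in_support:
  assumes "j < m" "a \<in> set_pmf q" "\<tau> j a = Some t"
  shows "t \<in> set_pmf (\<nu> j)"
proof (rule ccontr)
  assume t: "t \<notin> set_pmf (\<nu> j)"
  let ?h = "indicator {t} :: 't \<Rightarrow> ennreal"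
  have "(\<integral>\<^sup>+t. ?h t \<partial>measure_pmf (\<nu> j)) = 0"
    using t by (simp add: emeasure_pmf_single set_pmf_iff)
  then have "(\<integral>\<^sup>+a. (case \<tau> j a of None \<Rightarrow> 0 | Some t \<Rightarrow> ?h t) \<partial>measure_pmf q) = 0"
    using loc[OF assms(1), of ?h] by simp
  moreover have "ennreal (pmf q a) * (case \<tau> j a of None \<Rightarrow> 0 | Some t \<Rightarrow> ?h t) \<le>
      (\<integral>\<^sup>+a. (case \<tau> j a of None \<Rightarrow> 0 | Some t \<Rightarrow> ?h t) \<partial>measure_pmf q)"
    by (rule pmf_mult_le_nn_integral)
  ultimately have "ennreal (pmf q a) \<le> 0"
    by (simp add: assms(3))
  with pmf_positive[OF assms(2)] show False by simp
qed

text \<open>The converse test, where \<open>\<kappa> j > 0\<close> is essential. It supplies an atom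
  inside every child of positive probability.\<close>

lemma \<tau>_surj:
  assumes "j < m" "t \<in> set_pmf (\<nu> j)"
  shows "\<exists>a\<in>set_pmf q. \<tau> j a = Some t"
proof (rule ccontr)
  assume no: "\<not> (\<exists>a\<in>set_pmf q. \<tau> j a = Some t)"
  let ?h = "indicator {t} :: 't \<Rightarrow> ennreal"
  have "(\<integral>\<^sup>+a. (case \<tau> j a of None \<Rightarrow> 0 | Some t \<Rightarrow> ?h t) \<partial>measure_pmf q) = (\<integral>\<^sup>+a. 0 \<partial>measure_pmf q)"
    using no by (intro nn_integral_cong_AE)
      (auto simp: AE_measure_pmf_iff split: option.splits split_indicator)
  then have "ennreal (\<kappa> j) * ennreal (pmf (\<nu> j) t) = 0"
    using loc[OF assms(1), of ?h] by (simp add: emeasure_pmf_single)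
  then show False
    using \<kappa>_pos[OF assms(1)] pmf_positive[OF assms(2)] by simp
qed

lemma nn_integral_\<phi>:
  assumes "j < m" "h 0 = 0"
  shows "(\<integral>\<^sup>+x. h (\<phi> j x) \<partial>measure_pmf Q) = ennreal (\<kappa> j) * (\<integral>\<^sup>+t. h (g j t) \<partial>measure_pmf (\<nu> j))"
proof -
  have "(\<integral>\<^sup>+x. h (\<phi> j x) \<partial>measure_pmf Q) = (\<integral>\<^sup>+a. (case \<tau> j a of None \<Rightarrow> 0 | Some t \<Rightarrow> h (g j t)) \<partial>measure_pmf q)"
    unfolding Q_def nn_integral_pair_pmf'
    by (intro nn_integral_cong) (auto simp: \<phi>_def assms(2) split: option.splits)
  then show ?thesis by (simp add: loc[OF assms(1)])
qed

text \<open>\<open>\<kappa> j\<close> is the probability that the atom hits the cell. On that event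
  \<open>\<psi> j\<close> evaluates \<open>g j\<close> at an independent child with law
  \<open>\<nu> j\<close>, so it is distributed like \<open>\<phi> j\<close>; points off the cell are
  removed by \<open>h 0 = 0\<close>.\<close>

lemma nn_integral_\<psi>:
  assumes "j < m" "h 0 = 0"
  shows "(\<integral>\<^sup>+x. h (\<psi> j x) \<partial>measure_pmf Q) = ennreal (\<kappa> j) * (\<integral>\<^sup>+t. h (g j t) \<partial>measure_pmf (\<nu> j))"
proof -
  have "(\<integral>\<^sup>+x. h (\<psi> j x) \<partial>measure_pmf Q) = (\<integral>\<^sup>+a. (case \<tau> j a of None \<Rightarrow> 0 | Some t \<Rightarrow>
      (\<integral>\<^sup>+t. h (g j t) \<partial>measure_pmf (\<nu> j))) \<partial>measure_pmf q)"
    unfolding nn_integral_Q[OF assms(1)]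
    by (intro nn_integral_cong) (auto simp: \<psi>_def assms(2) split: option.splits)
  then show ?thesis by (simp add: loc[OF assms(1)])
qed

text \<open>One integrability condition, free of the sample space \<open>Q\<close>, that controls
  both the original and the decoupled term of step \<open>j\<close>.\<close>

definition Lp_finite :: "real \<Rightarrow> nat \<Rightarrow> bool" where
  "Lp_finite p j \<longleftrightarrow> (\<integral>\<^sup>+t. ennreal (norm (g j t) powr p) \<partial>measure_pmf (\<nu> j)) < \<infinity>"

lemma Lp_norm_\<phi>_finite_iff:
  assumes "0 < p" "j < m"
  shows "Lp_norm (measure_pmf Q) p (\<phi> j) < \<infinity> \<longleftrightarrow> Lp_finite p j"
  unfolding Lp_norm_less_top_iff Lp_finite_def
  using \<kappa>_pos[OF assms(2)] assms
  by (subst nn_integral_\<phi>[where h="\<lambda>v. ennreal (norm v powr p)"])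
    (auto simp: ennreal_mult_less_top)

lemma Lp_norm_\<psi>_finite:
  assumes "0 < p" "j < m" "Lp_finite p j"
  shows "Lp_norm (measure_pmf Q) p (\<psi> j) < \<infinity>"
  unfolding Lp_norm_less_top_iff
  using assms(3) assms unfolding Lp_finite_def
  by (subst nn_integral_\<psi>[where h="\<lambda>v. ennreal (norm v powr p)"])
    (auto simp: ennreal_mult_less_top)

text \<open>The first of the two martingale differences belonging to a cell is symmetric, and the second
  antisymmetric, under exchanging the child containing the atom and the independent child;
  hence the relation for the half step only remembers the two children as an unordered pair.\<close>

definition same :: "nat \<Rightarrow> 'a \<times> (nat \<Rightarrow> 't) \<Rightarrow> 'a \<times> (nat \<Rightarrow> 't) \<Rightarrow> bool" where
  "same j x y \<longleftrightarrow> \<tau> j (fst x) = \<tau> j (fst y) \<and> snd x j = snd y j"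

text \<open>If the atom misses the cell, \<open>None\<close> is a member of the pair, so the
  unordered pair still records the miss.\<close>

definition swapped :: "nat \<Rightarrow> 'a \<times> (nat \<Rightarrow> 't) \<Rightarrow> 'a \<times> (nat \<Rightarrow> 't) \<Rightarrow> bool" where
  "swapped j x y \<longleftrightarrow> {\<tau> j (fst x), Some (snd x j)} = {\<tau> j (fst y), Some (snd y j)}"

definition R :: "nat \<Rightarrow> 'a \<times> (nat \<Rightarrow> 't) \<Rightarrow> 'a \<times> (nat \<Rightarrow> 't) \<Rightarrow> bool" where
  "R n x y \<longleftrightarrow> (\<forall>i<n div 2. same i x y) \<and> (odd n \<longrightarrow> swapped (n div 2) x y)"

text \<open>Differences are numbered from \<open>1\<close>: odd indices carry the symmetric half and
  even ones the antisymmetric half of cell \<open>(n - 1) div 2\<close>.\<close>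

definition \<delta> :: "nat \<Rightarrow> 'a \<times> (nat \<Rightarrow> 't) \<Rightarrow> 'e" where
  "\<delta> n x = (let j = (n - 1) div 2 in
     (1/2) *\<^sub>R \<phi> j x + (if odd n then 1/2 else -1/2) *\<^sub>R \<psi> j x)"

lemma R_Suc: "R (Suc n) x y \<Longrightarrow> R n x y"
proof (cases "odd n")
  case True
  then have "Suc n div 2 = Suc (n div 2)" by (auto elim: oddE)
  with True show "R (Suc n) x y \<Longrightarrow> R n x y"
    by (auto simp: R_def same_def swapped_def)
next
  case False
  then show "R (Suc n) x y \<Longrightarrow> R n x y"
    by (auto simp: R_def)
qed

text \<open>For odd \<open>n\<close> the value is a symmetric function of the unordered pair, and
  zero if \<open>None\<close> belongs to the pair. For even \<open>n\<close> the step is complete,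
  so both children agree individually.\<close>

lemma \<delta>_adapted:
  assumes "1 \<le> n" "R n x y"
  shows "\<delta> n x = \<delta> n y"
proof (cases "odd n")
  case True
  then have j: "(n - Suc 0) div 2 = n div 2" by (auto elim: oddE)
  let ?j = "n div 2"
  have sw: "{\<tau> ?j (fst x), Some (snd x ?j)} = {\<tau> ?j (fst y), Some (snd y ?j)}"
    using assms(2) True by (auto simp: R_def swapped_def)
  then have "\<phi> ?j x + \<psi> ?j x = \<phi> ?j y + \<psi> ?j y"
    by (cases "\<tau> ?j (fst x)"; cases "\<tau> ?j (fst y)")
      (auto simp: \<phi>_def \<psi>_def doubleton_eq_iff add.commute)
  then show ?thesis
    using True by (simp add: \<delta>_def Let_def j scaleR_add_right[symmetric])
next
  case False
  with assms have "(n - 1) div 2 < n div 2" by (auto elim!: evenE)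
  then have "same ((n - 1) div 2) x y"
    using assms(2) by (auto simp: R_def)
  then show ?thesis
    by (auto simp: \<delta>_def Let_def same_def \<phi>_def \<psi>_def split: option.splits)
qed

section \<open>Vanishing conditional mean of the two halves\<close>

context
  fixes j n :: nat and B :: "('a \<times> (nat \<Rightarrow> 't)) set"
  assumes j: "j < m" and n: "n = 2 * j \<or> n = 2 * j + 1"
    and B: "\<And>x y. x \<in> set_pmf Q \<Longrightarrow> y \<in> set_pmf Q \<Longrightarrow> R n x y \<Longrightarrow> x \<in> B \<longleftrightarrow> y \<in> B"
begin

definition atom :: "'t \<Rightarrow> 'a" where
  "atom t = (SOME a. a \<in> set_pmf q \<and> \<tau> j a = Some t)"

lemma atom: "t \<in> set_pmf (\<nu> j) \<Longrightarrow> atom t \<in> set_pmf q" "t \<in> set_pmf (\<nu> j) \<Longrightarrow> \<tau> j (atom t) = Some t"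
  using someI_ex[OF \<tau>_surj[OF j, unfolded Bex_def], of t] by (simp_all add: atom_def)

text \<open>The conditional probability of the past event \<open>B\<close> when the atom lies in the
  child \<open>s\<close> and the independent child is \<open>t\<close>. Evaluating at one
  representative atom loses nothing, by \<open>w_cong\<close>.\<close>

definition w :: "'t \<Rightarrow> 't \<Rightarrow> ennreal" where
  "w s t = (\<integral>\<^sup>+f. indicator B (atom s, f(j := t)) \<partial>measure_pmf (rest j))"

text \<open>Two atoms in the cell have the same past by \<open>nested\<close>, and the other
  coordinates coincide because both points use \<open>f\<close>. So stage \<open>2 * j\<close> does
  not see the children of step \<open>j\<close>, and stage \<open>2 * j + 1\<close> sees only their
  unordered pair.\<close>

lemma R_children:
  assumes "a \<in> set_pmf q" "b \<in> set_pmf q" "\<tau> j a = Some s" "\<tau> j b = Some s'"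
    and "n = 2 * j + 1 \<Longrightarrow> {s, t} = {s', t'}"
  shows "R n (a, f(j := t)) (b, f(j := t'))"
proof -
  have "n div 2 = j" using n by auto
  moreover have "\<tau> i a = \<tau> i b" if "i < j" for i
    using nested[OF that j assms(1,2)] assms by simp
  moreover have "odd n \<Longrightarrow> swapped j (a, f(j := t)) (b, f(j := t'))"
    using n assms by (auto simp: swapped_def doubleton_eq_iff)
  ultimately show ?thesis
    by (auto simp: R_def same_def)
qed

lemma w_cong:
  assumes "a \<in> set_pmf q" "\<tau> j a = Some s" "s' \<in> set_pmf (\<nu> j)" "t \<in> set_pmf (\<nu> j)" "t' \<in> set_pmf (\<nu> j)"
    and "n = 2 * j + 1 \<Longrightarrow> {s, t} = {s', t'}"
  shows "(\<integral>\<^sup>+f. indicator B (a, f(j := t)) \<partial>measure_pmf (rest j)) = w s' t'"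
  unfolding w_def
proof (rule nn_integral_cong_AE, unfold AE_measure_pmf_iff, intro ballI)
  fix f assume f: "f \<in> set_pmf (rest j)"
  have "(a, f(j := t)) \<in> B \<longleftrightarrow> (atom s', f(j := t')) \<in> B"
  proof (rule B)
    show "(a, f(j := t)) \<in> set_pmf Q" "(atom s', f(j := t')) \<in> set_pmf Q"
      unfolding set_pmf_Q[OF j] using f assms atom by blast+
    show "R n (a, f(j := t)) (atom s', f(j := t'))"
      using assms atom by (intro R_children) auto
  qed
  then show "(indicator B (a, f(j := t)) :: ennreal) = indicator B (atom s', f(j := t'))"
    by (simp split: split_indicator)
qed

text \<open>Exchangeability: no event of the past distinguishes the two orders of the pair. This
  equates the integrals of \<open>\<phi> j\<close> and \<open>\<psi> j\<close> over
  \<open>B\<close>.\<close>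

lemma w_sym: "s \<in> set_pmf (\<nu> j) \<Longrightarrow> t \<in> set_pmf (\<nu> j) \<Longrightarrow> w s t = w t s"
  using w_cong[of "atom s" s t t s] atom by (auto simp: w_def)

lemma w_const:
  assumes "n = 2 * j" "s \<in> set_pmf (\<nu> j)" "t \<in> set_pmf (\<nu> j)" "s' \<in> set_pmf (\<nu> j)" "t' \<in> set_pmf (\<nu> j)"
  shows "w s t = w s' t'"
  using w_cong[of "atom s" s s' t t'] atom assms by (auto simp: w_def)

definition X :: "('a \<times> (nat \<Rightarrow> 't)) set" where
  "X = {x \<in> B. \<tau> j (fst x) \<noteq> None}"

text \<open>On the cell, the atom's child and the independent child are independent with the common
  law \<open>\<nu> j\<close>, and \<open>w\<close> is the conditional probability of
  \<open>B\<close>. \<open>Z\<close> stands for an event that depends on the two children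
  only.\<close>

lemma emeasure_X_vimage:
  assumes "\<And>a s y. a \<in> set_pmf q \<Longrightarrow> \<tau> j a = Some s \<Longrightarrow> y \<in> set_pmf (\<nu> j) \<Longrightarrow>
      (\<And>f. (a, f(j := y)) \<in> Z \<longleftrightarrow> z s y)"
  shows "emeasure (measure_pmf Q) (X \<inter> Z) =
    ennreal (\<kappa> j) * (\<integral>\<^sup>+s. \<integral>\<^sup>+y. (if z s y then w s y else 0) \<partial>measure_pmf (\<nu> j) \<partial>measure_pmf (\<nu> j))"
proof -
  have "emeasure (measure_pmf Q) (X \<inter> Z) = (\<integral>\<^sup>+x. indicator (X \<inter> Z) x \<partial>measure_pmf Q)"
    by simp
  also have "\<dots> = (\<integral>\<^sup>+a. \<integral>\<^sup>+y. \<integral>\<^sup>+f. indicator (X \<inter> Z) (a, f(j := y)) \<partial>measure_pmf (rest j) \<partial>measure_pmf (\<nu> j) \<partial>measure_pmf q)"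
    by (rule nn_integral_Q[OF j])
  also have "\<dots> = (\<integral>\<^sup>+a. (case \<tau> j a of None \<Rightarrow> 0 | Some s \<Rightarrow>
      (\<integral>\<^sup>+y. (if z s y then w s y else 0) \<partial>measure_pmf (\<nu> j))) \<partial>measure_pmf q)"
  proof (rule nn_integral_cong_AE, unfold AE_measure_pmf_iff, intro ballI)
    fix a assume a: "a \<in> set_pmf q"
    show "(\<integral>\<^sup>+y. \<integral>\<^sup>+f. indicator (X \<inter> Z) (a, f(j := y)) \<partial>measure_pmf (rest j) \<partial>measure_pmf (\<nu> j)) =
      (case \<tau> j a of None \<Rightarrow> 0 | Some s \<Rightarrow> (\<integral>\<^sup>+y. (if z s y then w s y else 0) \<partial>measure_pmf (\<nu> j)))"
    proof (cases "\<tau> j a")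
      case None
      then show ?thesis by (simp add: X_def)
    next
      case (Some s)
      have s: "s \<in> set_pmf (\<nu> j)" by (rule \<tau>_in_support[OF j a Some])
      have "(\<integral>\<^sup>+y. \<integral>\<^sup>+f. indicator (X \<inter> Z) (a, f(j := y)) \<partial>measure_pmf (rest j) \<partial>measure_pmf (\<nu> j)) =
          (\<integral>\<^sup>+y. (if z s y then w s y else 0) \<partial>measure_pmf (\<nu> j))"
      proof (rule nn_integral_cong_AE, unfold AE_measure_pmf_iff, intro ballI)
        fix y assume y: "y \<in> set_pmf (\<nu> j)"
        have "(\<integral>\<^sup>+f. indicator (X \<inter> Z) (a, f(j := y)) \<partial>measure_pmf (rest j)) =
            (\<integral>\<^sup>+f. (if z s y then indicator B (a, f(j := y)) else 0) \<partial>measure_pmf (rest j))"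
          using assms[OF a Some y] Some by (intro nn_integral_cong) (auto simp: X_def split: split_indicator)
        also have "\<dots> = (if z s y then w s y else 0)"
          using w_cong[OF a Some s y y] by simp
        finally show "(\<integral>\<^sup>+f. indicator (X \<inter> Z) (a, f(j := y)) \<partial>measure_pmf (rest j)) = (if z s y then w s y else 0)" .
      qed
      with Some show ?thesis by simp
    qed
  qed
  also have "\<dots> = ennreal (\<kappa> j) * (\<integral>\<^sup>+s. \<integral>\<^sup>+y. (if z s y then w s y else 0) \<partial>measure_pmf (\<nu> j) \<partial>measure_pmf (\<nu> j))"
    by (rule loc[OF j])
  finally show ?thesis .
qed

text \<open>The conditional probability of \<open>B\<close> given that the atom lies in
  \<open>t\<close>; by symmetry of \<open>w\<close> also the one given that the cell is hit and the
  independent child is \<open>t\<close>.\<close>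

definition mass :: "'t \<Rightarrow> ennreal" where
  "mass t = (\<integral>\<^sup>+y. w t y \<partial>measure_pmf (\<nu> j))"

lemma emeasure_own_child:
  "emeasure (measure_pmf Q) (X \<inter> (\<lambda>x. the (\<tau> j (fst x))) -` {t}) = ennreal (\<kappa> j) * (ennreal (pmf (\<nu> j) t) * mass t)"
proof -
  have "emeasure (measure_pmf Q) (X \<inter> (\<lambda>x. the (\<tau> j (fst x))) -` {t}) =
    ennreal (\<kappa> j) * (\<integral>\<^sup>+s. \<integral>\<^sup>+y. (if s = t then w s y else 0) \<partial>measure_pmf (\<nu> j) \<partial>measure_pmf (\<nu> j))"
    by (rule emeasure_X_vimage) simp
  also have "(\<integral>\<^sup>+s. \<integral>\<^sup>+y. (if s = t then w s y else 0) \<partial>measure_pmf (\<nu> j) \<partial>measure_pmf (\<nu> j)) =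
      (\<integral>\<^sup>+s. mass t * indicator {t} s \<partial>measure_pmf (\<nu> j))"
    by (intro nn_integral_cong) (auto simp: mass_def split: split_indicator)
  also have "\<dots> = ennreal (pmf (\<nu> j) t) * mass t"
    by (rule nn_integral_pmf_point)
  finally show ?thesis .
qed

lemma emeasure_other_child:
  assumes "t \<in> set_pmf (\<nu> j)"
  shows "emeasure (measure_pmf Q) (X \<inter> (\<lambda>x. snd x j) -` {t}) = ennreal (\<kappa> j) * (ennreal (pmf (\<nu> j) t) * mass t)"
proof -
  have "emeasure (measure_pmf Q) (X \<inter> (\<lambda>x. snd x j) -` {t}) =
    ennreal (\<kappa> j) * (\<integral>\<^sup>+s. \<integral>\<^sup>+y. (if y = t then w s y else 0) \<partial>measure_pmf (\<nu> j) \<partial>measure_pmf (\<nu> j))"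
    by (rule emeasure_X_vimage) simp
  also have "(\<integral>\<^sup>+s. \<integral>\<^sup>+y. (if y = t then w s y else 0) \<partial>measure_pmf (\<nu> j) \<partial>measure_pmf (\<nu> j)) =
      (\<integral>\<^sup>+s. ennreal (pmf (\<nu> j) t) * w s t \<partial>measure_pmf (\<nu> j))"
  proof (rule nn_integral_cong)
    fix s
    have "(\<integral>\<^sup>+y. (if y = t then w s y else 0) \<partial>measure_pmf (\<nu> j)) = (\<integral>\<^sup>+y. w s t * indicator {t} y \<partial>measure_pmf (\<nu> j))"
      by (intro nn_integral_cong) (auto split: split_indicator)
    then show "(\<integral>\<^sup>+y. (if y = t then w s y else 0) \<partial>measure_pmf (\<nu> j)) = ennreal (pmf (\<nu> j) t) * w s t"
      by (simp only: nn_integral_pmf_point)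
  qed
  also have "\<dots> = ennreal (pmf (\<nu> j) t) * (\<integral>\<^sup>+s. w s t \<partial>measure_pmf (\<nu> j))"
    by (simp add: nn_integral_cmult)
  also have "(\<integral>\<^sup>+s. w s t \<partial>measure_pmf (\<nu> j)) = mass t"
    unfolding mass_def using w_sym[OF _ assms]
    by (intro nn_integral_cong_AE) (simp add: AE_measure_pmf_iff)
  finally show ?thesis .
qed

lemma norm_\<phi>_integrable: "(\<integral>\<^sup>+x. ennreal (norm (indicator B x *\<^sub>R \<phi> j x)) \<partial>measure_pmf Q) < \<infinity>"
proof -
  have "(\<integral>\<^sup>+x. ennreal (norm (indicator B x *\<^sub>R \<phi> j x)) \<partial>measure_pmf Q) \<le> (\<integral>\<^sup>+x. ennreal (norm (\<phi> j x)) \<partial>measure_pmf Q)"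
    by (intro nn_integral_mono) (simp split: split_indicator)
  also have "\<dots> < \<infinity>"
    using integrable[OF j] by (subst nn_integral_\<phi>[OF j]) (simp_all add: ennreal_mult_less_top)
  finally show ?thesis .
qed

lemma norm_\<psi>_integrable: "(\<integral>\<^sup>+x. ennreal (norm (indicator B x *\<^sub>R \<psi> j x)) \<partial>measure_pmf Q) < \<infinity>"
proof -
  have "(\<integral>\<^sup>+x. ennreal (norm (indicator B x *\<^sub>R \<psi> j x)) \<partial>measure_pmf Q) \<le> (\<integral>\<^sup>+x. ennreal (norm (\<psi> j x)) \<partial>measure_pmf Q)"
    by (intro nn_integral_mono) (simp split: split_indicator)
  also have "\<dots> < \<infinity>"
    using integrable[OF j] by (subst nn_integral_\<psi>[OF j]) (simp_all add: ennreal_mult_less_top)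
  finally show ?thesis .
qed

lemma infsum_\<phi>:
  "(\<Sum>\<^sub>\<infinity>x\<in>set_pmf Q. pmf Q x *\<^sub>R (indicator B x *\<^sub>R \<phi> j x)) =
    (\<Sum>\<^sub>\<infinity>t\<in>set_pmf (\<nu> j). enn2real (ennreal (\<kappa> j) * (ennreal (pmf (\<nu> j) t) * mass t)) *\<^sub>R g j t)"
proof -
  have "(\<Sum>\<^sub>\<infinity>x\<in>set_pmf Q. pmf Q x *\<^sub>R (indicator B x *\<^sub>R \<phi> j x)) =
    (\<Sum>\<^sub>\<infinity>t\<in>set_pmf (\<nu> j). measure_pmf.prob Q (X \<inter> (\<lambda>x. the (\<tau> j (fst x))) -` {t}) *\<^sub>R g j t)"
  proof (rule infsum_pmf_fibers[OF norm_\<phi>_integrable])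
    show "(\<lambda>x. the (\<tau> j (fst x))) ` (set_pmf Q \<inter> X) \<subseteq> set_pmf (\<nu> j)"
      using \<tau>_in_support[OF j] by (auto simp: Q_def X_def)
  qed (auto simp: X_def \<phi>_def split: split_indicator)
  then show ?thesis
    by (simp add: measure_def emeasure_own_child)
qed

text \<open>Regrouping by the independent child instead of the atom's own child leads to the very
  series of \<open>infsum_\<phi>\<close>, because both children have the same weighted law on
  \<open>B\<close>.\<close>

lemma infsum_\<psi>:
  "(\<Sum>\<^sub>\<infinity>x\<in>set_pmf Q. pmf Q x *\<^sub>R (indicator B x *\<^sub>R \<psi> j x)) =
    (\<Sum>\<^sub>\<infinity>t\<in>set_pmf (\<nu> j). enn2real (ennreal (\<kappa> j) * (ennreal (pmf (\<nu> j) t) * mass t)) *\<^sub>R g j t)"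
proof -
  have "(\<Sum>\<^sub>\<infinity>x\<in>set_pmf Q. pmf Q x *\<^sub>R (indicator B x *\<^sub>R \<psi> j x)) =
    (\<Sum>\<^sub>\<infinity>t\<in>set_pmf (\<nu> j). measure_pmf.prob Q (X \<inter> (\<lambda>x. snd x j) -` {t}) *\<^sub>R g j t)"
  proof (rule infsum_pmf_fibers[OF norm_\<psi>_integrable])
    show "(\<lambda>x. snd x j) ` (set_pmf Q \<inter> X) \<subseteq> set_pmf (\<nu> j)"
      by (auto simp: set_pmf_Q[OF j])
  qed (auto simp: X_def \<psi>_def split: split_indicator)
  then show ?thesis
    by (simp add: measure_def emeasure_other_child cong: infsum_cong)
qed

text \<open>Both halves integrate the common value \<open>I\<close>. For odd \<open>n\<close> the
  two contributions cancel. For even \<open>n\<close> the event ignores the children, so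
  \<open>mass\<close> is constant on the support and \<open>I\<close> is a multiple of the mean of
  \<open>g j\<close>, which is zero.\<close>

lemma infsum_\<delta>: "(\<Sum>\<^sub>\<infinity>x\<in>set_pmf Q. pmf Q x *\<^sub>R (indicator B x *\<^sub>R \<delta> (Suc n) x)) = 0"
proof -
  have jj: "n div 2 = j" using n by auto
  define b :: real where "b = (if even n then 1/2 else -1/2)"
  define I where "I = (\<Sum>\<^sub>\<infinity>t\<in>set_pmf (\<nu> j). enn2real (ennreal (\<kappa> j) * (ennreal (pmf (\<nu> j) t) * mass t)) *\<^sub>R g j t)"
  have "(\<Sum>\<^sub>\<infinity>x\<in>set_pmf Q. pmf Q x *\<^sub>R (indicator B x *\<^sub>R \<delta> (Suc n) x)) =
    (\<Sum>\<^sub>\<infinity>x\<in>set_pmf Q. pmf Q x *\<^sub>R ((1/2) *\<^sub>R (indicator B x *\<^sub>R \<phi> j x) + b *\<^sub>R (indicator B x *\<^sub>R \<psi> j x)))"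
    by (simp add: \<delta>_def jj b_def scaleR_add_right mult.commute)
  also have "\<dots> = (1/2) *\<^sub>R I + b *\<^sub>R I"
    unfolding I_def infsum_pmf_add[OF norm_\<phi>_integrable norm_\<psi>_integrable] infsum_\<phi> infsum_\<psi> ..
  also have "\<dots> = 0"
  proof (cases "even n")
    case False
    then show ?thesis by (simp add: b_def)
  next
    case True
    with n have n: "n = 2 * j" by auto
    obtain t0 where t0: "t0 \<in> set_pmf (\<nu> j)"
      using set_pmf_not_empty[of "\<nu> j"] by blast
    have "mass t = mass t0" if "t \<in> set_pmf (\<nu> j)" for t
      unfolding mass_def using w_const[OF n that _ t0]
      by (intro nn_integral_cong_AE) (simp add: AE_measure_pmf_iff)
    then have "I = (\<Sum>\<^sub>\<infinity>t\<in>set_pmf (\<nu> j). (\<kappa> j * enn2real (mass t0)) *\<^sub>R (pmf (\<nu> j) t *\<^sub>R g j t))"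
      unfolding I_def using \<kappa>_pos[OF j]
      by (intro infsum_cong) (simp add: enn2real_mult ac_simps)
    also have "\<dots> = 0"
      by (simp add: infsum_scaleR_right mean_zero[OF j] del: scaleR_scaleR)
    finally show ?thesis by simp
  qed
  finally show ?thesis .
qed

end

text \<open>The sign \<open>e j\<close> on the symmetric half and \<open>- e j\<close> on the
  antisymmetric half cancel the \<open>\<phi> j\<close> parts and add up the \<open>\<psi> j\<close>
  parts.\<close>

lemma sum_\<delta>:
  assumes "\<forall>j<m. e j \<in> {-1, 1 :: real}"
  defines "s \<equiv> \<lambda>n. if odd n then e ((n - 1) div 2) else - e ((n - 1) div 2)"
  shows "(\<Sum>n=1..2*m. \<delta> n x) = (\<Sum>j<m. \<phi> j x)"
    and "(\<Sum>n=1..2*m. s n *\<^sub>R \<delta> n x) = (\<Sum>j<m. e j *\<^sub>R \<psi> j x)"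
    and "n \<in> {1..2*m} \<Longrightarrow> s n \<in> {-1, 1}"
proof -
  have \<delta>: "\<delta> (2 * j + 1) x = (1/2) *\<^sub>R \<phi> j x + (1/2) *\<^sub>R \<psi> j x"
    "\<delta> (2 * j + 2) x = (1/2) *\<^sub>R \<phi> j x - (1/2) *\<^sub>R \<psi> j x" for j
    by (simp_all add: \<delta>_def)
  have s: "s (2 * j + 1) = e j" "s (2 * j + 2) = - e j" for j
    by (simp_all add: s_def)
  have half: "(1/2) *\<^sub>R v + (1/2) *\<^sub>R v = v" for v :: 'e
    by (simp flip: scaleR_left_distrib)
  show "(\<Sum>n=1..2*m. \<delta> n x) = (\<Sum>j<m. \<phi> j x)"
    unfolding sum_pairs \<delta> using half by (intro sum.cong refl) simp
  show "(\<Sum>n=1..2*m. s n *\<^sub>R \<delta> n x) = (\<Sum>j<m. e j *\<^sub>R \<psi> j x)"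
  proof -
    have "c *\<^sub>R (u + v) + - c *\<^sub>R (u - v) = c *\<^sub>R (v + v)" for c :: real and u v :: 'e
      by (simp add: algebra_simps)
    then show ?thesis
      unfolding sum_pairs \<delta> s half by (simp only: half)
  qed
  show "s n \<in> {-1, 1}" if "n \<in> {1..2*m}"
  proof -
    have "(n - 1) div 2 < m" using that by auto
    with assms(1)[rule_format, of "(n - 1) div 2"] show ?thesis by (auto simp: s_def)
  qed
qed

text \<open>Prescribed signs \<open>t\<close> leave the martingale difference property intact, so
  one bound compares any two sign patterns. The choices \<open>t = 1\<close> and
  \<open>t = s\<close> give the two directions of decoupling.\<close>

lemma \<delta>_UMD:
  assumes C: "UMD_bound TYPE('e) p C" and p: "1 \<le> p" and fin: "\<forall>j<m. Lp_finite p j"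
    and s: "\<And>n. n \<in> {1..2*m} \<Longrightarrow> s n \<in> {-1, 1 :: real}" and t: "\<And>n. n \<in> {1..2*m} \<Longrightarrow> t n \<in> {-1, 1 :: real}"
  shows "Lp_norm (measure_pmf Q) p (\<lambda>x. \<Sum>n=1..2*m. s n *\<^sub>R t n *\<^sub>R \<delta> n x) \<le>
    ennreal C * Lp_norm (measure_pmf Q) p (\<lambda>x. \<Sum>n=1..2*m. t n *\<^sub>R \<delta> n x)"
proof (rule UMD_bound_pmf[OF C p R_Suc _ _ _ s])
  fix n assume n: "n \<in> {1..2*m}"
  let ?j = "(n - 1) div 2"
  have j: "?j < m" using n by auto
  show "t n *\<^sub>R \<delta> n x = t n *\<^sub>R \<delta> n y" if "R n x y" for x y
    using \<delta>_adapted[OF _ that] n by simp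
  show "Lp_norm (measure_pmf Q) p (\<lambda>x. t n *\<^sub>R \<delta> n x) < \<infinity>"
  proof -
    define b :: real where "b = (if odd n then 1/2 else -1/2)"
    have "Lp_norm (measure_pmf Q) p (\<lambda>x. (1/2) *\<^sub>R \<phi> ?j x + b *\<^sub>R \<psi> ?j x) < \<infinity>"
    proof (rule Lp_norm_finite_add[OF p])
      show "Lp_norm (measure_pmf Q) p (\<lambda>x. (1/2) *\<^sub>R \<phi> ?j x) < \<infinity>"
        using p j fin Lp_norm_\<phi>_finite_iff[of p ?j]
        by (intro Lp_norm_scaleR_finite) simp_all
      show "Lp_norm (measure_pmf Q) p (\<lambda>x. b *\<^sub>R \<psi> ?j x) < \<infinity>"
        using p j fin Lp_norm_\<psi>_finite[of p ?j]
        by (intro Lp_norm_scaleR_finite) simp_all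
    qed simp_all
    then have "Lp_norm (measure_pmf Q) p (\<delta> n) < \<infinity>"
      by (simp only: \<delta>_def[abs_def] b_def Let_def)
    then show ?thesis
      using p by (intro Lp_norm_scaleR_finite) simp_all
  qed
  fix B assume B: "\<And>x y. x \<in> set_pmf Q \<Longrightarrow> y \<in> set_pmf Q \<Longrightarrow> R (n - 1) x y \<Longrightarrow> x \<in> B \<longleftrightarrow> y \<in> B"
  have "n - 1 = 2 * ?j \<or> n - 1 = 2 * ?j + 1" by presburger
  from infsum_\<delta>[OF j this B] n
  have 0: "(\<Sum>\<^sub>\<infinity>x\<in>set_pmf Q. pmf Q x *\<^sub>R (indicator B x *\<^sub>R \<delta> n x)) = 0" by simp
  have "(\<Sum>\<^sub>\<infinity>x\<in>set_pmf Q. pmf Q x *\<^sub>R (indicator B x *\<^sub>R t n *\<^sub>R \<delta> n x)) =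
      (\<Sum>\<^sub>\<infinity>x\<in>set_pmf Q. t n *\<^sub>R (pmf Q x *\<^sub>R (indicator B x *\<^sub>R \<delta> n x)))"
    by (simp add: ac_simps)
  also have "\<dots> = 0" by (simp add: infsum_scaleR_right 0 del: scaleR_scaleR)
  finally show "(\<Sum>\<^sub>\<infinity>x\<in>set_pmf Q. pmf Q x *\<^sub>R (indicator B x *\<^sub>R t n *\<^sub>R \<delta> n x)) = 0" .
qed

lemma decoupling_UMD:
  assumes C: "UMD_bound TYPE('e) p C" and p: "1 \<le> p" and fin: "\<forall>j<m. Lp_finite p j"
    and e: "\<forall>j<m. e j \<in> {-1, 1 :: real}"
  shows "Lp_norm (measure_pmf Q) p (\<lambda>x. \<Sum>j<m. e j *\<^sub>R \<psi> j x) \<le> ennreal C * Lp_norm (measure_pmf Q) p (\<lambda>x. \<Sum>j<m. \<phi> j x)"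
    and "Lp_norm (measure_pmf Q) p (\<lambda>x. \<Sum>j<m. \<phi> j x) \<le> ennreal C * Lp_norm (measure_pmf Q) p (\<lambda>x. \<Sum>j<m. e j *\<^sub>R \<psi> j x)"
proof -
  define s where "s n = (if odd n then e ((n - 1) div 2) else - e ((n - 1) div 2))" for n
  note sums = sum_\<delta>[OF e, folded s_def]
  have ss: "s n *\<^sub>R s n *\<^sub>R \<delta> n x = \<delta> n x" if "n \<in> {1..2*m}" for n x
    using sums(3)[OF that] by auto
  show "Lp_norm (measure_pmf Q) p (\<lambda>x. \<Sum>j<m. e j *\<^sub>R \<psi> j x) \<le> ennreal C * Lp_norm (measure_pmf Q) p (\<lambda>x. \<Sum>j<m. \<phi> j x)"
    using \<delta>_UMD[where s=s and t="\<lambda>_. 1", OF C p fin sums(3)] by (simp add: sums(1,2) del: One_nat_def)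
  show "Lp_norm (measure_pmf Q) p (\<lambda>x. \<Sum>j<m. \<phi> j x) \<le> ennreal C * Lp_norm (measure_pmf Q) p (\<lambda>x. \<Sum>j<m. e j *\<^sub>R \<psi> j x)"
    using \<delta>_UMD[where s=s and t=s, OF C p fin sums(3) sums(3)] unfolding sums(2) by (simp only: ss sums(1) cong: sum.cong)
qed

text \<open>On the last cell all earlier terms have a constant sum \<open>r\<close>, by
  \<open>nested\<close>. Hence the last term is the full sum minus \<open>r\<close>, cut off to that
  cell, and lies in Lp; subtracting it leaves a shorter sum.\<close>

lemma Lp_finite_of_\<phi>:
  assumes p: "1 \<le> p" and fin: "Lp_norm (measure_pmf Q) p (\<lambda>x. \<Sum>j<l. \<phi> j x) < \<infinity>" and l: "l \<le> m" "j < l"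
  shows "Lp_finite p j"
  using fin l
proof (induction l)
  case (Suc l)
  then have lm: "l < m" by simp
  obtain t0 where t0: "t0 \<in> set_pmf (\<nu> l)"
    using set_pmf_not_empty[of "\<nu> l"] by blast
  then obtain b where b: "b \<in> set_pmf q" "\<tau> l b = Some t0"
    using \<tau>_surj[OF lm] by blast
  define r where "r = (\<Sum>j<l. \<phi> j (b, undefined))"
  have eq: "\<phi> l x = indicator {x. \<tau> l (fst x) \<noteq> None} x *\<^sub>R (\<Sum>j<Suc l. \<phi> j x) + indicator {x. \<tau> l (fst x) \<noteq> None} x *\<^sub>R (- r)"
    if "x \<in> set_pmf Q" for x
  proof (cases "\<tau> l (fst x)")
    case (Some t)
    have "\<tau> i (fst x) = \<tau> i b" if "i < l" for i
    proof (rule nested[OF that lm _ b(1)])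
      show "fst x \<in> set_pmf q" using \<open>x \<in> set_pmf Q\<close> by (auto simp: Q_def)
    qed (simp_all add: Some b)
    then have "(\<Sum>j<l. \<phi> j x) = r"
      unfolding r_def by (intro sum.cong refl) (simp add: \<phi>_def)
    with Some show ?thesis by simp
  qed (simp add: \<phi>_def)
  have "Lp_norm (measure_pmf Q) p (\<phi> l) = Lp_norm (measure_pmf Q) p
      (\<lambda>x. indicator {x. \<tau> l (fst x) \<noteq> None} x *\<^sub>R (\<Sum>j<Suc l. \<phi> j x) + indicator {x. \<tau> l (fst x) \<noteq> None} x *\<^sub>R (- r))"
    using eq by (intro Lp_norm_pmf_cong) simp
  also have "\<dots> < \<infinity>"
  proof (rule Lp_norm_finite_add[OF p])
    show "Lp_norm (measure_pmf Q) p (\<lambda>x. indicator {x. \<tau> l (fst x) \<noteq> None} x *\<^sub>R (\<Sum>j<Suc l. \<phi> j x)) < \<infinity>"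
    proof (rule le_less_trans[OF Lp_norm_mono Suc.prems(1)])
      show "norm (indicator {x. \<tau> l (fst x) \<noteq> None} x *\<^sub>R (\<Sum>j<Suc l. \<phi> j x)) \<le> norm (\<Sum>j<Suc l. \<phi> j x)" for x
        by (simp only: norm_scaleR) (simp split: split_indicator)
    qed (use p in simp)
    have "Lp_norm (measure_pmf Q) p (\<lambda>x. indicator {x. \<tau> l (fst x) \<noteq> None} x *\<^sub>R (- r)) \<le> Lp_norm (measure_pmf Q) p (\<lambda>x. r)"
      using p by (intro Lp_norm_mono) (auto split: split_indicator)
    also have "\<dots> < \<infinity>"
      by (simp add: Lp_norm_def ennreal_powr_ennreal)
    finally show "Lp_norm (measure_pmf Q) p (\<lambda>x. indicator {x. \<tau> l (fst x) \<noteq> None} x *\<^sub>R (- r)) < \<infinity>" .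
  qed simp_all
  finally have fl: "Lp_norm (measure_pmf Q) p (\<phi> l) < \<infinity>" .
  show ?case
  proof (cases "j = l")
    case True
    with fl p lm show ?thesis by (simp add: Lp_norm_\<phi>_finite_iff[unfolded infinity_ennreal_def])
  next
    case False
    have "Lp_norm (measure_pmf Q) p (\<lambda>x. (\<Sum>j<Suc l. \<phi> j x) + - \<phi> l x) < \<infinity>"
    proof (rule Lp_norm_finite_add[OF p])
      show "Lp_norm (measure_pmf Q) p (\<lambda>x. - \<phi> l x) < \<infinity>"
        using fl by (subst Lp_norm_cong[of _ _ "\<phi> l"]) simp_all
    qed (use Suc.prems(1) in simp_all)
    then have "Lp_norm (measure_pmf Q) p (\<lambda>x. \<Sum>j<l. \<phi> j x) < \<infinity>"
      by simp
    with Suc False show ?thesis by simp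
  qed
qed simp

lemma Lp_finite_of_\<psi>:
  assumes p: "1 \<le> p" and fin: "Lp_norm (measure_pmf Q) p (\<lambda>x. \<Sum>j<m. e j *\<^sub>R \<psi> j x) < \<infinity>" and j: "j < m"
    and e: "e j \<in> {-1, 1 :: real}"
  shows "Lp_finite p j"
proof -
  obtain t0 where t0: "t0 \<in> set_pmf (\<nu> j)"
    using set_pmf_not_empty[of "\<nu> j"] by blast
  then obtain a where a: "a \<in> set_pmf q" "\<tau> j a = Some t0"
    using \<tau>_surj[OF j] by blast
  obtain f where f: "f \<in> set_pmf (rest j)"
    using set_pmf_not_empty[of "rest j"] by blast
  define S where "S x = (\<Sum>i<m. e i *\<^sub>R \<psi> i x)" for x
  define r where "r = (\<Sum>i\<in>{..<m} - {j}. e i *\<^sub>R \<psi> i (a, f))"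
  have S: "S (a, f(j := y)) = e j *\<^sub>R g j y + r" for y
  proof -
    have "S (a, f(j := y)) = e j *\<^sub>R \<psi> j (a, f(j := y)) + (\<Sum>i\<in>{..<m} - {j}. e i *\<^sub>R \<psi> i (a, f(j := y)))"
      unfolding S_def using j by (intro sum.remove) auto
    also have "(\<Sum>i\<in>{..<m} - {j}. e i *\<^sub>R \<psi> i (a, f(j := y))) = r"
      unfolding r_def by (intro sum.cong refl) (auto simp: \<psi>_def split: option.splits)
    also have "\<psi> j (a, f(j := y)) = g j y"
      using a by (simp add: \<psi>_def)
    finally show ?thesis .
  qed
  let ?I = "\<integral>\<^sup>+y. ennreal (norm (e j *\<^sub>R g j y + r) powr p) \<partial>measure_pmf (\<nu> j)"
  have "ennreal (pmf q a) * (ennreal (pmf (rest j) f) * ?I) =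
      ennreal (pmf q a) * (\<integral>\<^sup>+y. ennreal (pmf (rest j) f) * ennreal (norm (S (a, f(j := y))) powr p) \<partial>measure_pmf (\<nu> j))"
    by (simp add: nn_integral_cmult S)
  also have "\<dots> \<le> ennreal (pmf q a) * (\<integral>\<^sup>+y. \<integral>\<^sup>+f. ennreal (norm (S (a, f(j := y))) powr p) \<partial>measure_pmf (rest j) \<partial>measure_pmf (\<nu> j))"
    by (intro mult_left_mono nn_integral_mono pmf_mult_le_nn_integral) simp
  also have "\<dots> \<le> (\<integral>\<^sup>+x. ennreal (norm (S x) powr p) \<partial>measure_pmf Q)"
    unfolding nn_integral_Q[OF j] by (rule pmf_mult_le_nn_integral)
  also have "\<dots> < \<infinity>"
    using fin unfolding S_def by (simp only: Lp_norm_less_top_iff)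
  finally have "?I < \<infinity>"
    using pmf_positive[OF a(1)] pmf_positive[OF f] by (auto simp: ennreal_mult_less_top)
  then have I: "Lp_norm (measure_pmf (\<nu> j)) p (\<lambda>y. e j *\<^sub>R g j y + r) < \<infinity>"
    by (simp only: Lp_norm_less_top_iff)
  have "Lp_norm (measure_pmf (\<nu> j)) p (\<lambda>y. - r) < \<infinity>"
    by (simp add: Lp_norm_def ennreal_powr_ennreal)
  then have "Lp_norm (measure_pmf (\<nu> j)) p (\<lambda>y. (e j *\<^sub>R g j y + r) + - r) < \<infinity>"
    by (intro Lp_norm_finite_add[OF p] I) simp_all
  also have "Lp_norm (measure_pmf (\<nu> j)) p (\<lambda>y. (e j *\<^sub>R g j y + r) + - r) = Lp_norm (measure_pmf (\<nu> j)) p (g j)"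
    using e by (intro Lp_norm_cong) auto
  finally show ?thesis
    by (simp only: Lp_norm_less_top_iff Lp_finite_def)
qed

text \<open>The case distinction on infinite norms matters because \<open>0 * \<infinity> = 0\<close>: if the UMD constant
  vanishes then so does the space.\<close>

lemma discrete_decoupling_inequality:
  assumes U: "UMD TYPE('e) p" and p: "1 \<le> p" and e: "\<forall>j<m. e j \<in> {-1, 1 :: real}"
  shows "Lp_norm (measure_pmf Q) p (\<lambda>x. \<Sum>j<m. e j *\<^sub>R \<psi> j x) \<le>
      ennreal (UMD_const TYPE('e) p) * Lp_norm (measure_pmf Q) p (\<lambda>x. \<Sum>j<m. \<phi> j x)" (is "?V \<le> ?b * ?U")
    and "Lp_norm (measure_pmf Q) p (\<lambda>x. \<Sum>j<m. \<phi> j x) \<le>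
      ennreal (UMD_const TYPE('e) p) * Lp_norm (measure_pmf Q) p (\<lambda>x. \<Sum>j<m. e j *\<^sub>R \<psi> j x)"
proof -
  have top: "c \<le> ?b * d" if "d = \<infinity>" "c = Lp_norm (measure_pmf Q) p h" for c d and h :: "_ \<Rightarrow> 'e"
  proof (cases "\<exists>v :: 'e. v \<noteq> 0")
    case True
    then have "1 \<le> UMD_const TYPE('e) p"
      using UMD_const_ge_1[OF U p] by blast
    then show ?thesis
      using that by (simp add: ennreal_mult_top)
  next
    case False
    then have "h = (\<lambda>x. 0)" by auto
    with that show ?thesis by simp
  qed
  show "?V \<le> ?b * ?U"
  proof (cases "?U < \<infinity>")
    case True
    then have "\<forall>j<m. Lp_finite p j"
      using Lp_finite_of_\<phi>[OF p _ order_refl] by blast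
    then show ?thesis
      using decoupling_UMD(1)[OF _ p _ e] by (intro UMD_const_le[OF U True])
  next
    case False
    then show ?thesis by (intro top) (simp_all add: less_top[symmetric])
  qed
  show "?U \<le> ?b * ?V"
  proof (cases "?V < \<infinity>")
    case True
    then have "\<forall>j<m. Lp_finite p j"
      using Lp_finite_of_\<psi>[OF p] e by blast
    then show ?thesis
      using decoupling_UMD(2)[OF _ p _ e] by (intro UMD_const_le[OF U True])
  next
    case False
    then show ?thesis by (intro top) (simp_all add: less_top[symmetric])
  qed
qed

end

section \<open>The law of a countably valued function on a set of finite measure\<close>

lemma countably_valued_cong:
  assumes "\<And>x. x \<in> space M \<Longrightarrow> u x = v x"
  shows "countably_valued M u \<longleftrightarrow> countably_valued M v"
  using assms by (simp add: countably_valued_def cong: measurable_cong image_cong)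

lemma countably_valued_measurable_compose:
  assumes "countably_valued N u" "h \<in> measurable M N"
  shows "countably_valued M (\<lambda>x. u (h x))"
proof -
  have "(\<lambda>x. u (h x)) ` space M \<subseteq> u ` space N"
    using assms(2) by (auto dest: measurable_space)
  then show ?thesis
    using assms by (auto simp: countably_valued_def intro: measurable_compose countable_subset)
qed

lemma countably_valued_fibersI:
  assumes "countable T" "\<And>x. x \<in> space M \<Longrightarrow> u x \<in> T" "\<And>t. t \<in> T \<Longrightarrow> u -` {t} \<inter> space M \<in> sets M"
  shows "countably_valued M u"
  unfolding countably_valued_def
proof
  have "u \<in> measurable M (count_space T)"
    using assms by (subst measurable_count_space_eq_countable) auto
  then show "u \<in> measurable M (count_space UNIV)"
    by (rule measurable_compose) simp
  show "countable (u ` space M)"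
    using assms by (auto intro: countable_subset)
qed

text \<open>\<open>None\<close> absorbs the complement of \<open>X\<close>, whose measure may be
  infinite but where the integrand is zero.\<close>

lemma nn_integral_fibers_on:
  assumes X: "X \<in> sets M" and u: "countably_valued M u"
  shows "(\<integral>\<^sup>+x. h (u x) * indicator X x \<partial>M) = (\<integral>\<^sup>+t. h t * emeasure M (X \<inter> u -` {t}) \<partial>count_space UNIV)"
proof -
  define \<tau> where "\<tau> x = (if x \<in> X then Some (u x) else None)" for x
  define h' where "h' z = (case z of None \<Rightarrow> 0 | Some t \<Rightarrow> h t)" for z
  have cX: "countably_valued M (\<lambda>x. x \<in> X)"
    using X by (simp add: countably_valued_def countable_finite)
  have cv: "countably_valued M \<tau>"
    unfolding \<tau>_def using countably_valued_compose2[OF cX u, of "\<lambda>b t. if b then Some t else None"] .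
  let ?T = "insert None (Some ` (u ` X))"
  have XM: "X \<subseteq> space M" by (rule sets.sets_into_space[OF X])
  have T: "countable ?T" "\<tau> ` space M \<subseteq> ?T"
    using u countable_subset[OF image_mono[OF XM]] by (auto simp: countably_valued_def \<tau>_def)
  have "(\<integral>\<^sup>+x. h (u x) * indicator X x \<partial>M) = (\<integral>\<^sup>+x. h' (\<tau> x) \<partial>M)"
    by (intro nn_integral_cong) (simp add: h'_def \<tau>_def)
  also have "\<dots> = (\<integral>\<^sup>+z. h' z * emeasure M (\<tau> -` {z} \<inter> space M) \<partial>count_space ?T)"
    by (rule nn_integral_fibers[OF cv T])
  also have "\<dots> = (\<integral>\<^sup>+z. h' z * emeasure M (\<tau> -` {z} \<inter> space M) \<partial>count_space (range Some))"
  proof (rule nn_integral_count_space_eq)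
    fix z assume z: "z \<in> range Some - ?T"
    then have "\<tau> -` {z} \<inter> space M = {}" by (auto simp: \<tau>_def split: if_splits)
    then show "h' z * emeasure M (\<tau> -` {z} \<inter> space M) = 0" by simp
  qed (auto simp: h'_def)
  also have "\<dots> = (\<integral>\<^sup>+t. h' (Some t) * emeasure M (\<tau> -` {Some t} \<inter> space M) \<partial>count_space UNIV)"
    by (rule nn_integral_bij_count_space[symmetric]) (simp add: bij_betw_def)
  also have "\<dots> = (\<integral>\<^sup>+t. h t * emeasure M (X \<inter> u -` {t}) \<partial>count_space UNIV)"
  proof (intro nn_integral_cong)
    fix t
    have "\<tau> -` {Some t} \<inter> space M = X \<inter> u -` {t}"
      using XM by (auto simp: \<tau>_def split: if_splits)
    then show "h' (Some t) * emeasure M (\<tau> -` {Some t} \<inter> space M) = h t * emeasure M (X \<inter> u -` {t})"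
      by (simp add: h'_def)
  qed
  finally show ?thesis .
qed

text \<open>The distribution of \<open>u\<close> under the normalised restriction of
  \<open>M\<close> to \<open>X\<close>, for countably valued \<open>u\<close> and \<open>X\<close>
  of finite positive measure.\<close>

definition law :: "'a measure \<Rightarrow> 'a set \<Rightarrow> ('a \<Rightarrow> 'c) \<Rightarrow> 'c pmf" where
  "law M X u = embed_pmf (\<lambda>t. measure M (X \<inter> u -` {t}) / measure M X)"

context
  fixes M :: "'a measure" and X :: "'a set" and u :: "'a \<Rightarrow> 'c"
  assumes X: "X \<in> sets M" "0 < emeasure M X" "emeasure M X < \<infinity>" and u: "countably_valued M u"
begin

lemma measure_law_pos: "0 < measure M X"
  using X by (simp add: measure_def enn2real_positive_iff)

lemma emeasure_law_set: "emeasure M X = ennreal (measure M X)"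
  using X by (intro emeasure_eq_ennreal_measure) simp

lemma emeasure_law_fiber: "emeasure M (X \<inter> u -` {t}) = ennreal (measure M (X \<inter> u -` {t}))"
proof (rule emeasure_eq_ennreal_measure)
  have "emeasure M (X \<inter> u -` {t}) \<le> emeasure M X"
    using X by (intro emeasure_mono) auto
  with X show "emeasure M (X \<inter> u -` {t}) \<noteq> top" by (auto simp: top_unique)
qed

lemma ennreal_law: "ennreal (measure M (X \<inter> u -` {t}) / measure M X) = ennreal (1 / measure M X) * emeasure M (X \<inter> u -` {t})"
  unfolding emeasure_law_fiber by (simp flip: ennreal_mult)

lemma pmf_law: "pmf (law M X u) t = measure M (X \<inter> u -` {t}) / measure M X"
  unfolding law_def
proof (rule pmf_embed_pmf)
  have "(\<integral>\<^sup>+t. ennreal (1 / measure M X) * emeasure M (X \<inter> u -` {t}) \<partial>count_space UNIV)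
      = (\<integral>\<^sup>+x. ennreal (1 / measure M X) * indicator X x \<partial>M)"
    using nn_integral_fibers_on[OF X(1) u, of "\<lambda>_. ennreal (1 / measure M X)"] by simp
  also have "\<dots> = 1"
    using measure_law_pos X
    by (simp add: nn_integral_cmult_indicator emeasure_law_set ennreal_mult[symmetric] flip: ennreal_1)
  finally show "(\<integral>\<^sup>+t. ennreal (measure M (X \<inter> u -` {t}) / measure M X) \<partial>count_space UNIV) = 1"
    unfolding ennreal_law .
qed simp

lemma nn_integral_law:
  "(\<integral>\<^sup>+t. h t \<partial>measure_pmf (law M X u)) = ennreal (1 / measure M X) * (\<integral>\<^sup>+x. h (u x) * indicator X x \<partial>M)"
proof -
  have "(\<integral>\<^sup>+t. h t \<partial>measure_pmf (law M X u)) = (\<integral>\<^sup>+t. ennreal (1 / measure M X) * (h t * emeasure M (X \<inter> u -` {t})) \<partial>count_space UNIV)"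
    by (simp add: nn_integral_measure_pmf pmf_law ennreal_law ac_simps)
  also have "\<dots> = ennreal (1 / measure M X) * (\<integral>\<^sup>+x. h (u x) * indicator X x \<partial>M)"
    unfolding nn_integral_fibers_on[OF X(1) u] by (rule nn_integral_cmult) simp
  finally show ?thesis .
qed

lemma set_lawD: "t \<in> set_pmf (law M X u) \<Longrightarrow> \<exists>x\<in>X. u x = t"
proof (rule ccontr)
  assume t: "t \<in> set_pmf (law M X u)" "\<not> (\<exists>x\<in>X. u x = t)"
  then have "X \<inter> u -` {t} = {}" by auto
  then have "pmf (law M X u) t = 0" by (simp add: pmf_law)
  with t(1) show False by (simp add: set_pmf_iff)
qed

end

text \<open>A single simple approximant at distance less than \<open>1\<close> bounds the integral
  of the norm. It extracts integrability from the zero mean hypothesis.\<close>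

lemma has_strong_integral_norm_finite:
  assumes "has_strong_integral M f v"
  shows "(\<integral>\<^sup>+x. ennreal (norm (f x)) \<partial>M) < \<infinity>"
proof -
  obtain s where f: "strongly_measurable M f"
    and s: "\<And>i. Bochner_Integration.simple_bochner_integrable M (s i)"
      "(\<lambda>i. \<integral>\<^sup>+x. ennreal (norm (f x - s i x)) \<partial>M) \<longlonglongrightarrow> 0"
    using assms unfolding has_strong_integral_def by blast
  have "eventually (\<lambda>i. (\<integral>\<^sup>+x. ennreal (norm (f x - s i x)) \<partial>M) < 1) sequentially"
    by (rule order_tendstoD(2)[OF s(2)]) simp
  then obtain i where i: "(\<integral>\<^sup>+x. ennreal (norm (f x - s i x)) \<partial>M) < 1"
    by (auto simp: eventually_sequentially)
  have sm: "strongly_measurable M (s i)"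
    unfolding strongly_measurable_def using s(1)[of i]
    by (intro exI[of _ "\<lambda>_. s i"]) (auto elim: Bochner_Integration.simple_bochner_integrable.cases)
  have [measurable]: "(\<lambda>x. norm (f x - s i x)) \<in> borel_measurable M" "(\<lambda>x. norm (s i x)) \<in> borel_measurable M"
    by (intro strongly_measurable_norm strongly_measurable_diff f sm)+
  have "Bochner_Integration.simple_bochner_integrable M (\<lambda>x. norm (s i x))"
    using simple_bochner_integrable_compose2[of "\<lambda>a b. norm a", OF _ s(1) s(1)] by simp
  then have "(\<integral>\<^sup>+x. ennreal (norm (s i x)) \<partial>M) = ennreal (Bochner_Integration.simple_bochner_integral M (\<lambda>x. norm (s i x)))"
    by (intro simple_bochner_integral_eq_nn_integral[symmetric]) auto
  then have fin: "(\<integral>\<^sup>+x. ennreal (norm (s i x)) \<partial>M) < \<infinity>" by simp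
  have "(\<integral>\<^sup>+x. ennreal (norm (f x)) \<partial>M) \<le> (\<integral>\<^sup>+x. ennreal (norm (f x - s i x)) + ennreal (norm (s i x)) \<partial>M)"
    using norm_triangle_ineq[of "f x - s i x" "s i x" for x]
    by (intro nn_integral_mono) (simp flip: ennreal_plus add: ennreal_leI)
  also have "\<dots> = (\<integral>\<^sup>+x. ennreal (norm (f x - s i x)) \<partial>M) + (\<integral>\<^sup>+x. ennreal (norm (s i x)) \<partial>M)"
    by (rule nn_integral_add) auto
  also have "\<dots> < \<infinity>"
    using fin less_trans[OF i ennreal_one_less_top] by simp
  finally show ?thesis .
qed

section \<open>Refining partitions\<close>

locale cell_partitions =
  fixes M :: "'x measure" and A :: "int \<Rightarrow> 'x set set"
  assumes countable_A: "\<And>n. countable (A n)"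
    and refines_A: "\<And>n. refines (space M) (A (n + 1)) (A n)"
    and A_cell: "\<And>n K. K \<in> A n \<Longrightarrow> K \<in> sets M \<and> 0 < emeasure M K \<and> emeasure M K < \<infinity>"
begin

lemma A_partition: "partition_on (space M) (A n)"
  using refines_A[of n] by (simp add: refines_def)

lemma A_disjoint: "K \<in> A n \<Longrightarrow> L \<in> A n \<Longrightarrow> x \<in> K \<Longrightarrow> x \<in> L \<Longrightarrow> K = L"
  using partition_onD2[OF A_partition[of n]] by (auto simp: disjoint_def)

lemma A_covers: "x \<in> space M \<Longrightarrow> \<exists>K\<in>A n. x \<in> K"
  using partition_onD1[OF A_partition[of n]] by blast

lemma A_subset: "K \<in> A n \<Longrightarrow> K \<subseteq> space M"
  using A_cell sets.sets_into_space by blast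

lemma A_coarser:
  assumes "n \<le> l" "K \<in> A l"
  shows "\<exists>L\<in>A n. K \<subseteq> L"
  using assms
proof (induction l arbitrary: K rule: int_ge_induct)
  case (step l)
  then obtain K' where K': "K' \<in> A l" "K \<subseteq> K'"
    using refines_A[of l] unfolding refines_def by metis
  from step.IH[OF K'(1)] K'(2) show ?case by (meson order_trans)
qed auto

definition cell :: "int \<Rightarrow> 'x \<Rightarrow> 'x set" where
  "cell n x = (THE K. K \<in> A n \<and> x \<in> K)"

lemma cell_eqI: "K \<in> A n \<Longrightarrow> x \<in> K \<Longrightarrow> cell n x = K"
  unfolding cell_def by (rule the_equality) (blast, metis A_disjoint)

lemma cell_in: "x \<in> space M \<Longrightarrow> cell n x \<in> A n" "x \<in> space M \<Longrightarrow> x \<in> cell n x"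
  using A_covers[of x n] by (auto simp: cell_eqI)

lemma cell_eq_iff: "K \<in> A n \<Longrightarrow> x \<in> space M \<Longrightarrow> cell n x = K \<longleftrightarrow> x \<in> K"
  using cell_in cell_eqI by blast

lemma cell_coarser:
  assumes "n \<le> l" "K \<in> A l" "x \<in> K" "y \<in> K"
  shows "cell n x = cell n y"
  using A_coarser[OF assms(1,2)] assms(3,4) cell_eqI by blast

lemma countably_valued_cell: "countably_valued M (cell n)"
proof (rule countably_valued_fibersI[OF countable_A[of n]])
  fix K assume K: "K \<in> A n"
  then have "cell n -` {K} \<inter> space M = K"
    using cell_eq_iff[OF K] A_subset[OF K] by auto
  with A_cell[OF K] show "cell n -` {K} \<inter> space M \<in> sets M" by simp
qed (rule cell_in)

lemma child_iff: "t \<in> child A k \<longleftrightarrow> t \<in> A (fst k + 1) \<and> t \<subseteq> snd k"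
  by (simp add: child_def)

lemma cells_iff: "k \<in> cells A \<longleftrightarrow> snd k \<in> A (fst k)"
  by (cases k) (simp add: cells_def)

lemma cell_child:
  assumes "k \<in> cells A" "x \<in> snd k"
  shows "cell (fst k + 1) x \<in> child A k"
proof -
  have K: "snd k \<in> A (fst k)" using assms by (simp add: cells_iff)
  have x: "x \<in> space M" using A_subset[OF K] assms by blast
  obtain L where L: "L \<in> A (fst k)" "cell (fst k + 1) x \<subseteq> L"
    using A_coarser[OF _ cell_in(1)[OF x], of "fst k" "fst k + 1"] by auto
  then have "L = snd k"
    using A_disjoint[OF L(1) K _ assms(2)] cell_in(2)[OF x] by blast
  with L cell_in[OF x] show ?thesis by (simp add: child_iff)
qed

lemma child_fiber:
  assumes "k \<in> cells A" "t \<in> child A k"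
  shows "snd k \<inter> cell (fst k + 1) -` {t} = t"
proof -
  have t: "t \<in> A (fst k + 1)" "t \<subseteq> snd k" using assms(2) by (simp_all add: child_iff)
  have "snd k \<subseteq> space M" using assms(1) by (intro A_subset[of _ "fst k"]) (simp add: cells_iff)
  then have "x \<in> snd k \<Longrightarrow> cell (fst k + 1) x = t \<longleftrightarrow> x \<in> t" for x
    by (intro cell_eq_iff t) auto
  with t(2) show ?thesis by auto
qed

lemma countable_child: "countable (child A k)"
  by (rule countable_subset[OF _ countable_A[of "fst k + 1"]]) (auto simp: child_iff)

lemma space_cell_space: "space (cell_space M A k) = snd k"
  unfolding cell_space_def by (rule space_measure_of) (auto simp: child_iff)

lemma sets_cell_space: "sets (cell_space M A k) = sigma_sets (snd k) ({snd k} \<union> child A k)"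
  unfolding cell_space_def by (rule sets_measure_of) (auto simp: child_iff)

text \<open>The set function given to \<open>measure_of\<close> takes effect only if it is countably
  additive on the generated sigma-algebra; this is inherited from \<open>M\<close>, in which all
  generated sets are measurable.\<close>

lemma emeasure_cell_space:
  assumes k: "k \<in> cells A" and B: "B \<in> sets (cell_space M A k)"
  shows "emeasure (cell_space M A k) B = emeasure M B / emeasure M (snd k)"
proof -
  have K: "snd k \<in> sets M" using k A_cell by (auto simp: cells_iff)
  have sub: "sets (cell_space M A k) \<subseteq> sets M"
    unfolding sets_cell_space
  proof (rule subsetI)
    fix B assume "B \<in> sigma_sets (snd k) ({snd k} \<union> child A k)"
    then show "B \<in> sets M"
      by induction (use K A_cell in \<open>auto simp: child_iff\<close>)
  qed
  show ?thesis
  proof (rule emeasure_measure_of[OF cell_space_def])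
    show "{snd k} \<union> child A k \<subseteq> Pow (snd k)" by (auto simp: child_iff)
    show "positive (sets (cell_space M A k)) (\<lambda>B. emeasure M B / emeasure M (snd k))"
      by (simp add: positive_def)
    show "countably_additive (sets (cell_space M A k)) (\<lambda>B. emeasure M B / emeasure M (snd k))"
    proof (rule countably_additiveI)
      fix D :: "nat \<Rightarrow> 'x set"
      assume "range D \<subseteq> sets (cell_space M A k)" "disjoint_family D"
      with sub have "(\<Sum>i. emeasure M (D i)) = emeasure M (\<Union>i. D i)"
        by (intro suminf_emeasure) auto
      then show "(\<Sum>i. emeasure M (D i) / emeasure M (snd k)) = emeasure M (\<Union>i. D i) / emeasure M (snd k)"
        by (simp add: divide_ennreal_def)
    qed
  qed (rule B)
qed

lemma prob_space_cell_space:
  assumes "k \<in> cells A"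
  shows "prob_space (cell_space M A k)"
proof
  have "snd k \<in> sets (cell_space M A k)"
    unfolding sets_cell_space by (rule sigma_sets_top)
  then show "emeasure (cell_space M A k) (space (cell_space M A k)) = 1"
    using A_cell[of "snd k" "fst k"] assms
    by (simp add: space_cell_space emeasure_cell_space cells_iff) (intro ennreal_divide_self, auto)
qed

lemma child_in_cell_space: "t \<in> child A k \<Longrightarrow> t \<in> sets (cell_space M A k)"
  by (simp add: sets_cell_space)

lemma countably_valued_cell_space:
  assumes "k \<in> cells A"
  shows "countably_valued (cell_space M A k) (cell (fst k + 1))"
proof (rule countably_valued_fibersI[OF countable_child])
  fix t assume t: "t \<in> child A k"
  have "cell (fst k + 1) -` {t} \<inter> space (cell_space M A k) = t"
    using child_fiber[OF assms t] by (auto simp: space_cell_space)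
  with t show "cell (fst k + 1) -` {t} \<inter> space (cell_space M A k) \<in> sets (cell_space M A k)"
    by (simp add: child_in_cell_space)
qed (use cell_child[OF assms] in \<open>simp add: space_cell_space\<close>)

lemma law_child:
  assumes k: "k \<in> cells A" and t: "t \<in> child A k"
  shows "ennreal (pmf (law M (snd k) (cell (fst k + 1))) t) = emeasure (cell_space M A k) t"
    and "t \<in> set_pmf (law M (snd k) (cell (fst k + 1)))"
proof -
  have K: "snd k \<in> sets M" "0 < emeasure M (snd k)" "emeasure M (snd k) < \<infinity>"
    using k A_cell by (auto simp: cells_iff)
  have t': "0 < emeasure M t" "emeasure M t < \<infinity>"
    using t A_cell by (auto simp: child_iff)
  have pmf: "pmf (law M (snd k) (cell (fst k + 1))) t = measure M t / measure M (snd k)"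
    unfolding pmf_law[OF K countably_valued_cell] child_fiber[OF k t] ..
  have pos: "0 < measure M t" "0 < measure M (snd k)"
    using K t' by (simp_all add: measure_def enn2real_positive_iff)
  show "ennreal (pmf (law M (snd k) (cell (fst k + 1))) t) = emeasure (cell_space M A k) t"
    unfolding pmf emeasure_cell_space[OF k child_in_cell_space[OF t]]
    using K t' pos by (simp add: emeasure_eq_ennreal_measure divide_ennreal)
  show "t \<in> set_pmf (law M (snd k) (cell (fst k + 1)))"
    unfolding set_pmf_iff pmf using pos by simp
qed

end

section \<open>Decoupling over finitely many cells\<close>

locale cell_functions = cell_partitions M A for M :: "'x measure" and A +
  fixes f :: "int \<times> 'x set \<Rightarrow> 'x \<Rightarrow> 'e::banach"
  assumes f_off: "\<And>k x. k \<in> cells A \<Longrightarrow> x \<in> space M - snd k \<Longrightarrow> f k x = 0"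
    and f_const: "\<And>k K'. k \<in> cells A \<Longrightarrow> K' \<in> child A k \<Longrightarrow> f k constant_on K'"
    and f_mean: "\<And>k. k \<in> cells A \<Longrightarrow> has_strong_integral M (\<lambda>x. indicator (snd k) x *\<^sub>R f k x) 0"
begin

text \<open>Turns \<open>f k\<close> into a function of the child; on a child of \<open>k\<close>
  the choice of the point is immaterial because \<open>f k\<close> is constant there.\<close>

definition val :: "int \<times> 'x set \<Rightarrow> 'x set \<Rightarrow> 'e" where
  "val k t = f k (SOME x. x \<in> t)"

lemma val_cell:
  assumes "k \<in> cells A" "x \<in> snd k"
  shows "val k (cell (fst k + 1) x) = f k x"
proof -
  have "x \<in> space M" using assms A_subset by (auto simp: cells_iff)
  then have x: "x \<in> cell (fst k + 1) x" by (rule cell_in)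
  then have "(SOME y. y \<in> cell (fst k + 1) x) \<in> cell (fst k + 1) x" by (rule someI)
  with x f_const[OF assms(1) cell_child[OF assms]] show ?thesis
    unfolding val_def constant_on_def by metis
qed

lemma cells_sets:
  assumes "k \<in> cells A"
  shows "snd k \<in> sets M" "0 < emeasure M (snd k)" "emeasure M (snd k) < \<infinity>" "snd k \<subseteq> space M"
  using assms A_cell A_subset by (auto simp: cells_iff)

lemma f_eq_val:
  assumes "k \<in> cells A" "x \<in> space M"
  shows "f k x = (if x \<in> snd k then val k (cell (fst k + 1) x) else 0)"
  using assms val_cell f_off by auto

lemma countably_valued_mem: "X \<in> sets M \<Longrightarrow> countably_valued M (\<lambda>x. x \<in> X)"
  by (simp add: countably_valued_def countable_finite)

lemma countably_valued_f:
  assumes "k \<in> cells A"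
  shows "countably_valued M (f k)"
proof -
  have "countably_valued M (\<lambda>x. if x \<in> snd k then val k (cell (fst k + 1) x) else 0)"
    by (rule countably_valued_compose2[OF countably_valued_mem countably_valued_cell,
        of "snd k" "\<lambda>b t. if b then val k t else 0"]) (rule cells_sets[OF assms])
  then show ?thesis
    using f_eq_val[OF assms] by (subst countably_valued_cong) auto
qed

abbreviation Y :: "(int \<times> 'x set \<Rightarrow> 'x) measure" where
  "Y \<equiv> \<Pi>\<^sub>M k\<in>cells A. cell_space M A k"

lemma prob_space_Y: "prob_space Y"
  by (rule prob_space_PiM) (rule prob_space_cell_space)

lemma countably_valued_Y:
  assumes "k \<in> cells A"
  shows "countably_valued Y (\<lambda>y. cell (fst k + 1) (y k))"
  by (rule countably_valued_measurable_compose[OF countably_valued_cell_space[OF assms]])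
    (rule measurable_component_singleton[OF assms])

lemma Y_in: "y \<in> space Y \<Longrightarrow> k \<in> cells A \<Longrightarrow> y k \<in> snd k"
  by (auto simp: space_PiM PiE_iff space_cell_space)

text \<open>\<open>f k (y k)\<close> depends on \<open>y\<close> only through the child containing
  \<open>y k\<close>, which is all that the coarse sigma-algebra of \<open>cell_space\<close> can
  see.\<close>

lemma countably_valued_decoupled:
  assumes k: "k \<in> cells A"
  shows "countably_valued (M \<Otimes>\<^sub>M Y) (\<lambda>(x, y). (c * indicator (snd k) x) *\<^sub>R f k (y k))"
proof -
  have 1: "countably_valued (M \<Otimes>\<^sub>M Y) (\<lambda>z. fst z \<in> snd k)"
    by (rule countably_valued_measurable_compose[OF countably_valued_mem measurable_fst]) (rule cells_sets[OF k])
  have 2: "countably_valued (M \<Otimes>\<^sub>M Y) (\<lambda>z. cell (fst k + 1) (snd z k))"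
    by (rule countably_valued_measurable_compose[OF countably_valued_Y[OF k] measurable_snd])
  have "countably_valued (M \<Otimes>\<^sub>M Y) (\<lambda>z. (c * of_bool (fst z \<in> snd k)) *\<^sub>R val k (cell (fst k + 1) (snd z k)))"
    by (rule countably_valued_compose2[OF 1 2, of "\<lambda>b t. (c * of_bool b) *\<^sub>R val k t"])
  then show ?thesis
    using Y_in[OF _ k] val_cell[OF k]
    by (subst countably_valued_cong) (auto simp: space_pair_measure split: split_indicator)
qed

end

text \<open>Evaluated over the fibres of \<open>u\<close>, the vanishing integral is
  \<open>measure M X\<close> times the discrete mean, and this positive factor can be
  cancelled.\<close>

lemma infsum_law_zero:
  fixes G :: "'c \<Rightarrow> 'e::banach"
  assumes X: "X \<in> sets M" "0 < emeasure M X" "emeasure M X < \<infinity>" and u: "countably_valued M u"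
    and zero: "has_strong_integral M (\<lambda>x. indicator X x *\<^sub>R G (u x)) 0"
  shows "(\<Sum>\<^sub>\<infinity>t\<in>set_pmf (law M X u). pmf (law M X u) t *\<^sub>R G t) = 0"
proof -
  define \<tau> where "\<tau> x = (if x \<in> X then Some (u x) else None)" for x
  define G' where "G' z = (case z of None \<Rightarrow> 0 | Some t \<Rightarrow> G t)" for z
  have cX: "countably_valued M (\<lambda>x. x \<in> X)"
    using X by (simp add: countably_valued_def countable_finite)
  have cv: "countably_valued M \<tau>"
    unfolding \<tau>_def using countably_valued_compose2[OF cX u, of "\<lambda>b t. if b then Some t else None"] .
  have XM: "X \<subseteq> space M" by (rule sets.sets_into_space[OF X(1)])
  let ?T = "u ` space M"
  have T: "countable (insert None (Some ` ?T))" "\<tau> ` space M \<subseteq> insert None (Some ` ?T)"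
    using u by (auto simp: countably_valued_def \<tau>_def)
  have G': "(\<lambda>x. G' (\<tau> x)) = (\<lambda>x. indicator X x *\<^sub>R G (u x))"
    by (auto simp: G'_def \<tau>_def)
  have "(\<integral>\<^sup>+x. ennreal (norm (G' (\<tau> x))) \<partial>M) < \<infinity>"
    using has_strong_integral_norm_finite[OF zero] by (simp only: G'[THEN fun_cong])
  from has_strong_integral_fibers[OF cv T this]
  have "(\<Sum>\<^sub>\<infinity>z\<in>insert None (Some ` ?T). measure M (\<tau> -` {z} \<inter> space M) *\<^sub>R G' z) = 0"
    unfolding G' by (rule has_strong_integral_unique[OF _ zero])
  also have "(\<Sum>\<^sub>\<infinity>z\<in>insert None (Some ` ?T). measure M (\<tau> -` {z} \<inter> space M) *\<^sub>R G' z) =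
      (\<Sum>\<^sub>\<infinity>z\<in>Some ` ?T. measure M (\<tau> -` {z} \<inter> space M) *\<^sub>R G' z)"
    by (intro infsum_cong_neutral) (auto simp: G'_def)
  also have "\<dots> = (\<Sum>\<^sub>\<infinity>t\<in>?T. measure M (\<tau> -` {Some t} \<inter> space M) *\<^sub>R G t)"
    by (subst infsum_reindex) (auto simp: G'_def o_def)
  also have "\<dots> = (\<Sum>\<^sub>\<infinity>t\<in>set_pmf (law M X u). measure M X *\<^sub>R (pmf (law M X u) t *\<^sub>R G t))"
  proof (rule infsum_cong_neutral)
    have fib: "\<tau> -` {Some t} \<inter> space M = X \<inter> u -` {t}" for t
      using XM by (auto simp: \<tau>_def split: if_splits)
    have *: "measure M (\<tau> -` {Some t} \<inter> space M) = measure M X * pmf (law M X u) t" for t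
      unfolding fib using measure_law_pos[OF X u] by (simp add: pmf_law[OF X u])
    then show "measure M (\<tau> -` {Some t} \<inter> space M) *\<^sub>R G t = measure M X *\<^sub>R (pmf (law M X u) t *\<^sub>R G t)" for t
      by simp
    fix t
    show "measure M X *\<^sub>R (pmf (law M X u) t *\<^sub>R G t) = 0" if "t \<in> set_pmf (law M X u) - ?T"
      using that set_lawD[OF X u, of t] XM by blast
    show "measure M (\<tau> -` {Some t} \<inter> space M) *\<^sub>R G t = 0" if "t \<in> ?T - set_pmf (law M X u)"
      using that by (simp add: * set_pmf_iff)
  qed
  also have "\<dots> = measure M X *\<^sub>R (\<Sum>\<^sub>\<infinity>t\<in>set_pmf (law M X u). pmf (law M X u) t *\<^sub>R G t)"
    by (rule infsum_scaleR_right)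
  finally show ?thesis
    using measure_law_pos[OF X u] by simp
qed

section \<open>The discrete model of a finite family of cells\<close>

locale finitely_many_cells = cell_functions M A f for M :: "'x measure" and A and f :: "int \<times> 'x set \<Rightarrow> 'x \<Rightarrow> 'e::banach" +
  fixes ks :: "(int \<times> 'x set) list"
  assumes ks: "distinct ks" "sorted (map fst ks)" "set ks \<subseteq> cells A" "ks \<noteq> []"
begin

definition m :: nat where "m = length ks"
definition lev :: "nat \<Rightarrow> int" where "lev j = fst (ks ! j)"
definition K :: "nat \<Rightarrow> 'x set" where "K j = snd (ks ! j)"
text \<open>One level finer than the finest listed cell, hence fine enough to determine every child
  that occurs. Level \<open>N\<close> cells are the atoms.\<close>

definition N :: int where "N = fst (last ks) + 1"
definition X0 :: "'x set" where "X0 = (\<Union>j<m. K j)"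

definition q :: "'x set pmf" where "q = law M X0 (cell N)"
definition \<nu> :: "nat \<Rightarrow> 'x set pmf" where "\<nu> j = law M (K j) (cell (lev j + 1))"
text \<open>An atom is inspected at an arbitrary point of it: membership in \<open>K j\<close> and
  the child of \<open>K j\<close> are constant on atoms.\<close>

definition \<tau> :: "nat \<Rightarrow> 'x set \<Rightarrow> 'x set option" where
  "\<tau> j a = (let x = (SOME x. x \<in> a) in if x \<in> K j then Some (cell (lev j + 1) x) else None)"
definition g :: "nat \<Rightarrow> 'x set \<Rightarrow> 'e" where "g j = val (ks ! j)"
definition \<kappa> :: "nat \<Rightarrow> real" where "\<kappa> j = measure M (K j) / measure M X0"

lemma ks_cells: "j < m \<Longrightarrow> ks ! j \<in> cells A"
  using ks(3) by (auto simp: m_def)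

lemma m_pos: "0 < m"
  using ks(4) by (simp add: m_def)

lemma lev_mono: "i \<le> j \<Longrightarrow> j < m \<Longrightarrow> lev i \<le> lev j"
  using sorted_nth_mono[OF ks(2), of i j] by (simp add: m_def lev_def)

lemma lev_less_N: "j < m \<Longrightarrow> lev j + 1 \<le> N"
  using lev_mono[of j "m - 1"] m_pos ks(4) by (simp add: N_def lev_def last_conv_nth m_def)

lemma K_A: "j < m \<Longrightarrow> K j \<in> A (lev j)"
  using ks_cells by (simp add: cells_iff K_def lev_def)

lemma K_sets: "j < m \<Longrightarrow> K j \<in> sets M" "j < m \<Longrightarrow> 0 < emeasure M (K j)" "j < m \<Longrightarrow> emeasure M (K j) < \<infinity>"
    "j < m \<Longrightarrow> K j \<subseteq> space M"
  using cells_sets[OF ks_cells] by (auto simp: K_def)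

lemma X0_sets: "X0 \<in> sets M" "0 < emeasure M X0" "emeasure M X0 < \<infinity>" "X0 \<subseteq> space M"
proof -
  show X0: "X0 \<in> sets M" unfolding X0_def using K_sets by auto
  then show "X0 \<subseteq> space M" by (rule sets.sets_into_space)
  have "emeasure M (K 0) \<le> emeasure M X0"
    using m_pos by (intro emeasure_mono X0) (auto simp: X0_def)
  with K_sets(2)[OF m_pos] show "0 < emeasure M X0" by (rule less_le_trans)
  have "emeasure M X0 \<le> (\<Sum>j<m. emeasure M (K j))"
    unfolding X0_def using K_sets by (intro emeasure_subadditive_finite) auto
  also have "\<dots> < \<infinity>"
    using K_sets(3) by simp
  finally show "emeasure M X0 < \<infinity>" .
qed

lemma \<tau>_cell:
  assumes j: "j < m" and x: "x \<in> space M"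
  shows "\<tau> j (cell N x) = (if x \<in> K j then Some (cell (lev j + 1) x) else None)"
proof -
  define y where "y = (SOME y. y \<in> cell N x)"
  have y: "y \<in> cell N x"
    unfolding y_def using cell_in(2)[OF x] by (rule someI)
  then have ym: "y \<in> space M" using A_subset[OF cell_in(1)[OF x]] by blast
  have eq: "cell n y = cell n x" if "n \<le> N" for n
    by (rule cell_coarser[OF that cell_in(1)[OF x] y cell_in(2)[OF x]])
  have "y \<in> K j \<longleftrightarrow> x \<in> K j"
    using cell_eq_iff[OF K_A[OF j] x] cell_eq_iff[OF K_A[OF j] ym] eq[of "lev j"] lev_less_N[OF j] by simp
  then show ?thesis
    using eq[OF lev_less_N[OF j]] by (simp add: \<tau>_def Let_def flip: y_def)
qed

lemma nn_integral_q:
  "(\<integral>\<^sup>+a. h a \<partial>measure_pmf q) = ennreal (1 / measure M X0) * (\<integral>\<^sup>+x. h (cell N x) * indicator X0 x \<partial>M)"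
  unfolding q_def by (rule nn_integral_law[OF X0_sets(1-3) countably_valued_cell])

lemma nn_integral_\<nu>:
  assumes "j < m"
  shows "(\<integral>\<^sup>+t. h t \<partial>measure_pmf (\<nu> j)) =
    ennreal (1 / measure M (K j)) * (\<integral>\<^sup>+x. h (cell (lev j + 1) x) * indicator (K j) x \<partial>M)"
  unfolding \<nu>_def by (rule nn_integral_law[OF K_sets(1-3)[OF assms] countably_valued_cell])

lemma measure_K_pos: "j < m \<Longrightarrow> 0 < measure M (K j)"
  by (rule measure_law_pos[OF K_sets(1-3) countably_valued_cell])

lemma measure_X0_pos: "0 < measure M X0"
  by (rule measure_law_pos[OF X0_sets(1-3) countably_valued_cell])

lemma q_support:
  assumes "a \<in> set_pmf q"
  obtains x where "x \<in> space M" "a = cell N x"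
  using set_lawD[OF X0_sets(1-3) countably_valued_cell assms[unfolded q_def]] X0_sets(4) that by blast

sublocale discrete_decoupling q \<nu> \<tau> g m \<kappa>
proof
  fix j assume j: "j < m"
  show "0 < \<kappa> j"
    using measure_K_pos[OF j] measure_X0_pos by (simp add: \<kappa>_def)
  show "(\<integral>\<^sup>+a. (case \<tau> j a of None \<Rightarrow> 0 | Some t \<Rightarrow> h t) \<partial>measure_pmf q) =
      ennreal (\<kappa> j) * (\<integral>\<^sup>+t. h t \<partial>measure_pmf (\<nu> j))" for h
  proof -
    have "(\<integral>\<^sup>+x. (case \<tau> j (cell N x) of None \<Rightarrow> 0 | Some t \<Rightarrow> h t) * indicator X0 x \<partial>M) =
        (\<integral>\<^sup>+x. h (cell (lev j + 1) x) * indicator (K j) x \<partial>M)"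
      using j by (intro nn_integral_cong) (auto simp: \<tau>_cell X0_def split: split_indicator)
    then have "(\<integral>\<^sup>+a. (case \<tau> j a of None \<Rightarrow> 0 | Some t \<Rightarrow> h t) \<partial>measure_pmf q) =
        ennreal (1 / measure M X0) * (\<integral>\<^sup>+x. h (cell (lev j + 1) x) * indicator (K j) x \<partial>M)"
      by (simp only: nn_integral_q)
    \<comment> \<open>\<open>\<kappa> j\<close> is the share of the cell in \<open>X0\<close>; it
      converts the normalisation on \<open>X0\<close> into the one on \<open>K j\<close>.\<close>
    also have "ennreal (1 / measure M X0) = ennreal (\<kappa> j) * ennreal (1 / measure M (K j))"
      using measure_K_pos[OF j] by (simp add: \<kappa>_def flip: ennreal_mult)
    finally show ?thesis
      by (simp add: nn_integral_\<nu>[OF j] mult.assoc)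
  qed
  have val: "indicator (snd (ks ! j)) x *\<^sub>R f (ks ! j) x = indicator (K j) x *\<^sub>R g j (cell (lev j + 1) x)" for x
    using val_cell[OF ks_cells[OF j], of x] by (auto simp: K_def g_def lev_def split: split_indicator)
  have mean: "has_strong_integral M (\<lambda>x. indicator (K j) x *\<^sub>R g j (cell (lev j + 1) x)) 0"
    using f_mean[OF ks_cells[OF j]] unfolding val .
  show "(\<Sum>\<^sub>\<infinity>t\<in>set_pmf (\<nu> j). pmf (\<nu> j) t *\<^sub>R g j t) = 0"
    unfolding \<nu>_def by (rule infsum_law_zero[OF K_sets(1-3)[OF j] countably_valued_cell mean])
  have "(\<integral>\<^sup>+x. ennreal (norm (g j (cell (lev j + 1) x))) * indicator (K j) x \<partial>M)
      = (\<integral>\<^sup>+x. ennreal (norm (indicator (K j) x *\<^sub>R g j (cell (lev j + 1) x))) \<partial>M)"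
    by (intro nn_integral_cong) (simp split: split_indicator)
  also have "\<dots> < \<infinity>" by (rule has_strong_integral_norm_finite[OF mean])
  finally show "(\<integral>\<^sup>+t. ennreal (norm (g j t)) \<partial>measure_pmf (\<nu> j)) < \<infinity>"
    unfolding nn_integral_\<nu>[OF j] infinity_ennreal_def ennreal_mult_less_top by simp
next
  fix i j a b
  assume ij: "i < j" "j < m" and a: "a \<in> set_pmf q" "\<tau> j a \<noteq> None" and b: "b \<in> set_pmf q" "\<tau> j b \<noteq> None"
  obtain x where x: "x \<in> space M" "a = cell N x" using q_support[OF a(1)] .
  obtain y where y: "y \<in> space M" "b = cell N y" using q_support[OF b(1)] .
  have i: "i < m" using ij by simp
  have xy: "x \<in> K j" "y \<in> K j"
    using a(2) b(2) x y \<tau>_cell[OF ij(2)] by (auto split: if_splits)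
  have eq: "cell n x = cell n y" if "n \<le> lev j" for n
    by (rule cell_coarser[OF that K_A[OF ij(2)] xy])
  have K_iff: "x \<in> K i \<longleftrightarrow> y \<in> K i"
    using eq[OF lev_mono[of i j]] ij cell_eq_iff[OF K_A[OF i] x(1)] cell_eq_iff[OF K_A[OF i] y(1)] by simp
  have "cell (lev i + 1) x = cell (lev i + 1) y" if "x \<in> K i"
  \<comment> \<open>Two cells of equal level through \<open>x\<close> coincide, contrary to
    distinctness of the list. If the earlier level is strictly lower, its children have level at
    most \<open>lev j\<close>, so one of them contains all of \<open>K j\<close>.\<close>
  proof (cases "lev i = lev j")
    case True
    then have "K i = K j"
      using A_disjoint[OF K_A[OF i], of "K j" x] K_A[OF ij(2)] that xy by simp
    with True have "ks ! i = ks ! j"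
      by (simp add: K_def lev_def prod_eq_iff)
    with ks(1) ij show ?thesis
      by (simp add: nth_eq_iff_index_eq m_def)
  next
    case False
    with lev_mono[of i j] ij show ?thesis by (intro eq) simp
  qed
  then show "\<tau> i a = \<tau> i b"
    using K_iff by (simp add: x y \<tau>_cell[OF i])
qed

lemma \<phi>_cell:
  assumes "j < m" "x \<in> space M"
  shows "\<phi> j (cell N x, c) = f (ks ! j) x"
  using f_eq_val[OF ks_cells[OF assms(1)] assms(2)]
  by (simp add: \<phi>_def \<tau>_cell assms g_def K_def lev_def)

lemma \<psi>_cell:
  assumes "j < m" "x \<in> space M"
  shows "\<psi> j (cell N x, c) = indicator (K j) x *\<^sub>R g j (c j)"
  by (simp add: \<psi>_def \<tau>_cell assms)

text \<open>Undoes the normalisation on \<open>X0\<close>. The original and the decoupled norm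
  acquire the same factor this way.\<close>

lemma nn_integral_M:
  assumes "\<And>x. x \<in> space M - X0 \<Longrightarrow> h (cell N x) = 0"
  shows "(\<integral>\<^sup>+x. h (cell N x) \<partial>M) = ennreal (measure M X0) * (\<integral>\<^sup>+a. h a \<partial>measure_pmf q)"
proof -
  have "ennreal (measure M X0) * (\<integral>\<^sup>+a. h a \<partial>measure_pmf q) = (\<integral>\<^sup>+x. h (cell N x) * indicator X0 x \<partial>M)"
    using measure_X0_pos by (simp add: nn_integral_q mult.assoc[symmetric] flip: ennreal_mult)
  also have "\<dots> = (\<integral>\<^sup>+x. h (cell N x) \<partial>M)"
    using assms by (intro nn_integral_cong) (auto split: split_indicator)
  finally show ?thesis ..
qed

lemma Lp_norm_original:
  assumes p: "0 < p"
  shows "Lp_norm M p (\<lambda>x. \<Sum>j<m. f (ks ! j) x) =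
    ennreal_powr (ennreal (measure M X0)) (1 / p) * Lp_norm (measure_pmf Q) p (\<lambda>x. \<Sum>j<m. \<phi> j x)"
proof -
  define h where "h a = ennreal (norm (\<Sum>j<m. \<phi> j (a, undefined)) powr p)" for a
  have h: "h (cell N x) = ennreal (norm (\<Sum>j<m. f (ks ! j) x) powr p)" if "x \<in> space M" for x
    using that by (simp add: h_def \<phi>_cell)
  have "(\<integral>\<^sup>+x. ennreal (norm (\<Sum>j<m. f (ks ! j) x) powr p) \<partial>M) = (\<integral>\<^sup>+x. h (cell N x) \<partial>M)"
    by (intro nn_integral_cong) (simp add: h)
  also have "\<dots> = ennreal (measure M X0) * (\<integral>\<^sup>+a. h a \<partial>measure_pmf q)"
  proof (rule nn_integral_M)
    fix x assume x: "x \<in> space M - X0"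
    then have "(\<Sum>j<m. f (ks ! j) x) = 0"
      by (intro sum.neutral ballI f_off ks_cells) (auto simp: X0_def K_def)
    with x show "h (cell N x) = 0" by (simp add: h)
  qed
  also have "(\<integral>\<^sup>+a. h a \<partial>measure_pmf q) = (\<integral>\<^sup>+x. ennreal (norm (\<Sum>j<m. \<phi> j x) powr p) \<partial>measure_pmf Q)"
    unfolding Q_def nn_integral_pair_pmf' by (simp add: h_def \<phi>_def)
  finally show ?thesis
    unfolding Lp_norm_def using p by (simp add: ennreal_powr_mult)
qed

text \<open>The value \<open>undefined\<close> beyond \<open>m\<close> matches the default of
  \<open>Pi_pmf {..<m} undefined\<close>, so that laws on functions can be compared
  literally.\<close>

definition children :: "(int \<times> 'x set \<Rightarrow> 'x) \<Rightarrow> nat \<Rightarrow> 'x set" where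
  "children y j = (if j < m then cell (lev j + 1) (y (ks ! j)) else undefined)"

lemma \<nu>_support:
  assumes "j < m"
  shows "set_pmf (\<nu> j) = child A (ks ! j)"
proof
  show "set_pmf (\<nu> j) \<subseteq> child A (ks ! j)"
  proof
    fix t assume "t \<in> set_pmf (\<nu> j)"
    then obtain x where "x \<in> K j" "cell (lev j + 1) x = t"
      unfolding \<nu>_def using set_lawD[OF K_sets(1-3)[OF assms] countably_valued_cell] by blast
    with cell_child[OF ks_cells[OF assms], of x] show "t \<in> child A (ks ! j)"
      by (simp add: K_def lev_def)
  qed
  show "child A (ks ! j) \<subseteq> set_pmf (\<nu> j)"
    using law_child(2)[OF ks_cells[OF assms]] by (auto simp: \<nu>_def K_def lev_def)
qed

lemma inj_ks: "inj_on ((!) ks) {..<m}"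
  using ks(1) by (simp add: inj_on_def nth_eq_iff_index_eq m_def)

lemma image_ks: "(!) ks ` {..<m} = set ks"
  unfolding set_conv_nth m_def by auto

text \<open>A fibre is the cylinder that prescribes one child in each listed coordinate, and the
  product measure of a cylinder is the product of the probabilities of these children.\<close>

lemma children_fiber:
  assumes c: "c \<in> set_pmf (Pi_pmf {..<m} undefined \<nu>)"
  shows "children -` {c} \<inter> space Y \<in> sets Y"
    and "emeasure Y (children -` {c} \<inter> space Y) = ennreal (pmf (Pi_pmf {..<m} undefined \<nu>) c)"
proof -
  have c_child: "c j \<in> child A (ks ! j)" if "j < m" for j
    using c that by (auto simp: set_Pi_pmf PiE_dflt_def \<nu>_support)
  have c_undef: "c j = undefined" if "\<not> j < m" for j
    using c that by (auto simp: set_Pi_pmf PiE_dflt_def)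
  define D where "D k = c (the_inv_into {..<m} ((!) ks) k)" for k
  have D: "D (ks ! j) = c j" if "j < m" for j
    using that by (simp add: D_def the_inv_into_f_f[OF inj_ks])
  have D_sets: "D k \<in> sets (cell_space M A k)" if "k \<in> set ks" for k
    using that c_child D by (auto simp: in_set_conv_nth m_def intro!: child_in_cell_space)
  have "children -` {c} \<inter> space Y = prod_emb (cells A) (cell_space M A) (set ks) (Pi\<^sub>E (set ks) D)"
  proof -
    have "children y = c \<longleftrightarrow> (\<forall>k\<in>set ks. y k \<in> D k)" if y: "y \<in> space Y" for y
    proof -
      have "cell (lev j + 1) (y (ks ! j)) = c j \<longleftrightarrow> y (ks ! j) \<in> D (ks ! j)" if "j < m" for j
        using child_fiber[OF ks_cells[OF that] c_child[OF that]] Y_in[OF y ks_cells[OF that]] D[OF that]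
        by (auto simp: lev_def)
      then show ?thesis
        unfolding image_ks[symmetric] using c_undef by (auto simp: children_def fun_eq_iff)
    qed
    moreover have "y \<in> prod_emb (cells A) (cell_space M A) (set ks) (Pi\<^sub>E (set ks) D) \<longleftrightarrow>
        y \<in> space Y \<and> (\<forall>k\<in>set ks. y k \<in> D k)" for y
      by (auto simp: prod_emb_iff space_PiM PiE_iff)
    ultimately show ?thesis by blast
  qed
  note fiber = this
  show "children -` {c} \<inter> space Y \<in> sets Y"
    unfolding fiber using ks(3) D_sets by (intro sets_PiM_I) auto
  have "emeasure Y (children -` {c} \<inter> space Y) = (\<Prod>k\<in>set ks. emeasure (cell_space M A k) (D k))"
    unfolding fiber using ks(3) D_sets by (intro emeasure_PiM_emb prob_space_cell_space) auto
  also have "\<dots> = (\<Prod>j<m. emeasure (cell_space M A (ks ! j)) (D (ks ! j)))"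
    unfolding image_ks[symmetric] by (simp add: prod.reindex[OF inj_ks])
  also have "\<dots> = (\<Prod>j<m. ennreal (pmf (\<nu> j) (c j)))"
    using law_child(1)[OF ks_cells c_child]
    by (intro prod.cong refl) (simp add: D \<nu>_def K_def lev_def)
  also have "\<dots> = ennreal (pmf (Pi_pmf {..<m} undefined \<nu>) c)"
    using c_undef by (simp add: pmf_Pi prod_ennreal)
  finally show "emeasure Y (children -` {c} \<inter> space Y) = ennreal (pmf (Pi_pmf {..<m} undefined \<nu>) c)" .
qed

lemma nn_integral_Y: "(\<integral>\<^sup>+y. h (children y) \<partial>Y) = (\<integral>\<^sup>+c. h c \<partial>measure_pmf (Pi_pmf {..<m} undefined \<nu>))"
proof -
  let ?T = "set_pmf (Pi_pmf {..<m} undefined \<nu>)"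
  have in_T: "children y \<in> ?T" if "y \<in> space Y" for y
    using cell_child[OF ks_cells Y_in[OF that ks_cells]]
    by (auto simp: set_Pi_pmf PiE_dflt_def \<nu>_support children_def lev_def)
  have cv: "countably_valued Y children"
    by (rule countably_valued_fibersI[OF countable_set_pmf in_T children_fiber(1)])
  have "(\<integral>\<^sup>+y. h (children y) \<partial>Y) = (\<integral>\<^sup>+c. h c * emeasure Y (children -` {c} \<inter> space Y) \<partial>count_space ?T)"
    using in_T by (intro nn_integral_fibers[OF cv]) auto
  also have "\<dots> = (\<integral>\<^sup>+c. ennreal (pmf (Pi_pmf {..<m} undefined \<nu>) c) * h c \<partial>count_space ?T)"
    by (intro nn_integral_cong) (simp add: children_fiber(2) mult.commute)
  also have "\<dots> = (\<integral>\<^sup>+c. ennreal (pmf (Pi_pmf {..<m} undefined \<nu>) c) * h c \<partial>count_space UNIV)"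
    by (rule nn_integral_count_space_eq) (simp_all add: set_pmf_iff)
  finally show ?thesis by (simp add: nn_integral_measure_pmf)
qed

lemma Lp_norm_decoupled:
  assumes p: "0 < p"
  shows "Lp_norm (M \<Otimes>\<^sub>M Y) p (\<lambda>z. \<Sum>j<m. case z of (x, y) \<Rightarrow> (e j * indicator (K j) x) *\<^sub>R f (ks ! j) (y (ks ! j))) =
    ennreal_powr (ennreal (measure M X0)) (1 / p) * Lp_norm (measure_pmf Q) p (\<lambda>x. \<Sum>j<m. e j *\<^sub>R \<psi> j x)"
proof -
  interpret Y: prob_space Y by (rule prob_space_Y)
  define D where "D z = (\<Sum>j<m. case z of (x, y) \<Rightarrow> (e j * indicator (K j) x) *\<^sub>R f (ks ! j) (y (ks ! j)))" for z
  define h where "h a = (\<integral>\<^sup>+c. ennreal (norm (\<Sum>j<m. e j *\<^sub>R \<psi> j (a, c)) powr p) \<partial>measure_pmf (Pi_pmf {..<m} undefined \<nu>))" for a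
  have cvD: "countably_valued (M \<Otimes>\<^sub>M Y) D"
    unfolding D_def
    using countably_valued_decoupled[OF ks_cells] by (intro countably_valued_sum) (auto simp: K_def)
  have [measurable]: "(\<lambda>z. norm (D z)) \<in> borel_measurable (M \<Otimes>\<^sub>M Y)"
    by (rule countably_valued_norm[OF cvD])
  have D_eq: "D (x, y) = (\<Sum>j<m. e j *\<^sub>R \<psi> j (cell N x, children y))" if "x \<in> space M" "y \<in> space Y" for x y
    unfolding D_def
  proof (intro sum.cong refl)
    fix j assume "j \<in> {..<m}"
    then have j: "j < m" by simp
    have "f (ks ! j) (y (ks ! j)) = g j (children y j)"
      using val_cell[OF ks_cells[OF j] Y_in[OF that(2) ks_cells[OF j]]] j
      by (simp add: g_def children_def lev_def)
    then show "(case (x, y) of (x, y) \<Rightarrow> (e j * indicator (K j) x) *\<^sub>R f (ks ! j) (y (ks ! j))) =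
        e j *\<^sub>R \<psi> j (cell N x, children y)"
      by (simp add: \<psi>_cell[OF j that(1)])
  qed
  have "(\<integral>\<^sup>+z. ennreal (norm (D z) powr p) \<partial>(M \<Otimes>\<^sub>M Y)) = (\<integral>\<^sup>+x. \<integral>\<^sup>+y. ennreal (norm (D (x, y)) powr p) \<partial>Y \<partial>M)"
    by (rule Y.nn_integral_fst[symmetric]) measurable
  also have "\<dots> = (\<integral>\<^sup>+x. \<integral>\<^sup>+y. ennreal (norm (\<Sum>j<m. e j *\<^sub>R \<psi> j (cell N x, children y)) powr p) \<partial>Y \<partial>M)"
    by (intro nn_integral_cong) (simp add: D_eq)
  also have "\<dots> = (\<integral>\<^sup>+x. h (cell N x) \<partial>M)"
    unfolding h_def
    by (intro nn_integral_cong nn_integral_Y[of "\<lambda>c. ennreal (norm (\<Sum>j<m. e j *\<^sub>R \<psi> j (cell N _, c)) powr p)"])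
  also have "\<dots> = ennreal (measure M X0) * (\<integral>\<^sup>+a. h a \<partial>measure_pmf q)"
  proof (rule nn_integral_M)
    fix x assume x: "x \<in> space M - X0"
    then have "(\<Sum>j<m. e j *\<^sub>R \<psi> j (cell N x, c)) = 0" for c
      by (intro sum.neutral) (auto simp: \<psi>_cell X0_def)
    then show "h (cell N x) = 0" by (simp add: h_def)
  qed
  also have "(\<integral>\<^sup>+a. h a \<partial>measure_pmf q) = (\<integral>\<^sup>+x. ennreal (norm (\<Sum>j<m. e j *\<^sub>R \<psi> j x) powr p) \<partial>measure_pmf Q)"
    unfolding Q_def nn_integral_pair_pmf' h_def ..
  finally have "Lp_norm (M \<Otimes>\<^sub>M Y) p D = ennreal_powr (ennreal (measure M X0)) (1 / p) * Lp_norm (measure_pmf Q) p (\<lambda>x. \<Sum>j<m. e j *\<^sub>R \<psi> j x)"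
    unfolding Lp_norm_def using p by (simp add: ennreal_powr_mult)
  then show ?thesis
    by (simp only: D_def[abs_def])
qed

end

context cell_functions
begin

lemma finite_decoupling:
  assumes U: "UMD TYPE('e) p" and p: "1 \<le> p" and T: "finite T" "T \<subseteq> cells A"
    and e: "\<And>k. k \<in> cells A \<Longrightarrow> e k \<in> {-1, 1 :: real}"
  shows "Lp_norm M p (\<lambda>x. \<Sum>k\<in>T. f k x) \<le> ennreal (UMD_const TYPE('e) p) *
      Lp_norm (M \<Otimes>\<^sub>M Y) p (\<lambda>z. \<Sum>k\<in>T. case z of (x, y) \<Rightarrow> (e k * indicator (snd k) x) *\<^sub>R f k (y k))" (is "?l \<le> ?b * ?r")
    and "Lp_norm (M \<Otimes>\<^sub>M Y) p (\<lambda>z. \<Sum>k\<in>T. case z of (x, y) \<Rightarrow> (e k * indicator (snd k) x) *\<^sub>R f k (y k))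
      \<le> ennreal (UMD_const TYPE('e) p) * Lp_norm M p (\<lambda>x. \<Sum>k\<in>T. f k x)"
proof -
  have "?l \<le> ?b * ?r \<and> ?r \<le> ?b * ?l"
  proof (cases "T = {}")
    case False
    obtain xs where xs: "set xs = T" "distinct xs"
      using finite_distinct_list[OF T(1)] by blast
    define ks where "ks = sort_key fst xs"
    have ks_T: "set ks = T" "distinct ks" "sorted (map fst ks)"
      using xs by (auto simp: ks_def)
    then have "ks \<noteq> []" using False by auto
    interpret finitely_many_cells M A f ks
      by unfold_locales (use ks_T \<open>ks \<noteq> []\<close> T in auto)
    have bij: "bij_betw ((!) ks) {..<m} T"
      using inj_ks image_ks ks_T(1) by (simp add: bij_betw_def)
    have l: "?l = ennreal_powr (ennreal (measure M X0)) (1 / p) * Lp_norm (measure_pmf Q) p (\<lambda>x. \<Sum>j<m. \<phi> j x)"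
      using Lp_norm_original[of p] p by (simp add: sum.reindex_bij_betw[OF bij, of "\<lambda>k. f k _"])
    have r: "?r = ennreal_powr (ennreal (measure M X0)) (1 / p) *
        Lp_norm (measure_pmf Q) p (\<lambda>x. \<Sum>j<m. e (ks ! j) *\<^sub>R \<psi> j x)"
      using Lp_norm_decoupled[of p "\<lambda>j. e (ks ! j)"] p
      by (simp add: K_def sum.reindex_bij_betw[OF bij, of "\<lambda>k. case _ of (x, y) \<Rightarrow> (e k * indicator (snd k) x) *\<^sub>R f k (y k)"])
    have e': "\<forall>j<m. e (ks ! j) \<in> {-1, 1}"
      using e ks_cells by blast
    show ?thesis
      unfolding l r using discrete_decoupling_inequality[OF U p e']
      by (auto simp: mult.left_commute[of ?b] intro: mult_left_mono)
  qed simp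
  then show "?l \<le> ?b * ?r" "?r \<le> ?b * ?l" by auto
qed

lemma decoupling:
  assumes U: "UMD TYPE('e) p" and p: "1 \<le> p"
    and e: "\<And>k. k \<in> cells A \<Longrightarrow> e k \<in> {-1, 1 :: real}"
  defines "h \<equiv> \<lambda>k (x, y). (e k * indicator (snd k) x) *\<^sub>R f k (y k)"
  shows "Lp_norm_sum M p f (cells A) \<le> ennreal (UMD_const TYPE('e) p) * Lp_norm_sum (M \<Otimes>\<^sub>M Y) p h (cells A)"
    and "Lp_norm_sum (M \<Otimes>\<^sub>M Y) p h (cells A) \<le> ennreal (UMD_const TYPE('e) p) * Lp_norm_sum M p f (cells A)"
proof -
  have h: "countably_valued (M \<Otimes>\<^sub>M Y) (h k)" if "k \<in> cells A" for k
    unfolding h_def by (rule countably_valued_decoupled[OF that])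
  note finite = finite_decoupling[where e=e, OF U p _ _ e]
  show "Lp_norm_sum M p f (cells A) \<le> ennreal (UMD_const TYPE('e) p) * Lp_norm_sum (M \<Otimes>\<^sub>M Y) p h (cells A)"
    by (rule Lp_norm_sum_compare[OF p UMD_const_nonneg[OF U] countably_valued_f h])
      (simp_all add: h_def finite(1))
  show "Lp_norm_sum (M \<Otimes>\<^sub>M Y) p h (cells A) \<le> ennreal (UMD_const TYPE('e) p) * Lp_norm_sum M p f (cells A)"
    by (rule Lp_norm_sum_compare[OF p UMD_const_nonneg[OF U] h countably_valued_f])
      (simp_all add: h_def finite(2))
qed

end

theorem theorem3p1:
  fixes p :: real
    and M :: "'x measure"
    and A :: "int \<Rightarrow> 'x set set"
    and f :: "int \<times> 'x set \<Rightarrow> 'x \<Rightarrow> 'e::banach"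
    and P :: "'w measure"
    and \<epsilon> :: "int \<times> 'x set \<Rightarrow> 'w \<Rightarrow> real"
  assumes "1 < p"
    and "UMD TYPE('e) p"
    and "sigma_finite_measure M"
    and "\<And>n. countable (A n)"
    and "\<And>n. refines (space M) (A (n + 1)) (A n)"
    and "\<And>n K. K \<in> A n \<Longrightarrow> K \<in> sets M \<and> 0 < emeasure M K \<and> emeasure M K < \<infinity>"
    and "\<And>k x. k \<in> cells A \<Longrightarrow> x \<in> space M - snd k \<Longrightarrow> f k x = 0"
    and "\<And>k K'. k \<in> cells A \<Longrightarrow> K' \<in> child A k \<Longrightarrow> f k constant_on K'"
    and "\<And>k. k \<in> cells A \<Longrightarrow> has_strong_integral M (\<lambda>x. indicator (snd k) x *\<^sub>R f k x) 0"
    and "random_signs P (cells A) \<epsilon>"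
  shows "ennreal (1 / UMD_const TYPE('e) p) * decoupled_norm P \<epsilon> M A p f
           \<le> Lp_norm_sum M p f (cells A)
       \<and> Lp_norm_sum M p f (cells A)
           \<le> ennreal (UMD_const TYPE('e) p) * decoupled_norm P \<epsilon> M A p f"
proof -
  interpret cell_functions M A f
    by unfold_locales (use assms in auto)
  interpret P: prob_space P
    using assms(10) by (simp add: random_signs_def)
  define \<beta> where "\<beta> = UMD_const TYPE('e) p"
  have \<beta>: "0 \<le> \<beta>"
    unfolding \<beta>_def by (rule UMD_const_nonneg[OF assms(2)])
  define U where "U = Lp_norm_sum M p f (cells A)"
  define V where "V \<omega> = Lp_norm_sum (M \<Otimes>\<^sub>M Y) p
      (\<lambda>k (x, y). (\<epsilon> k \<omega> * indicator (snd k) x) *\<^sub>R f k (y k)) (cells A)" for \<omega>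
  define D where "D = decoupled_norm P \<epsilon> M A p f"
  have D: "D = ennreal_powr (\<integral>\<^sup>+\<omega>. ennreal_powr (V \<omega>) p \<partial>P) (1 / p)"
    by (simp add: D_def decoupled_norm_def V_def)
  have signs: "\<epsilon> k \<omega> \<in> {-1, 1}" if "k \<in> cells A" "\<omega> \<in> space P" for k \<omega>
    using assms(10) that by (simp add: random_signs_def)
  have UV: "U \<le> ennreal \<beta> * V \<omega>" and VU: "V \<omega> \<le> ennreal \<beta> * U" if "\<omega> \<in> space P" for \<omega>
    unfolding U_def V_def \<beta>_def
    using decoupling[of p "\<lambda>k. \<epsilon> k \<omega>"] assms(1,2) signs[OF _ that] by auto
  have const: "ennreal_powr (\<integral>\<^sup>+\<omega>. ennreal_powr c p \<partial>P) (1 / p) = c" for c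
    using assms(1) by (simp add: P.emeasure_space_1 ennreal_powr_powr)
  have cancel: "ennreal (1 / \<beta>) * (ennreal \<beta> * c) \<le> c" for c
    using \<beta> by (cases "\<beta> = 0") (simp_all add: mult.assoc[symmetric] flip: ennreal_mult)
  have "D \<le> ennreal \<beta> * U"
  proof -
    have "D \<le> ennreal_powr (\<integral>\<^sup>+\<omega>. ennreal_powr (ennreal \<beta> * U) p \<partial>P) (1 / p)"
      unfolding D using assms(1) by (intro ennreal_powr_mono nn_integral_mono VU) auto
    then show ?thesis unfolding const .
  qed
  then have "ennreal (1 / \<beta>) * D \<le> U"
    using cancel[of U] by (meson mult_left_mono order_trans zero_le)
  moreover have "U \<le> ennreal \<beta> * D"
  proof (cases "\<beta> = 0")
    case True
    obtain \<omega> where "\<omega> \<in> space P" using P.not_empty by blast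
    from UV[OF this] True show ?thesis by simp
  next
    case False
    have "ennreal (1 / \<beta>) * U \<le> V \<omega>" if "\<omega> \<in> space P" for \<omega>
      using UV[OF that] cancel[of "V \<omega>"] by (meson mult_left_mono order_trans zero_le)
    then have "ennreal_powr (\<integral>\<^sup>+\<omega>. ennreal_powr (ennreal (1 / \<beta>) * U) p \<partial>P) (1 / p) \<le> D"
      unfolding D using assms(1) by (intro ennreal_powr_mono nn_integral_mono) auto
    then have "ennreal \<beta> * (ennreal (1 / \<beta>) * U) \<le> ennreal \<beta> * D"
      unfolding const by (rule mult_left_mono) simp
    then show ?thesis
      using False \<beta> by (simp add: mult.assoc[symmetric] flip: ennreal_mult)
  qed
  ultimately show ?thesis
    by (simp add: U_def D_def \<beta>_def)
qed

end
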